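(* Let $E$ be an effect algebra with RDP and let $I$ be a lexicographic ideal of $E$. Then there is an Abelian antilattice unital po-group $(H,u)$ with RDP such that $E/I\cong\Gamma(H,u)$, and there is an Abelian nontrivial directed po-group $G$ with RDP and with $\langle I\rangle\cong\Gamma(\mathbb Z\overrightarrow{\times}G,(1,0))$, such that $E\cong\Gamma(H\overrightarrow{\times}G,(u,0))$. Conversely, if $E\cong\Gamma(H\overrightarrow{\times}G,(u,0))$, where $(H,u)$ is a nontrivial Abelian antilattice unital po-group with RDP and $G$ is an Abelian nontrivial directed po-group with RDP, then $E$ has a lexicographic ideal $I$ such that $E/I\cong\Gamma(H,u)$ and $\langle I\rangle\cong\Gamma(\mathbb Z\overrightarrow{\times}G,(1,0))$.
   Context: An effect algebra is a partial algebra $(E;+,0,1)$ with a partial binary operation $+$ such that for all $a,b,c\in E$: (i) $a+b$ is defined iff $b+a$ is, and then $a+b=b+a$; (ii) $a+b$ and $(a+b)+c$ are defined iff $b+c$ and $a+(b+c)$ are, and then $(a+b)+c=a+(b+c)$; (iii) there is a unique $a^-\in E$ with $a+a^-=1$; (iv) if $a+1$ is defined then $a=0$. The order is $a\le b$ iff $a+c=b$ for some $c\in E$ (then $c=:b-a$). A homomorphism $h:E\to F$ satisfies $h(1)=1$ and, whenever $a+b$ is defined, $h(a)+h(b)$ is defined and equals $h(a+b)$; an isomorphism ($\cong$) is a bijection that is a homomorphism together with its inverse. An effect subalgebra of $E$ is a subset containing $1$, closed under $^-$ and under existing sums. A po-group is a group $(G;+,0)$ with a partial order such that $g\le h$ implies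 $k+g+f\le k+h+f$; $G^+=\{g:g\ge 0\}$. It is directed if any two elements have a common upper bound. A strong unit is $u\in G^+$ such that each $g\in G$ satisfies $g\le nu$ for some integer $n\ge0$; $(G,u)$ is then a unital po-group. For an Abelian po-group and $u\in G^+$, $\Gamma(G,u)=\{g:0\le g\le u\}$ is an effect algebra with $a+b$ defined iff $a\le u-b$, being then the group sum, and with top $u$. A poset is an antilattice if only comparable pairs of elements have an infimum or a supremum. RDP for an Abelian po-group $G$ (resp. an effect algebra $E$): whenever $a_1+a_2=b_1+b_2$ with all elements in $G^+$ (resp. $E$), there are $c_{11},c_{12},c_{21},c_{22}$ in $G^+$ (resp. $E$) with $a_1=c_{11}+c_{12}$, $a_2=c_{21}+c_{22}$, $b_1=c_{11}+c_{21}$, $b_2=c_{12}+c_{22}$. The lexicographic product $H\overrightarrow{\times}G$ is the group $H\times G$ with the order $(h_1,g_1)\le(h_2,g_2)$ iff $h_1<h_2$, or $h_1=h_2$ and $g_1\le g_2$. An ideal of $E$ is a nonempty $I\subseteq E$ with: $a\le b\in I\Rightarrow a\in I$; $a,b\in I$ and $a+b$ defined $\Rightarrow a+b\in I$. $I_0(a)$ denotes the ideal generated by $a$; $\langle I\rangle$ denotes the effect subalgebra of $E$ generated by $I$. $I$ is prime if $I_0(x)\cap I_0(y)\subseteq I$ implies $x\in I$ or $y\in I$. For $E$ with RDP and an ideal $I$, $a\sim_I b$ iff there are $e,f\in I$, $e\le a$, $f\le b$, with $a-e=b-f$; $E/I=\{x/I:x\in E\}$ is the quotient effect algebra and $\pi_I:E\to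 E/I$ the canonical projection. An ideal $I$ with $\{0\}\ne I\ne E$ is lexicographic if (i) $I$ is strict: $x/I<y/I$ implies $x<y$; (ii) $I$ is retractive: there is a homomorphism $\delta_I:E/I\to E$ with $\pi_I\circ\delta_I=\mathrm{id}_{E/I}$; (iii) $I$ is prime. *)

theory Defs
  imports "HOL-Algebra.Elementary_Groups"
begin

section \<open>Effect algebras\<close>

text \<open>The partial sum takes values in an option type; \<^term>\<open>None\<close> means that the sum is
  undefined. Its values outside the carrier are irrelevant.\<close>

record 'a effalg = "'a partial_object" +
  ea_plus :: "'a \<Rightarrow> 'a \<Rightarrow> 'a option"  (infixl \<open>\<boxplus>\<index>\<close> 65)
  ea_zero :: 'a
  ea_one :: 'a

locale effect_algebra =
  fixes E :: "'a effalg" (structure)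
  assumes zero_closed: "ea_zero E \<in> carrier E"
    and one_closed: "ea_one E \<in> carrier E"
    and plus_closed: "\<lbrakk>a \<in> carrier E; b \<in> carrier E; a \<boxplus> b = Some c\<rbrakk> \<Longrightarrow> c \<in> carrier E"
    and plus_commute: "\<lbrakk>a \<in> carrier E; b \<in> carrier E\<rbrakk> \<Longrightarrow> a \<boxplus> b = b \<boxplus> a"
    and plus_assoc: "\<lbrakk>a \<in> carrier E; b \<in> carrier E; c \<in> carrier E\<rbrakk>
      \<Longrightarrow> Option.bind (a \<boxplus> b) (\<lambda>x. x \<boxplus> c) = Option.bind (b \<boxplus> c) (\<lambda>y. a \<boxplus> y)"
    and ex1_complement: "a \<in> carrier E \<Longrightarrow> \<exists>!x. x \<in> carrier E \<and> a \<boxplus> x = Some (ea_one E)"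
    and plus_one_defined: "\<lbrakk>a \<in> carrier E; a \<boxplus> ea_one E \<noteq> None\<rbrakk> \<Longrightarrow> a = ea_zero E"

definition ea_compl :: "'a effalg \<Rightarrow> 'a \<Rightarrow> 'a" where
  "ea_compl E a = (THE x. x \<in> carrier E \<and> a \<boxplus>\<^bsub>E\<^esub> x = Some (ea_one E))"

definition ea_le :: "'a effalg \<Rightarrow> 'a \<Rightarrow> 'a \<Rightarrow> bool" where
  "ea_le E a b \<longleftrightarrow> a \<in> carrier E \<and> b \<in> carrier E \<and> (\<exists>c\<in>carrier E. a \<boxplus>\<^bsub>E\<^esub> c = Some b)"

definition ea_less :: "'a effalg \<Rightarrow> 'a \<Rightarrow> 'a \<Rightarrow> bool" where
  "ea_less E a b \<longleftrightarrow> ea_le E a b \<and> a \<noteq> b"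

text \<open>\<open>ea_diff E b a\<close> is \<open>b - a\<close>; it is meaningful only for \<open>a \<le> b\<close>.\<close>

definition ea_diff :: "'a effalg \<Rightarrow> 'a \<Rightarrow> 'a \<Rightarrow> 'a" where
  "ea_diff E b a = (THE c. c \<in> carrier E \<and> a \<boxplus>\<^bsub>E\<^esub> c = Some b)"

definition ea_hom :: "'a effalg \<Rightarrow> 'b effalg \<Rightarrow> ('a \<Rightarrow> 'b) set" where
  "ea_hom E F = {h. h \<in> carrier E \<rightarrow> carrier F \<and> h (ea_one E) = ea_one F \<and>
     (\<forall>a\<in>carrier E. \<forall>b\<in>carrier E. \<forall>c. a \<boxplus>\<^bsub>E\<^esub> b = Some c \<longrightarrow> h a \<boxplus>\<^bsub>F\<^esub> h b = Some (h c))}"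

definition ea_iso :: "'a effalg \<Rightarrow> 'b effalg \<Rightarrow> ('a \<Rightarrow> 'b) set" where
  "ea_iso E F = {h. h \<in> ea_hom E F \<and> bij_betw h (carrier E) (carrier F) \<and>
     inv_into (carrier E) h \<in> ea_hom F E}"

definition ea_isomorphic :: "'a effalg \<Rightarrow> 'b effalg \<Rightarrow> bool"  (infix \<open>\<cong>\<^sub>e\<close> 50) where
  "E \<cong>\<^sub>e F \<longleftrightarrow> ea_iso E F \<noteq> {}"

definition ea_subalgebra :: "'a effalg \<Rightarrow> 'a set \<Rightarrow> bool" where
  "ea_subalgebra E S \<longleftrightarrow> S \<subseteq> carrier E \<and> ea_one E \<in> S \<and> (\<forall>a\<in>S. ea_compl E a \<in> S) \<and>
     (\<forall>a\<in>S. \<forall>b\<in>S. \<forall>c. a \<boxplus>\<^bsub>E\<^esub> b = Some c \<longrightarrow> c \<in> S)"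

definition ea_generated :: "'a effalg \<Rightarrow> 'a set \<Rightarrow> 'a effalg" where
  "ea_generated E X = E\<lparr>carrier := \<Inter>{S. ea_subalgebra E S \<and> X \<subseteq> S}\<rparr>"

definition ea_rdp :: "'a effalg \<Rightarrow> bool" where
  "ea_rdp E \<longleftrightarrow> (\<forall>a1\<in>carrier E. \<forall>a2\<in>carrier E. \<forall>b1\<in>carrier E. \<forall>b2\<in>carrier E.
     a1 \<boxplus>\<^bsub>E\<^esub> a2 \<noteq> None \<and> a1 \<boxplus>\<^bsub>E\<^esub> a2 = b1 \<boxplus>\<^bsub>E\<^esub> b2 \<longrightarrow>
     (\<exists>c11\<in>carrier E. \<exists>c12\<in>carrier E. \<exists>c21\<in>carrier E. \<exists>c22\<in>carrier E.
        c11 \<boxplus>\<^bsub>E\<^esub> c12 = Some a1 \<and> c21 \<boxplus>\<^bsub>E\<^esub> c22 = Some a2 \<and>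
        c11 \<boxplus>\<^bsub>E\<^esub> c21 = Some b1 \<and> c12 \<boxplus>\<^bsub>E\<^esub> c22 = Some b2))"


section \<open>Ideals and quotients\<close>

definition ea_ideal :: "'a effalg \<Rightarrow> 'a set \<Rightarrow> bool" where
  "ea_ideal E I \<longleftrightarrow> I \<subseteq> carrier E \<and> I \<noteq> {} \<and> (\<forall>a b. ea_le E a b \<and> b \<in> I \<longrightarrow> a \<in> I) \<and>
     (\<forall>a\<in>I. \<forall>b\<in>I. \<forall>c. a \<boxplus>\<^bsub>E\<^esub> b = Some c \<longrightarrow> c \<in> I)"

definition ea_principal :: "'a effalg \<Rightarrow> 'a \<Rightarrow> 'a set" where
  "ea_principal E a = \<Inter>{J. ea_ideal E J \<and> a \<in> J}"

definition ea_prime :: "'a effalg \<Rightarrow> 'a set \<Rightarrow> bool" where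
  "ea_prime E I \<longleftrightarrow> (\<forall>x\<in>carrier E. \<forall>y\<in>carrier E.
     ea_principal E x \<inter> ea_principal E y \<subseteq> I \<longrightarrow> x \<in> I \<or> y \<in> I)"

definition ea_cong :: "'a effalg \<Rightarrow> 'a set \<Rightarrow> ('a \<times> 'a) set" where
  "ea_cong E I = {(a, b). a \<in> carrier E \<and> b \<in> carrier E \<and>
     (\<exists>e\<in>I. \<exists>f\<in>I. ea_le E e a \<and> ea_le E f b \<and> ea_diff E a e = ea_diff E b f)}"

definition ea_proj :: "'a effalg \<Rightarrow> 'a set \<Rightarrow> 'a \<Rightarrow> 'a set" where
  "ea_proj E I x = ea_cong E I `` {x}"

text \<open>The sum of two classes is defined iff some representatives are summable, and is then the
  class of their sum. When \<open>E\<close> has RDP and \<open>I\<close> is an ideal, this class does not depend on the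
  representatives, so the union below is a single class.\<close>

definition ea_quot :: "'a effalg \<Rightarrow> 'a set \<Rightarrow> 'a set effalg" where
  "ea_quot E I = \<lparr>carrier = carrier E // ea_cong E I,
     ea_plus = (\<lambda>A B. if \<exists>a\<in>A. \<exists>b\<in>B. a \<boxplus>\<^bsub>E\<^esub> b \<noteq> None
        then Some (\<Union>{ea_proj E I c | c. \<exists>a\<in>A. \<exists>b\<in>B. a \<boxplus>\<^bsub>E\<^esub> b = Some c}) else None),
     ea_zero = ea_proj E I (ea_zero E), ea_one = ea_proj E I (ea_one E)\<rparr>"

definition ea_strict :: "'a effalg \<Rightarrow> 'a set \<Rightarrow> bool" where
  "ea_strict E I \<longleftrightarrow> (\<forall>x\<in>carrier E. \<forall>y\<in>carrier E.
     ea_less (ea_quot E I) (ea_proj E I x) (ea_proj E I y) \<longrightarrow> ea_less E x y)"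

definition ea_retractive :: "'a effalg \<Rightarrow> 'a set \<Rightarrow> bool" where
  "ea_retractive E I \<longleftrightarrow> (\<exists>\<delta>\<in>ea_hom (ea_quot E I) E.
     \<forall>X\<in>carrier (ea_quot E I). ea_proj E I (\<delta> X) = X)"

text \<open>RDP is part of the notion, since only under RDP is the quotient by an ideal available.\<close>

locale lexicographic_ideal = effect_algebra E for E :: "'a effalg" (structure) +
  fixes I :: "'a set"
  assumes rdp: "ea_rdp E"
    and ideal: "ea_ideal E I"
    and not_zero: "I \<noteq> {ea_zero E}"
    and proper: "I \<noteq> carrier E"
    and strict: "ea_strict E I"
    and retractive: "ea_retractive E I"
    and prime: "ea_prime E I"


section \<open>Partially ordered groups\<close>

text \<open>As usual in \<^theory>\<open>HOL-Algebra.Group\<close>, groups are written multiplicatively: the group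
  sum is \<open>\<otimes>\<close>, the neutral element 0 is \<open>\<one>\<close>, and \<open>n u\<close> is \<open>u [^] n\<close>.\<close>

record 'a pogroup = "'a monoid" +
  pg_le :: "'a \<Rightarrow> 'a \<Rightarrow> bool"  (infix \<open>\<preceq>\<index>\<close> 50)

definition pg_order :: "'a pogroup \<Rightarrow> 'a gorder" where
  "pg_order G = \<lparr>carrier = carrier G, eq = (=), le = pg_le G\<rparr>"

locale po_group = group G for G :: "'a pogroup" (structure) +
  assumes order: "partial_order (pg_order G)"
    and translation: "\<lbrakk>g \<in> carrier G; h \<in> carrier G; k \<in> carrier G; f \<in> carrier G; g \<preceq> h\<rbrakk>
      \<Longrightarrow> k \<otimes> g \<otimes> f \<preceq> k \<otimes> h \<otimes> f"

locale abelian_po_group = po_group G + comm_group G for G :: "'a pogroup" (structure)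

definition pg_pos :: "'a pogroup \<Rightarrow> 'a set" where
  "pg_pos G = {g \<in> carrier G. \<one>\<^bsub>G\<^esub> \<preceq>\<^bsub>G\<^esub> g}"

definition pg_nontrivial :: "'a pogroup \<Rightarrow> bool" where
  "pg_nontrivial G \<longleftrightarrow> carrier G \<noteq> {\<one>\<^bsub>G\<^esub>}"

definition pg_directed :: "'a pogroup \<Rightarrow> bool" where
  "pg_directed G \<longleftrightarrow> (\<forall>a\<in>carrier G. \<forall>b\<in>carrier G. \<exists>c\<in>carrier G. a \<preceq>\<^bsub>G\<^esub> c \<and> b \<preceq>\<^bsub>G\<^esub> c)"

definition pg_strong_unit :: "'a pogroup \<Rightarrow> 'a \<Rightarrow> bool" where
  "pg_strong_unit G u \<longleftrightarrow> u \<in> pg_pos G \<and> (\<forall>g\<in>carrier G. \<exists>n::nat. g \<preceq>\<^bsub>G\<^esub> u [^]\<^bsub>G\<^esub> n)"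

definition pg_rdp :: "'a pogroup \<Rightarrow> bool" where
  "pg_rdp G \<longleftrightarrow> (\<forall>a1\<in>pg_pos G. \<forall>a2\<in>pg_pos G. \<forall>b1\<in>pg_pos G. \<forall>b2\<in>pg_pos G.
     a1 \<otimes>\<^bsub>G\<^esub> a2 = b1 \<otimes>\<^bsub>G\<^esub> b2 \<longrightarrow>
     (\<exists>c11\<in>pg_pos G. \<exists>c12\<in>pg_pos G. \<exists>c21\<in>pg_pos G. \<exists>c22\<in>pg_pos G.
        a1 = c11 \<otimes>\<^bsub>G\<^esub> c12 \<and> a2 = c21 \<otimes>\<^bsub>G\<^esub> c22 \<and> b1 = c11 \<otimes>\<^bsub>G\<^esub> c21 \<and> b2 = c12 \<otimes>\<^bsub>G\<^esub> c22))"

definition antilattice :: "'a gorder \<Rightarrow> bool" where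
  "antilattice L \<longleftrightarrow> (\<forall>x\<in>carrier L. \<forall>y\<in>carrier L.
     (\<exists>s. is_lub L s {x, y}) \<or> (\<exists>i. is_glb L i {x, y}) \<longrightarrow> x \<sqsubseteq>\<^bsub>L\<^esub> y \<or> y \<sqsubseteq>\<^bsub>L\<^esub> x)"

definition Gamma :: "'a pogroup \<Rightarrow> 'a \<Rightarrow> 'a effalg" where
  "Gamma G u = \<lparr>carrier = {g \<in> carrier G. \<one>\<^bsub>G\<^esub> \<preceq>\<^bsub>G\<^esub> g \<and> g \<preceq>\<^bsub>G\<^esub> u},
     ea_plus = (\<lambda>a b. if a \<preceq>\<^bsub>G\<^esub> u \<otimes>\<^bsub>G\<^esub> inv\<^bsub>G\<^esub> b then Some (a \<otimes>\<^bsub>G\<^esub> b) else None),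
     ea_zero = \<one>\<^bsub>G\<^esub>, ea_one = u\<rparr>"

definition lex_prod :: "'a pogroup \<Rightarrow> 'b pogroup \<Rightarrow> ('a \<times> 'b) pogroup"  (infixr \<open>\<times>\<^sub>l\<^sub>e\<^sub>x\<close> 80) where
  "H \<times>\<^sub>l\<^sub>e\<^sub>x G = monoid.extend (H \<times>\<times> G) (pogroup.fields
     (\<lambda>(h1, g1) (h2, g2). (h1 \<preceq>\<^bsub>H\<^esub> h2 \<and> h1 \<noteq> h2) \<or> (h1 = h2 \<and> g1 \<preceq>\<^bsub>G\<^esub> g2)))"

definition int_pogroup :: "int pogroup" where
  "int_pogroup = monoid.extend integer_group (pogroup.fields (\<le>))"

text \<open>A statement cannot quantify existentially over types, so an existential claim about po-groups
  has to name the type of their elements. For po-groups obtained from an effect algebra over \<open>'a\<close>,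
  no generality is lost with the following types. If the elements of \<open>H\<close> are differences of finite
  sums of classes \<open>x/I\<close>, then \<open>h\<close> can be encoded as the set of all pairs \<open>(v, w)\<close> of lists over
  \<open>E\<close> whose formal difference represents \<open>h\<close>, of type \<open>('a list \<times> 'a list) set\<close>; if the elements
  of \<open>G\<close> are differences of elements of \<open>I\<close>, then \<open>g\<close> can be encoded as the set of all
  \<open>(x, y)\<close> in \<open>I \<times> I\<close> with \<open>g = x - y\<close>, of type \<open>('a \<times> 'a) set\<close>.\<close>

end

theory Submission
  imports Defs "HOL-Library.Multiset"
begin

text \<open>An effect algebra with RDP embeds into a universal po-group: the words over \<open>E\<close>, taken modulo
  common refinement, form a cancellative conical refinement monoid, whose group of differences has
  \<open>E\<close> as its unit interval. For a lexicographic ideal \<open>I\<close> the retraction gives an idempotent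
  endomorphism \<open>\<rho>\<close> of \<open>E\<close> with kernel \<open>I\<close>, whose image is a copy of \<open>E/I\<close>. Here \<open>H\<close> is the universal
  group of this image, \<open>G\<close> is the group of differences of \<open>I\<close> (where, by strictness, all sums
  exist), and \<open>x\<close> is mapped to \<open>(\<rho> x, x - \<rho> x)\<close>, the difference being taken in the universal group
  of \<open>E\<close>. Strictness makes the order lexicographic, and primeness of \<open>I\<close> makes \<open>H\<close> an antilattice.
  Conversely, in \<open>\<Gamma>(H \<times> G, (u, 0))\<close> the elements with first component \<open>0\<close> form the required ideal;
  RDP of \<open>H\<close> and \<open>G\<close> passes to the product through the Riesz interpolation property, which needs \<open>G\<close> directed.\<close>

section \<open>Effect algebras\<close>

text \<open>Sums in E are partial, so neither E nor the image of \<rho> is a monoid that could be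
  completed to a group at once, whereas in I every sum exists. Hence H is built from words, while G
  consists of plain differences of elements of I. H starts from the image of \<rho> and not from
  E/I, since the elements of the image have type \<open>'a\<close>, which gives the element type
  \<open>('a list \<times> 'a list) set\<close>. The difference x - \<rho> x belongs to G because x
  and \<rho> x are congruent modulo I: they are r + e and r + f with a common r and with e, f in I,
  so the difference is e - f. The universal group of E is only the place where such equations are
  manipulated; it is faithful in the strong sense that an equation c = a + b between images of
  elements of E forces the partial sum a + b to be defined in E. Both implications lead to the same
  situation, an effect algebra presented as an interval of a lexicographic product. There the ideal
  of elements with first component 0, its quotient and its generated subalgebra are computed once
  for both.\<close>

context effect_algebra
begin

text \<open>The partial sum extended to options, where it is associative and commutative without side
  conditions; \<open>None\<close> is absorbing.\<close>

definition osum :: "'a option \<Rightarrow> 'a option \<Rightarrow> 'a option"  (infixl \<open>\<uplus>\<close> 65) where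
  "A \<uplus> B = Option.bind A (\<lambda>a. Option.bind B (\<lambda>b.
     if a \<in> carrier E \<and> b \<in> carrier E then a \<boxplus> b else None))"

lemma osum_None [simp]: "None \<uplus> A = None" "A \<uplus> None = None"
  by (auto simp: osum_def split: bind_splits)

lemma osum_Some: "a \<in> carrier E \<Longrightarrow> b \<in> carrier E \<Longrightarrow> Some a \<uplus> Some b = a \<boxplus> b"
  by (simp add: osum_def)

lemma osum_Some_iff:
  "Some a \<uplus> Some b = Some c \<longleftrightarrow> a \<in> carrier E \<and> b \<in> carrier E \<and> a \<boxplus> b = Some c"
  by (auto simp: osum_def)

lemma osum_closed:
  assumes "Some a \<uplus> Some b = Some c"
  shows "a \<in> carrier E" "b \<in> carrier E" "c \<in> carrier E"
  using assms plus_closed unfolding osum_Some_iff by blast+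

lemma osum_eq_SomeE:
  assumes "A \<uplus> B = Some c"
  obtains a b where "A = Some a" "B = Some b" "a \<in> carrier E" "b \<in> carrier E" "c \<in> carrier E"
    "a \<boxplus> b = Some c"
proof -
  obtain a b where ab: "A = Some a" "B = Some b"
    using assms by (cases A; cases B) auto
  from assms have "Some a \<uplus> Some b = Some c" by (simp add: ab)
  then have "a \<in> carrier E" "b \<in> carrier E" "c \<in> carrier E" "a \<boxplus> b = Some c"
    using osum_closed osum_Some_iff by blast+
  then show thesis by (rule that[OF ab])
qed

lemma osum_commute: "A \<uplus> B = B \<uplus> A"
  by (cases A; cases B) (auto simp: osum_def plus_commute)

lemma osum_not_NoneD: "A \<uplus> B \<noteq> None \<Longrightarrow> A \<in> Some ` carrier E \<and> B \<in> Some ` carrier E"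
  by (cases A; cases B) (auto simp: osum_def split: if_splits)

lemma osum_assoc: "A \<uplus> B \<uplus> C = A \<uplus> (B \<uplus> C)"
proof (cases "A \<in> Some ` carrier E \<and> B \<in> Some ` carrier E \<and> C \<in> Some ` carrier E")
  case True
  obtain a where a: "A = Some a" "a \<in> carrier E" using True by blast
  obtain b where b: "B = Some b" "b \<in> carrier E" using True by blast
  obtain c where c: "C = Some c" "c \<in> carrier E" using True by blast
  have "A \<uplus> B \<uplus> C = Option.bind (a \<boxplus> b) (\<lambda>x. x \<boxplus> c)"
  proof (cases "a \<boxplus> b")
    case (Some x)
    with plus_closed[of a b x] a b c show ?thesis by (simp add: osum_Some)
  qed (use a b in \<open>simp add: osum_Some\<close>)
  also have "\<dots> = Option.bind (b \<boxplus> c) (\<lambda>y. a \<boxplus> y)"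
    using a b c by (intro plus_assoc)
  also have "\<dots> = A \<uplus> (B \<uplus> C)"
  proof (cases "b \<boxplus> c")
    case (Some x)
    with plus_closed[of b c x] a b c show ?thesis by (simp add: osum_Some)
  qed (use b c in \<open>simp add: osum_Some\<close>)
  finally show ?thesis .
next
  case False
  have "A \<uplus> B \<uplus> C = None"
  proof (rule ccontr)
    assume *: "A \<uplus> B \<uplus> C \<noteq> None"
    then have "A \<uplus> B \<noteq> None" by (cases "A \<uplus> B") simp_all
    with * False show False using osum_not_NoneD by blast
  qed
  moreover have "A \<uplus> (B \<uplus> C) = None"
  proof (rule ccontr)
    assume *: "A \<uplus> (B \<uplus> C) \<noteq> None"
    then have "B \<uplus> C \<noteq> None" by (cases "B \<uplus> C") simp_all
    with * False show False using osum_not_NoneD by blast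
  qed
  ultimately show ?thesis by simp
qed

lemma osum_left_commute: "A \<uplus> (B \<uplus> C) = B \<uplus> (A \<uplus> C)"
  by (metis osum_assoc osum_commute)

lemmas osum_ac = osum_assoc osum_commute osum_left_commute

abbreviation zero :: 'a  (\<open>\<zero>\<^sub>E\<close>) where "\<zero>\<^sub>E \<equiv> ea_zero E"
abbreviation one :: 'a  (\<open>\<one>\<^sub>E\<close>) where "\<one>\<^sub>E \<equiv> ea_one E"

lemma compl:
  assumes "a \<in> carrier E"
  shows "ea_compl E a \<in> carrier E" "Some a \<uplus> Some (ea_compl E a) = Some \<one>\<^sub>E"
  using theI'[OF ex1_complement[OF assms]] assms by (simp_all add: ea_compl_def osum_Some)

lemma compl_unique: "Some a \<uplus> Some b = Some \<one>\<^sub>E \<Longrightarrow> b = ea_compl E a"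
  using ex1_complement[of a] compl[of a] by (auto simp: osum_Some_iff)

lemma compl_compl: "a \<in> carrier E \<Longrightarrow> ea_compl E (ea_compl E a) = a"
  using compl_unique[of "ea_compl E a" a] compl[of a] by (simp add: osum_commute)

lemma compl_inj: "a \<in> carrier E \<Longrightarrow> b \<in> carrier E \<Longrightarrow> ea_compl E a = ea_compl E b \<Longrightarrow> a = b"
  using compl_compl by metis

lemma one_osum: "Some \<one>\<^sub>E \<uplus> Some a = Some b \<Longrightarrow> a = \<zero>\<^sub>E"
  using plus_one_defined[of a] osum_commute[of "Some \<one>\<^sub>E" "Some a"] osum_Some_iff by force

lemma one_zero: "Some \<one>\<^sub>E \<uplus> Some \<zero>\<^sub>E = Some \<one>\<^sub>E"
  using compl[OF one_closed] one_osum by metis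

text \<open>Neutrality of zero is not an axiom. The complement of 1 must be 0, so 1 + 0 = 1;
  rewriting 1 as a plus its complement shows that a + 0 is a second complement of the complement of
  a, hence equal to a.\<close>

lemma osum_zero:
  assumes "a \<in> carrier E"
  shows "Some a \<uplus> Some \<zero>\<^sub>E = Some a" "Some \<zero>\<^sub>E \<uplus> Some a = Some a"
proof -
  have "Some (ea_compl E a) \<uplus> (Some a \<uplus> Some \<zero>\<^sub>E) = Some \<one>\<^sub>E"
    using compl(2)[OF assms] one_zero by (metis osum_assoc osum_commute)
  then obtain b where b: "Some a \<uplus> Some \<zero>\<^sub>E = Some b" "Some (ea_compl E a) \<uplus> Some b = Some \<one>\<^sub>E"
    by (metis osum_eq_SomeE)
  then show "Some a \<uplus> Some \<zero>\<^sub>E = Some a"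
    using compl_unique compl_compl assms by metis
  then show "Some \<zero>\<^sub>E \<uplus> Some a = Some a" by (simp add: osum_commute)
qed

text \<open>Both \<open>B\<close> and \<open>C\<close> are complements of a + d', where d' is the
  complement of \<open>d\<close>, and complements are unique.\<close>

lemma osum_cancel:
  assumes "Some a \<uplus> B = Some d" "Some a \<uplus> C = Some d"
  shows "B = C"
proof -
  obtain b c where bc: "B = Some b" "C = Some c" "b \<in> carrier E" "c \<in> carrier E" "d \<in> carrier E"
    using assms by (metis osum_eq_SomeE)
  have "Some d \<uplus> Some (ea_compl E d) = Some \<one>\<^sub>E" using compl bc by blast
  then have "Some b \<uplus> (Some a \<uplus> Some (ea_compl E d)) = Some \<one>\<^sub>E"
    and "Some c \<uplus> (Some a \<uplus> Some (ea_compl E d)) = Some \<one>\<^sub>E"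
    using assms bc by (metis osum_assoc osum_commute)+
  then show ?thesis using compl_unique bc by (metis osum_commute osum_eq_SomeE)
qed

lemma osum_cancel_Some:
  assumes "Some a \<uplus> Some b = Some d" "Some a \<uplus> Some c = Some d"
  shows "b = c"
  using osum_cancel[OF assms] by simp

text \<open>Substituting x + y for 0 in 1 + 0 = 1 and regrouping shows that 1 + x is defined, which
  forces x = 0.\<close>

lemma osum_eq_zero:
  assumes "A \<uplus> B = Some \<zero>\<^sub>E"
  shows "A = Some \<zero>\<^sub>E" "B = Some \<zero>\<^sub>E"
proof -
  have *: "X = Some \<zero>\<^sub>E" if "X \<uplus> Y = Some \<zero>\<^sub>E" for X Y
  proof -
    have "Y \<uplus> (Some \<one>\<^sub>E \<uplus> X) = Some \<one>\<^sub>E"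
      using one_zero that by (metis osum_assoc osum_commute)
    then obtain x y where "X = Some x" "Some \<one>\<^sub>E \<uplus> Some x = Some y"
      by (metis osum_eq_SomeE)
    then show ?thesis using one_osum by blast
  qed
  show "A = Some \<zero>\<^sub>E" using *[OF assms] .
  show "B = Some \<zero>\<^sub>E" using *[of B A] assms by (simp add: osum_commute)
qed

lemma le_iff: "ea_le E a b \<longleftrightarrow> (\<exists>c. Some a \<uplus> Some c = Some b)"
  unfolding ea_le_def osum_Some_iff using plus_closed by blast

lemma leI: "Some a \<uplus> Some c = Some b \<Longrightarrow> ea_le E a b"
  unfolding le_iff by blast

lemma leE:
  assumes "ea_le E a b"
  obtains c where "c \<in> carrier E" "Some a \<uplus> Some c = Some b"
  using assms osum_closed unfolding le_iff by metis

lemma le_closed: "ea_le E a b \<Longrightarrow> a \<in> carrier E" "ea_le E a b \<Longrightarrow> b \<in> carrier E"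
  by (simp_all add: ea_le_def)

lemma le_refl: "a \<in> carrier E \<Longrightarrow> ea_le E a a"
  using osum_zero leI by blast

lemma le_trans:
  assumes "ea_le E a b" "ea_le E b c" shows "ea_le E a c"
proof -
  obtain x y where "Some a \<uplus> Some x = Some b" "Some b \<uplus> Some y = Some c"
    using assms by (auto simp: le_iff)
  then have "Some a \<uplus> (Some x \<uplus> Some y) = Some c" by (metis osum_assoc)
  then show ?thesis by (metis leI osum_eq_SomeE)
qed

lemma le_zero: "ea_le E a \<zero>\<^sub>E \<Longrightarrow> a = \<zero>\<^sub>E"
  using osum_eq_zero by (metis le_iff option.inject)

lemma zero_le: "a \<in> carrier E \<Longrightarrow> ea_le E \<zero>\<^sub>E a"
  using osum_zero leI by blast

lemma le_one: "a \<in> carrier E \<Longrightarrow> ea_le E a \<one>\<^sub>E"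
  using compl leI by blast

text \<open>If a + b = c, then a plus the complement of \<open>c\<close> is the complement of
  \<open>b\<close>; the converse regroups b + (a + x) = 1.\<close>

lemma osum_defined_iff:
  assumes "a \<in> carrier E" "b \<in> carrier E"
  shows "(\<exists>c. Some a \<uplus> Some b = Some c) \<longleftrightarrow> ea_le E a (ea_compl E b)"
proof
  assume "\<exists>c. Some a \<uplus> Some b = Some c"
  then obtain c where c: "Some a \<uplus> Some b = Some c" by blast
  then have "Some c \<uplus> Some (ea_compl E c) = Some \<one>\<^sub>E" using compl osum_closed by blast
  then have "Some b \<uplus> (Some a \<uplus> Some (ea_compl E c)) = Some \<one>\<^sub>E"
    using c by (metis osum_assoc osum_commute)
  then obtain y where "Some a \<uplus> Some (ea_compl E c) = Some y" "Some b \<uplus> Some y = Some \<one>\<^sub>E"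
    by (metis osum_eq_SomeE)
  then show "ea_le E a (ea_compl E b)" using compl_unique leI by metis
next
  assume "ea_le E a (ea_compl E b)"
  then obtain x where "Some a \<uplus> Some x = Some (ea_compl E b)" by (auto simp: le_iff)
  then have "Some x \<uplus> (Some a \<uplus> Some b) = Some \<one>\<^sub>E"
    using compl(2)[OF assms(2)] by (metis osum_assoc osum_commute)
  then show "\<exists>c. Some a \<uplus> Some b = Some c" by (metis osum_eq_SomeE)
qed

lemma diff_eq:
  assumes "Some a \<uplus> Some c = Some b"
  shows "ea_diff E b a = c"
  unfolding ea_diff_def
proof (rule the_equality)
  show "c \<in> carrier E \<and> a \<boxplus> c = Some b" using assms osum_closed osum_Some_iff by metis
  fix c' assume "c' \<in> carrier E \<and> a \<boxplus> c' = Some b"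
  then have "Some a \<uplus> Some c' = Some b" using assms osum_closed osum_Some_iff by metis
  then show "c' = c" using assms osum_cancel_Some by metis
qed

lemma rdp_osum:
  assumes "ea_rdp E" "Some a1 \<uplus> Some a2 = Some d" "Some b1 \<uplus> Some b2 = Some d"
  obtains c11 c12 c21 c22 where "Some c11 \<uplus> Some c12 = Some a1" "Some c21 \<uplus> Some c22 = Some a2"
    "Some c11 \<uplus> Some c21 = Some b1" "Some c12 \<uplus> Some c22 = Some b2"
proof -
  have *: "a1 \<in> carrier E" "a2 \<in> carrier E" "b1 \<in> carrier E" "b2 \<in> carrier E"
    "a1 \<boxplus> a2 \<noteq> None \<and> a1 \<boxplus> a2 = b1 \<boxplus> b2"
    using assms(2,3) by (auto simp: osum_Some_iff)
  obtain c11 c12 c21 c22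
    where c: "c11 \<in> carrier E" "c12 \<in> carrier E" "c21 \<in> carrier E" "c22 \<in> carrier E"
      "c11 \<boxplus> c12 = Some a1" "c21 \<boxplus> c22 = Some a2" "c11 \<boxplus> c21 = Some b1" "c12 \<boxplus> c22 = Some b2"
    using assms(1)[unfolded ea_rdp_def, rule_format, OF *] by (elim bexE conjE)
  show thesis by (rule that[of c11 c12 c21 c22]) (simp_all add: osum_Some c)
qed

lemma rdpI:
  assumes "\<And>a1 a2 b1 b2 d. Some a1 \<uplus> Some a2 = Some d \<Longrightarrow> Some b1 \<uplus> Some b2 = Some d \<Longrightarrow>
    \<exists>c11 c12 c21 c22. Some c11 \<uplus> Some c12 = Some a1 \<and> Some c21 \<uplus> Some c22 = Some a2 \<and>
      Some c11 \<uplus> Some c21 = Some b1 \<and> Some c12 \<uplus> Some c22 = Some b2"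
  shows "ea_rdp E"
  unfolding ea_rdp_def
proof (intro ballI impI)
  fix a1 a2 b1 b2
  assume *: "a1 \<in> carrier E" "a2 \<in> carrier E" "b1 \<in> carrier E" "b2 \<in> carrier E"
    and ab: "a1 \<boxplus> a2 \<noteq> None \<and> a1 \<boxplus> a2 = b1 \<boxplus> b2"
  obtain d where d: "a1 \<boxplus> a2 = Some d" using ab by blast
  have "Some a1 \<uplus> Some a2 = Some d" "Some b1 \<uplus> Some b2 = Some d"
    using * ab d by (simp_all add: osum_Some)
  from assms[OF this] obtain c11 c12 c21 c22
    where "Some c11 \<uplus> Some c12 = Some a1" "Some c21 \<uplus> Some c22 = Some a2"
      "Some c11 \<uplus> Some c21 = Some b1" "Some c12 \<uplus> Some c22 = Some b2" by (elim exE conjE)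
  then show "\<exists>c11\<in>carrier E. \<exists>c12\<in>carrier E. \<exists>c21\<in>carrier E. \<exists>c22\<in>carrier E.
      c11 \<boxplus> c12 = Some a1 \<and> c21 \<boxplus> c22 = Some a2 \<and> c11 \<boxplus> c21 = Some b1 \<and> c12 \<boxplus> c22 = Some b2"
    unfolding osum_Some_iff by (intro bexI conjI) (elim conjE, assumption)+
qed

lemma idealI:
  assumes "I \<subseteq> carrier E" "I \<noteq> {}" "\<And>a b. ea_le E a b \<Longrightarrow> b \<in> I \<Longrightarrow> a \<in> I"
    "\<And>a b c. a \<in> I \<Longrightarrow> b \<in> I \<Longrightarrow> Some a \<uplus> Some b = Some c \<Longrightarrow> c \<in> I"
  shows "ea_ideal E I"
proof -
  have "c \<in> I" if "a \<in> I" "b \<in> I" "a \<boxplus> b = Some c" for a b c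
    using that assms(1) assms(4)[of a b c] osum_Some[of a b] by auto
  then show ?thesis unfolding ea_ideal_def using assms(1-3) by blast
qed

lemma idealD:
  assumes "ea_ideal E I"
  shows "I \<subseteq> carrier E" "\<zero>\<^sub>E \<in> I" "\<And>a b. ea_le E a b \<Longrightarrow> b \<in> I \<Longrightarrow> a \<in> I"
    "\<And>a b c. a \<in> I \<Longrightarrow> b \<in> I \<Longrightarrow> Some a \<uplus> Some b = Some c \<Longrightarrow> c \<in> I"
proof -
  note A = assms[unfolded ea_ideal_def]
  show I: "I \<subseteq> carrier E" using A by (elim conjE)
  have down: "\<forall>a b. ea_le E a b \<and> b \<in> I \<longrightarrow> a \<in> I" using A by (elim conjE)
  then show "a \<in> I" if "ea_le E a b" "b \<in> I" for a b using that by blast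
  obtain a where "a \<in> I" using A by (elim conjE) blast
  with zero_le[of a] I down show "\<zero>\<^sub>E \<in> I" by blast
  have "\<forall>a\<in>I. \<forall>b\<in>I. \<forall>c. a \<boxplus> b = Some c \<longrightarrow> c \<in> I" using A by (elim conjE)
  then show "c \<in> I" if "a \<in> I" "b \<in> I" "Some a \<uplus> Some b = Some c" for a b c
    using that unfolding osum_Some_iff by blast
qed

end

section \<open>Finite sums and their refinements\<close>

context effect_algebra
begin

text \<open>Multisets are words up to order, which is harmless because \<open>\<uplus>\<close> is
  commutative and associative even when sums are undefined. A value \<open>Some a\<close> also
  certifies that all entries lie in the carrier.\<close>

definition msum :: "'a multiset \<Rightarrow> 'a option" where
  "msum A = fold_mset (\<lambda>x s. Some x \<uplus> s) (Some \<zero>\<^sub>E) A"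

lemma msum_simps [simp]:
  "msum {#} = Some \<zero>\<^sub>E"
  "msum (add_mset x A) = Some x \<uplus> msum A"
proof -
  interpret comp_fun_commute "\<lambda>x s. Some x \<uplus> s"
    by unfold_locales (simp add: fun_eq_iff osum_left_commute)
  show "msum {#} = Some \<zero>\<^sub>E" "msum (add_mset x A) = Some x \<uplus> msum A"
    by (simp_all add: msum_def)
qed

lemma msum_closed: "msum A = Some a \<Longrightarrow> a \<in> carrier E"
  by (cases A) (auto simp: zero_closed elim: osum_eq_SomeE)

lemma msum_closed_mem:
  assumes "msum A = Some a" shows "set_mset A \<subseteq> carrier E"
  using assms
proof (induction A arbitrary: a)
  case (add x A)
  then obtain s where "msum A = Some s" "x \<in> carrier E" by (auto elim: osum_eq_SomeE)
  with add.IH show ?case by simp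
qed simp

lemma msum_single: "x \<in> carrier E \<Longrightarrow> msum {#x#} = Some x"
  by (simp add: osum_zero)

lemma zero_osum_msum: "Some \<zero>\<^sub>E \<uplus> msum A = msum A"
  by (cases "msum A") (auto simp: osum_zero msum_closed)

lemma msum_union: "msum (A + B) = msum A \<uplus> msum B"
  by (induction A) (simp_all add: zero_osum_msum osum_assoc)

text \<open>Each entry of the first multiset is replaced by a finite block with the same sum. Empty
  blocks are allowed and replace exactly the entries 0; in this way the one-letter word 0 becomes
  equivalent to the empty word.\<close>

inductive refines :: "'a multiset \<Rightarrow> 'a multiset \<Rightarrow> bool" where
  empty: "refines {#} {#}"
| add: "refines A C \<Longrightarrow> msum X = Some a \<Longrightarrow> refines (add_mset a A) (X + C)"

lemma refines_closed:
  "refines A C \<Longrightarrow> set_mset A \<subseteq> carrier E"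
  "refines A C \<Longrightarrow> set_mset C \<subseteq> carrier E"
  by (induction rule: refines.induct) (auto dest: msum_closed msum_closed_mem)

lemma refines_union:
  assumes "refines A C" "refines B D" shows "refines (A + B) (C + D)"
  using assms(1)
proof (induction rule: refines.induct)
  case empty
  then show ?case using assms(2) by simp
next
  case (add A C X a)
  from refines.add[OF add.IH add.hyps(2)] show ?case by (simp add: ac_simps)
qed

lemma refines_refl: "set_mset A \<subseteq> carrier E \<Longrightarrow> refines A A"
proof (induction A)
  case (add x A)
  then show ?case using refines.add[of A A "{#x#}" x] by (simp add: osum_zero)
qed (simp add: refines.empty)

lemma refines_msum: "refines A C \<Longrightarrow> msum C = msum A"
  by (induction rule: refines.induct) (simp_all add: msum_union)

text \<open>A multiset does not remember which entry the last rule application has added, so the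
  block belonging to \<open>a\<close> has to be traced back through the derivation.\<close>

lemma refines_add_msetE:
  assumes "refines (add_mset a A) C"
  shows "\<exists>X C'. C = X + C' \<and> msum X = Some a \<and> refines A C'"
  using assms
proof (induction "add_mset a A" C arbitrary: a A rule: refines.induct)
  case (add B C X b)
  show ?case
  proof (cases "a = b")
    case True
    with add show ?thesis by auto
  next
    case False
    with add.hyps(4) obtain A' where A': "B = add_mset a A'" "A = add_mset b A'"
      by (metis add_eq_conv_ex)
    then obtain Y C' where "C = Y + C'" "msum Y = Some a" "refines A' C'"
      using add.hyps(2) by blast
    moreover have "refines A (X + C')" unfolding A' by (rule refines.add) fact+
    ultimately show ?thesis by (intro exI[of _ Y] exI[of _ "X + C'"]) (simp add: ac_simps)
  qed
qed simp

lemma refines_unionE: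
  assumes "refines (A + B) C"
  shows "\<exists>C1 C2. C = C1 + C2 \<and> refines A C1 \<and> refines B C2"
  using assms
proof (induction A arbitrary: C)
  case empty
  then show ?case by (intro exI[of _ "{#}"] exI[of _ C]) (simp add: refines.empty)
next
  case (add a A)
  then obtain X C' where X: "C = X + C'" "msum X = Some a" "refines (A + B) C'"
    using refines_add_msetE[of a "A + B" C] by auto
  then obtain C1 C2 where "C' = C1 + C2" "refines A C1" "refines B C2" using add.IH by blast
  with X show ?case
    using refines.add[of A C1 X a] by (intro exI[of _ "X + C1"] exI[of _ C2] conjI) (simp_all add: ac_simps)
qed

lemma refines_trans:
  assumes "refines A C" "refines C D" shows "refines A D"
  using assms
proof (induction arbitrary: D rule: refines.induct)
  case (add A C X a)
  obtain D1 D2 where D: "D = D1 + D2" "refines X D1" "refines C D2"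
    using refines_unionE[OF add.prems] by blast
  have "msum D1 = Some a" using refines_msum[OF D(2)] add.hyps(2) by simp
  then show ?case unfolding D(1) by (intro refines.add add.IH D)
qed

lemma msum_zero: "msum A = Some \<zero>\<^sub>E \<Longrightarrow> refines A {#}"
proof (induction A)
  case (add x A)
  then have "Some x \<uplus> msum A = Some \<zero>\<^sub>E" by simp
  then have "Some x = Some \<zero>\<^sub>E" "msum A = Some \<zero>\<^sub>E" by (rule osum_eq_zero)+
  with add.IH refines.add[of A "{#}" "{#}" x] show ?case by simp
qed (simp add: refines.empty)

end

section \<open>Confluence of refinement, and the congruence of words with a common
  refinement\<close>

locale rdp_algebra = effect_algebra +
  assumes rdp: "ea_rdp E"
begin

text \<open>RDP for a sum of two elements against a sum of many. RDP splits the head of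
  \<open>Y\<close> into c11 + c12 and the sum of its tail into c21 + c22; the induction hypothesis
  distributes the latter decomposition over the entries of the tail.\<close>

lemma msum_split:
  assumes "msum Y = Some d" "Some x \<uplus> Some s = Some d"
  shows "\<exists>Y1 Y2. refines Y (Y1 + Y2) \<and> msum Y1 = Some x \<and> msum Y2 = Some s"
  using assms
proof (induction Y arbitrary: x s d)
  case empty
  then have "Some x \<uplus> Some s = Some \<zero>\<^sub>E" by simp
  then have "x = \<zero>\<^sub>E" "s = \<zero>\<^sub>E" using osum_eq_zero by blast+
  then show ?case by (intro exI[of _ "{#}"]) (simp add: refines.empty)
next
  case (add y Y)
  then have "Some y \<uplus> msum Y = Some d" by simp
  then obtain t where t: "msum Y = Some t" "Some y \<uplus> Some t = Some d" by (metis osum_eq_SomeE)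
  obtain c11 c12 c21 c22 where c: "Some c11 \<uplus> Some c12 = Some y" "Some c21 \<uplus> Some c22 = Some t"
    "Some c11 \<uplus> Some c21 = Some x" "Some c12 \<uplus> Some c22 = Some s"
    by (rule rdp_osum[OF rdp t(2) add.prems(2)])
  obtain Y1 Y2 where Y: "refines Y (Y1 + Y2)" "msum Y1 = Some c21" "msum Y2 = Some c22"
    using add.IH[OF t(1) c(2)] by blast
  have "c11 \<in> carrier E" "c12 \<in> carrier E" using c(1) osum_closed by blast+
  then have "msum {#c11, c12#} = Some y" using c(1) by (simp add: osum_zero)
  from refines.add[OF Y(1) this]
  have "refines (add_mset y Y) (add_mset c11 Y1 + add_mset c12 Y2)" by (simp add: ac_simps add_mset_commute)
  then show ?case
    using Y c by (intro exI[of _ "add_mset c11 Y1"] exI[of _ "add_mset c12 Y2"]) simp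
qed

text \<open>RDP for two finite sums of arbitrary length: \<open>msum_split\<close> cuts from
  \<open>Y\<close> a block with the sum of the first entry of \<open>X\<close>, and the rest of
  \<open>Y\<close> has the same sum as the rest of \<open>X\<close>.\<close>

lemma common_refinement:
  assumes "msum X = Some d" "msum Y = Some d"
  shows "\<exists>Z. refines X Z \<and> refines Y Z"
  using assms
proof (induction X arbitrary: Y d)
  case empty
  then show ?case using msum_zero refines.empty by (intro exI[of _ "{#}"]) simp
next
  case (add x X)
  then have "Some x \<uplus> msum X = Some d" by simp
  then obtain s where s: "msum X = Some s" "Some x \<uplus> Some s = Some d" by (metis osum_eq_SomeE)
  obtain Y1 Y2 where Y: "refines Y (Y1 + Y2)" "msum Y1 = Some x" "msum Y2 = Some s"
    using msum_split[OF add.prems(2) s(2)] by blast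
  obtain Z where Z: "refines X Z" "refines Y2 Z" using add.IH[OF s(1) Y(3)] by blast
  have "refines (Y1 + Y2) (Y1 + Z)"
    using refines_union[OF refines_refl[OF msum_closed_mem[OF Y(2)]] Z(2)] .
  then have "refines Y (Y1 + Z)" using refines_trans[OF Y(1)] by blast
  moreover have "refines (add_mset x X) (Y1 + Z)" by (rule refines.add[OF Z(1) Y(2)])
  ultimately show ?case by blast
qed

text \<open>The two blocks that replace one entry have equal sums, so
  \<open>common_refinement\<close> joins them block by block. Confluence is what makes having a
  common refinement a transitive relation.\<close>

lemma refines_confluent:
  assumes "refines A C" "refines A D"
  shows "\<exists>Z. refines C Z \<and> refines D Z"
  using assms
proof (induction arbitrary: D rule: refines.induct)
  case empty
  then show ?case using refines_refl by (intro exI[of _ D]) (auto dest: refines_closed)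
next
  case (add A C X a)
  obtain Y D' where D: "D = Y + D'" "msum Y = Some a" "refines A D'"
    using refines_add_msetE[OF add.prems] by blast
  obtain Z1 where "refines X Z1" "refines Y Z1" using common_refinement[OF add.hyps(2) D(2)] by blast
  moreover obtain Z2 where "refines C Z2" "refines D' Z2" using add.IH[OF D(3)] by blast
  ultimately show ?case unfolding D(1) by (intro exI[of _ "Z1 + Z2"]) (simp add: refines_union)
qed

definition eqv :: "'a multiset \<Rightarrow> 'a multiset \<Rightarrow> bool"  (infix \<open>\<approx>\<close> 50) where
  "A \<approx> B \<longleftrightarrow> (\<exists>C. refines A C \<and> refines B C)"

lemma eqvI: "refines A C \<Longrightarrow> refines B C \<Longrightarrow> A \<approx> B"
  unfolding eqv_def by blast

lemma eqv_closed:
  assumes "A \<approx> B" shows "set_mset A \<subseteq> carrier E" "set_mset B \<subseteq> carrier E"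
  using assms refines_closed unfolding eqv_def by blast+

lemma eqv_refl: "set_mset A \<subseteq> carrier E \<Longrightarrow> A \<approx> A"
  unfolding eqv_def using refines_refl by blast

lemma eqv_sym: "A \<approx> B \<Longrightarrow> B \<approx> A"
  unfolding eqv_def by blast

lemma eqv_trans:
  assumes "A \<approx> B" "B \<approx> C" shows "A \<approx> C"
proof -
  obtain X Y where XY: "refines A X" "refines B X" "refines B Y" "refines C Y"
    using assms unfolding eqv_def by blast
  then obtain Z where "refines X Z" "refines Y Z" using refines_confluent by blast
  then show ?thesis using XY refines_trans eqvI by metis
qed

lemma eqv_union: "A \<approx> B \<Longrightarrow> C \<approx> D \<Longrightarrow> A + C \<approx> B + D"
  unfolding eqv_def using refines_union by blast

lemma eqv_msum: "A \<approx> B \<Longrightarrow> msum A = msum B"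
  unfolding eqv_def using refines_msum by metis

lemma msum_eqv: "msum A = Some a \<Longrightarrow> msum B = Some a \<Longrightarrow> A \<approx> B"
  unfolding eqv_def using common_refinement by blast

text \<open>The refinement property of the free commutative monoid: \<open>W\<close> is the overlap
  of \<open>A\<close> and \<open>C\<close>, taken as large as possible, and this determines the
  other three parts.\<close>

lemma mset_eq_refinement:
  fixes A B C D :: "'b multiset"
  assumes "A + B = C + D"
  obtains W V T S where "A = W + V" "B = T + S" "C = W + T" "D = V + S"
proof -
  define W where "W = A \<inter># C"
  define V where "V = A - C"
  define T where "T = C - A"
  define S where "S = B - (C - A)"
  have "count A x + count B x = count C x + count D x" for x
    using arg_cong[OF assms, of "\<lambda>M. count M x"] by simp
  then have *: "count A x = count C x + count D x - count B x" "count B x \<le> count C x + count D x" for x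
    by (metis diff_add_inverse2, metis le_add2)
  have "A = W + V" "B = T + S" "C = W + T" "D = V + S"
    unfolding W_def V_def T_def S_def using *
    by (auto simp: multiset_eq_iff min_def)
  then show thesis by (rule that)
qed

text \<open>In a common refinement the letter \<open>c\<close> is represented by two blocks
  \<open>X\<close> and \<open>Y\<close>, which may differ. They share the part \<open>S\<close>, and
  by cancellation in E their remaining parts \<open>T\<close> and \<open>V\<close> have equal sums,
  hence are equivalent. What is left of the common refinement after removing \<open>X\<close> or
  \<open>Y\<close> is W + V or W + T, respectively.\<close>

lemma eqv_cancel_single:
  assumes "add_mset c A \<approx> add_mset c B" shows "A \<approx> B"
proof -
  obtain C where C: "refines (add_mset c A) C" "refines (add_mset c B) C"
    using assms unfolding eqv_def by blast
  obtain X C1 where X: "C = X + C1" "msum X = Some c" "refines A C1"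
    using refines_add_msetE[OF C(1)] by blast
  obtain Y C2 where Y: "C = Y + C2" "msum Y = Some c" "refines B C2"
    using refines_add_msetE[OF C(2)] by blast
  have "C1 + X = C2 + Y" using X(1) Y(1) by (simp add: ac_simps)
  then obtain W V T S where *: "C1 = W + V" "X = T + S" "C2 = W + T" "Y = V + S"
    by (rule mset_eq_refinement)
  have "msum S \<uplus> msum T = Some c" "msum S \<uplus> msum V = Some c"
    using X(2) Y(2) * msum_union by (simp_all add: osum_commute)
  moreover from this obtain s where "msum S = Some s" by (metis osum_eq_SomeE)
  ultimately have "msum T = msum V" and "\<exists>t. msum T = Some t"
    using osum_cancel by (metis, metis osum_eq_SomeE)
  then have "V \<approx> T" using msum_eqv by metis
  have "A \<approx> C1" "B \<approx> C2"
    using X(3) Y(3) refines_refl[OF refines_closed(2)[OF X(3)]]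
      refines_refl[OF refines_closed(2)[OF Y(3)]] by (auto intro: eqvI)
  moreover have "C1 \<approx> C2"
    unfolding * using refines_closed(2)[OF X(3)] \<open>V \<approx> T\<close> *(1)
    by (intro eqv_union eqv_refl) auto
  ultimately show ?thesis using eqv_trans eqv_sym by metis
qed

lemma eqv_cancel:
  assumes "C + A \<approx> C + B" shows "A \<approx> B"
  using assms by (induction C) (auto dest: eqv_cancel_single)

text \<open>Equivalent words have equal sums, so the sum of A + B is 0; positivity of E makes the
  sum of \<open>A\<close> zero as well.\<close>

lemma eqv_empty:
  assumes "A + B \<approx> {#}" shows "A \<approx> {#}"
proof -
  have "msum A \<uplus> msum B = Some \<zero>\<^sub>E" using eqv_msum[OF assms] by (simp add: msum_union)
  then have "msum A = Some \<zero>\<^sub>E" by (rule osum_eq_zero)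
  then show ?thesis by (intro msum_eqv) simp_all
qed

text \<open>The refinement property is inherited from multisets: a common refinement is cut in two
  ways, according to the left and to the right side, and the two cuts are intersected.\<close>

lemma eqv_refinement:
  assumes "A1 + A2 \<approx> B1 + B2"
  shows "\<exists>W V T S. A1 \<approx> W + V \<and> A2 \<approx> T + S \<and> B1 \<approx> W + T \<and> B2 \<approx> V + S"
proof -
  obtain C where C: "refines (A1 + A2) C" "refines (B1 + B2) C"
    using assms unfolding eqv_def by blast
  obtain C1 C2 where c: "C = C1 + C2" "refines A1 C1" "refines A2 C2"
    using refines_unionE[OF C(1)] by blast
  obtain D1 D2 where d: "C = D1 + D2" "refines B1 D1" "refines B2 D2"
    using refines_unionE[OF C(2)] by blast
  have "C1 + C2 = D1 + D2" using c d by simp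
  then obtain W V T S where *: "C1 = W + V" "C2 = T + S" "D1 = W + T" "D2 = V + S"
    by (rule mset_eq_refinement)
  have "A1 \<approx> C1" "A2 \<approx> C2" "B1 \<approx> D1" "B2 \<approx> D2"
    using c d refines_refl refines_closed by (auto intro!: eqvI)
  then show ?thesis unfolding * by blast
qed

end

section \<open>Partially ordered Abelian groups\<close>

lemma abelian_po_groupI:
  fixes G :: "'g pogroup" (structure)
  assumes "comm_group G"
    and refl: "\<And>x. x \<in> carrier G \<Longrightarrow> x \<preceq> x"
    and antisym: "\<And>x y. \<lbrakk>x \<in> carrier G; y \<in> carrier G; x \<preceq> y; y \<preceq> x\<rbrakk> \<Longrightarrow> x = y"
    and trans: "\<And>x y z. \<lbrakk>x \<in> carrier G; y \<in> carrier G; z \<in> carrier G; x \<preceq> y; y \<preceq> z\<rbrakk> \<Longrightarrow> x \<preceq> z"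
    and mono: "\<And>x y z. \<lbrakk>x \<in> carrier G; y \<in> carrier G; z \<in> carrier G; x \<preceq> y\<rbrakk> \<Longrightarrow> x \<otimes> z \<preceq> y \<otimes> z"
  shows "abelian_po_group G"
proof -
  interpret comm_group G by fact
  have "partial_order (pg_order G)"
    by unfold_locales (simp_all add: pg_order_def refl, (metis refl antisym trans)+)
  moreover have "k \<otimes> g \<otimes> f \<preceq> k \<otimes> h \<otimes> f"
    if "g \<in> carrier G" "h \<in> carrier G" "k \<in> carrier G" "f \<in> carrier G" "g \<preceq> h" for g h k f
    using mono[of g h "k \<otimes> f"] that by (simp add: m_ac)
  ultimately have "po_group_axioms G" by (simp add: po_group_axioms_def)
  then show ?thesis
    by (simp add: abelian_po_group_def po_group_def group_axioms comm_group_axioms)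
qed

context abelian_po_group
begin

lemma le_refl: "x \<in> carrier G \<Longrightarrow> x \<preceq> x"
  using partial_order.axioms(1)[OF order] weak_partial_order.le_refl[of "pg_order G" x]
  by (simp add: pg_order_def)

lemma le_antisym: "\<lbrakk>x \<in> carrier G; y \<in> carrier G; x \<preceq> y; y \<preceq> x\<rbrakk> \<Longrightarrow> x = y"
  using partial_order.axioms(1)[OF order] weak_partial_order.weak_le_antisym[of "pg_order G" x y]
  by (simp add: pg_order_def)

lemma le_trans:
  "\<lbrakk>x \<in> carrier G; y \<in> carrier G; z \<in> carrier G; x \<preceq> y; y \<preceq> z\<rbrakk> \<Longrightarrow> x \<preceq> z"
  using partial_order.axioms(1)[OF order] weak_partial_order.le_trans[of "pg_order G" x y z]
  by (simp add: pg_order_def)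

lemma le_mult:
  "\<lbrakk>x \<in> carrier G; y \<in> carrier G; z \<in> carrier G; x \<preceq> y\<rbrakk> \<Longrightarrow> z \<otimes> x \<preceq> z \<otimes> y"
  using translation[of x y z \<one>] by simp

lemma le_mult_iff:
  assumes "x \<in> carrier G" "y \<in> carrier G" "z \<in> carrier G"
  shows "z \<otimes> x \<preceq> z \<otimes> y \<longleftrightarrow> x \<preceq> y"
proof
  assume "z \<otimes> x \<preceq> z \<otimes> y"
  then have "inv z \<otimes> (z \<otimes> x) \<preceq> inv z \<otimes> (z \<otimes> y)" using assms by (intro le_mult[OF _ _ _ \<open>z \<otimes> x \<preceq> z \<otimes> y\<close>]) auto
  moreover have "inv z \<otimes> (z \<otimes> w) = w" if "w \<in> carrier G" for w
    using assms that by (simp flip: m_assoc)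
  ultimately show "x \<preceq> y" using assms by simp
qed (use assms le_mult in blast)

lemma posD: "p \<in> pg_pos G \<Longrightarrow> p \<in> carrier G" "p \<in> pg_pos G \<Longrightarrow> \<one> \<preceq> p"
  by (simp_all add: pg_pos_def)

lemma one_pos: "\<one> \<in> pg_pos G"
  by (simp add: pg_pos_def le_refl)

lemma le_mult_pos: "x \<in> carrier G \<Longrightarrow> p \<in> pg_pos G \<Longrightarrow> x \<preceq> x \<otimes> p"
  using le_mult[of \<one> p x] by (simp add: pg_pos_def)

lemma le_iff_pos:
  assumes "x \<in> carrier G" "y \<in> carrier G"
  shows "x \<preceq> y \<longleftrightarrow> (\<exists>p\<in>pg_pos G. y = x \<otimes> p)"
proof
  assume "x \<preceq> y"
  then have "inv x \<otimes> x \<preceq> inv x \<otimes> y" using assms le_mult[of x y "inv x"] by blast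
  then have "inv x \<otimes> y \<in> pg_pos G" using assms by (simp add: pg_pos_def)
  moreover have "y = x \<otimes> (inv x \<otimes> y)" using assms by (simp flip: m_assoc)
  ultimately show "\<exists>p\<in>pg_pos G. y = x \<otimes> p" by blast
qed (use assms le_mult_pos in blast)

lemma pos_mult:
  assumes "p \<in> pg_pos G" "q \<in> pg_pos G" shows "p \<otimes> q \<in> pg_pos G"
proof -
  have "\<one> \<preceq> p \<otimes> q"
    using le_trans[of \<one> p "p \<otimes> q"] le_mult_pos[of p q] assms by (simp add: pg_pos_def)
  then show ?thesis using assms by (simp add: pg_pos_def)
qed

lemma pos_mult_one:
  assumes "p \<in> pg_pos G" "q \<in> pg_pos G" "p \<otimes> q = \<one>" shows "p = \<one>" "q = \<one>"
proof -
  have "p \<preceq> \<one>" using le_mult_pos[of p q] assms posD by simp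
  then show "p = \<one>" using assms posD le_antisym by simp
  then show "q = \<one>" using assms posD by simp
qed

text \<open>The left side is the condition under which \<open>Gamma\<close> declares the sum of
  \<open>a\<close> and \<open>b\<close> to be defined; the right side is free of inverses.\<close>

lemma le_inv: 
  assumes "a \<in> carrier G" "b \<in> carrier G" "u \<in> carrier G"
  shows "a \<preceq> u \<otimes> inv b \<longleftrightarrow> b \<otimes> a \<preceq> u"
proof -
  have "b \<otimes> (u \<otimes> inv b) = u" using assms m_lcomm[of b u "inv b"] by simp
  then show ?thesis using le_mult_iff[of a "u \<otimes> inv b" b] assms by simp
qed

end

section \<open>The group of differences of a cancellative refinement monoid\<close>

text \<open>The elements of the group are sets of pairs over \<open>M\<close>, whose elements name those of the
  monoid by means of \<open>c\<close>.\<close>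

locale group_of_differences = comm_monoid Q for Q :: "'q monoid" (structure) +
  fixes M :: "'m set" and c :: "'m \<Rightarrow> 'q"
  assumes onto: "c ` M = carrier Q"
    and l_cancel: "\<lbrakk>z \<otimes> x = z \<otimes> y; x \<in> carrier Q; y \<in> carrier Q; z \<in> carrier Q\<rbrakk> \<Longrightarrow> x = y"
    and conical: "\<lbrakk>x \<otimes> y = \<one>; x \<in> carrier Q; y \<in> carrier Q\<rbrakk> \<Longrightarrow> x = \<one>"
    and refinement: "\<lbrakk>x1 \<otimes> x2 = y1 \<otimes> y2; x1 \<in> carrier Q; x2 \<in> carrier Q; y1 \<in> carrier Q;
      y2 \<in> carrier Q\<rbrakk> \<Longrightarrow> \<exists>w\<in>carrier Q. \<exists>v\<in>carrier Q. \<exists>t\<in>carrier Q. \<exists>s\<in>carrier Q.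
        x1 = w \<otimes> v \<and> x2 = t \<otimes> s \<and> y1 = w \<otimes> t \<and> y2 = v \<otimes> s"
begin

text \<open>The formal difference p - q, coded as the set of all pairs of names whose difference
  equals it. Equality of group elements thus becomes equality of sets. Names from \<open>M\<close>
  are used in place of elements of \<open>Q\<close> in order to control the type of the group
  elements: \<open>Q\<close> may be a monoid of classes, while its names are, for instance,
  lists.\<close>

definition frac :: "'q \<Rightarrow> 'q \<Rightarrow> ('m \<times> 'm) set" where
  "frac p q = {(v, w). v \<in> M \<and> w \<in> M \<and> c v \<otimes> q = p \<otimes> c w}"

lemma c_closed: "v \<in> M \<Longrightarrow> c v \<in> carrier Q"
  using imageI[of v M c] by (simp add: onto)

lemma c_onto:
  assumes "p \<in> carrier Q" obtains v where "v \<in> M" "c v = p"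
  using assms unfolding onto[symmetric] by (elim imageE) simp

lemma frac_mono:
  assumes Q: "p \<in> carrier Q" "q \<in> carrier Q" "p' \<in> carrier Q" "q' \<in> carrier Q"
    and eq: "p \<otimes> q' = p' \<otimes> q"
  shows "frac p q \<subseteq> frac p' q'"
proof (clarsimp simp: frac_def)
  fix v w assume "v \<in> M" "w \<in> M" and *: "c v \<otimes> q = p \<otimes> c w"
  then have [simp]: "c v \<in> carrier Q" "c w \<in> carrier Q" by (simp_all add: c_closed)
  have "(c v \<otimes> q) \<otimes> (p \<otimes> q') = (p \<otimes> c w) \<otimes> (p' \<otimes> q)" using * eq by simp
  then have "(q \<otimes> p) \<otimes> (c v \<otimes> q') = (q \<otimes> p) \<otimes> (p' \<otimes> c w)" using Q by (simp add: m_ac)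
  then show "c v \<otimes> q' = p' \<otimes> c w" by (rule l_cancel) (use Q in simp_all)
qed

text \<open>From left to right, it suffices to test one pair: names of \<open>p\<close> and
  \<open>q\<close> belong to the first set, hence to the second.\<close>

lemma frac_eq:
  assumes Q: "p \<in> carrier Q" "q \<in> carrier Q" "p' \<in> carrier Q" "q' \<in> carrier Q"
  shows "frac p q = frac p' q' \<longleftrightarrow> p \<otimes> q' = p' \<otimes> q"
proof
  assume eq: "frac p q = frac p' q'"
  obtain v where v: "v \<in> M" "c v = p" using Q(1) by (rule c_onto)
  obtain w where w: "w \<in> M" "c w = q" using Q(2) by (rule c_onto)
  note vw = v w
  then have "(v, w) \<in> frac p q" using Q by (simp add: frac_def)
  then have "(v, w) \<in> frac p' q'" using eq by simp
  then show "p \<otimes> q' = p' \<otimes> q" using vw by (simp add: frac_def)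
next
  assume *: "p \<otimes> q' = p' \<otimes> q"
  show "frac p q = frac p' q'"
    using frac_mono[OF Q *] frac_mono[OF Q(3,4,1,2) *[symmetric]] by blast
qed

text \<open>The order is the one whose positive cone is the image of \<open>Q\<close>.
  Multiplication acts on representatives; the description is meaningful because its result is the
  same for all of them, as \<open>frac_mult\<close> shows.\<close>

definition diffs :: "('m \<times> 'm) set pogroup" where
  "diffs = \<lparr>carrier = {frac p q | p q. p \<in> carrier Q \<and> q \<in> carrier Q},
     monoid.mult = (\<lambda>X Y. THE Z. \<exists>p\<in>carrier Q. \<exists>q\<in>carrier Q. \<exists>p'\<in>carrier Q. \<exists>q'\<in>carrier Q.
       X = frac p q \<and> Y = frac p' q' \<and> Z = frac (p \<otimes> p') (q \<otimes> q')),
     one = frac \<one> \<one>,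
     pg_le = (\<lambda>X Y. \<exists>p\<in>carrier Q. \<exists>q\<in>carrier Q. \<exists>r\<in>carrier Q.
       X = frac p q \<and> Y = frac (p \<otimes> r) q)\<rparr>"

lemma diffs_E:
  assumes "X \<in> carrier diffs"
  obtains p q where "p \<in> carrier Q" "q \<in> carrier Q" "X = frac p q"
  using assms by (auto simp: diffs_def)

lemma frac_closed [simp]: "p \<in> carrier Q \<Longrightarrow> q \<in> carrier Q \<Longrightarrow> frac p q \<in> carrier diffs"
  by (auto simp: diffs_def)

lemma frac_mult:
  assumes "p \<in> carrier Q" "q \<in> carrier Q" "p' \<in> carrier Q" "q' \<in> carrier Q"
  shows "frac p q \<otimes>\<^bsub>diffs\<^esub> frac p' q' = frac (p \<otimes> p') (q \<otimes> q')"
  unfolding diffs_def monoid.simps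
proof (rule the_equality)
  show "\<exists>pa\<in>carrier Q. \<exists>qa\<in>carrier Q. \<exists>p'a\<in>carrier Q. \<exists>q'a\<in>carrier Q.
      frac p q = frac pa qa \<and> frac p' q' = frac p'a q'a \<and>
      frac (p \<otimes> p') (q \<otimes> q') = frac (pa \<otimes> p'a) (qa \<otimes> q'a)"
    using assms by blast
  fix Z
  assume "\<exists>pa\<in>carrier Q. \<exists>qa\<in>carrier Q. \<exists>p'a\<in>carrier Q. \<exists>q'a\<in>carrier Q.
      frac p q = frac pa qa \<and> frac p' q' = frac p'a q'a \<and> Z = frac (pa \<otimes> p'a) (qa \<otimes> q'a)"
  then obtain a b a' b' where Q: "a \<in> carrier Q" "b \<in> carrier Q" "a' \<in> carrier Q" "b' \<in> carrier Q"
    and eq: "frac p q = frac a b" "frac p' q' = frac a' b'" and Z: "Z = frac (a \<otimes> a') (b \<otimes> b')"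
    by (elim bexE conjE)
  have "p \<otimes> b = a \<otimes> q" "p' \<otimes> b' = a' \<otimes> q'" using eq Q assms by (simp_all add: frac_eq)
  then have "(p \<otimes> b) \<otimes> (p' \<otimes> b') = (a \<otimes> q) \<otimes> (a' \<otimes> q')" by simp
  then have "(a \<otimes> a') \<otimes> (q \<otimes> q') = (p \<otimes> p') \<otimes> (b \<otimes> b')" using Q assms by (simp add: m_ac)
  then show "Z = frac (p \<otimes> p') (q \<otimes> q')" using Z Q assms by (simp add: frac_eq)
qed

lemma frac_le:
  assumes "p \<in> carrier Q" "q \<in> carrier Q" "p' \<in> carrier Q" "q' \<in> carrier Q"
  shows "frac p q \<preceq>\<^bsub>diffs\<^esub> frac p' q' \<longleftrightarrow> (\<exists>r\<in>carrier Q. p \<otimes> q' \<otimes> r = p' \<otimes> q)"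
proof
  assume "frac p q \<preceq>\<^bsub>diffs\<^esub> frac p' q'"
  then obtain a b r where Q: "a \<in> carrier Q" "b \<in> carrier Q" "r \<in> carrier Q"
    and eq: "frac p q = frac a b" "frac p' q' = frac (a \<otimes> r) b"
    unfolding diffs_def pogroup.simps by (elim bexE conjE)
  have "p \<otimes> b = a \<otimes> q" "p' \<otimes> b = a \<otimes> r \<otimes> q'" using eq Q assms by (simp_all add: frac_eq)
  then have "(p \<otimes> b) \<otimes> (a \<otimes> r \<otimes> q') = (a \<otimes> q) \<otimes> (p' \<otimes> b)" by simp
  then have "(a \<otimes> b) \<otimes> (p \<otimes> q' \<otimes> r) = (a \<otimes> b) \<otimes> (p' \<otimes> q)" using Q assms by (simp add: m_ac)
  then have "p \<otimes> q' \<otimes> r = p' \<otimes> q" by (rule l_cancel) (use Q assms in simp_all)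
  then show "\<exists>r\<in>carrier Q. p \<otimes> q' \<otimes> r = p' \<otimes> q" using Q by blast
next
  assume "\<exists>r\<in>carrier Q. p \<otimes> q' \<otimes> r = p' \<otimes> q"
  then obtain r where r: "r \<in> carrier Q" "p \<otimes> q' \<otimes> r = p' \<otimes> q" by blast
  have "frac p q = frac (p \<otimes> q') (q \<otimes> q')" "frac p' q' = frac (p \<otimes> q' \<otimes> r) (q \<otimes> q')"
    using r assms by (simp_all add: frac_eq m_ac)
  then show "frac p q \<preceq>\<^bsub>diffs\<^esub> frac p' q'"
    unfolding diffs_def pogroup.simps using r(1) assms m_closed by blast
qed

lemma one_diffs: "\<one>\<^bsub>diffs\<^esub> = frac \<one> \<one>"
  by (simp add: diffs_def)

lemma comm_group_diffs: "comm_group diffs"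
proof (rule comm_groupI)
  fix X assume X: "X \<in> carrier diffs"
  then obtain p q where pq: "p \<in> carrier Q" "q \<in> carrier Q" "X = frac p q" by (rule diffs_E)
  show "\<one>\<^bsub>diffs\<^esub> \<otimes>\<^bsub>diffs\<^esub> X = X" using pq by (simp add: one_diffs frac_mult)
  have "frac q p \<otimes>\<^bsub>diffs\<^esub> X = \<one>\<^bsub>diffs\<^esub>" using pq by (simp add: one_diffs frac_mult frac_eq m_ac)
  then show "\<exists>Y\<in>carrier diffs. Y \<otimes>\<^bsub>diffs\<^esub> X = \<one>\<^bsub>diffs\<^esub>" using pq frac_closed by blast
  fix Y assume Y: "Y \<in> carrier diffs"
  then obtain a b where ab: "a \<in> carrier Q" "b \<in> carrier Q" "Y = frac a b" by (rule diffs_E)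
  show "X \<otimes>\<^bsub>diffs\<^esub> Y \<in> carrier diffs" "X \<otimes>\<^bsub>diffs\<^esub> Y = Y \<otimes>\<^bsub>diffs\<^esub> X"
    using pq ab by (simp_all add: frac_mult m_ac)
  fix Z assume Z: "Z \<in> carrier diffs"
  then obtain x y where "x \<in> carrier Q" "y \<in> carrier Q" "Z = frac x y" by (rule diffs_E)
  then show "X \<otimes>\<^bsub>diffs\<^esub> Y \<otimes>\<^bsub>diffs\<^esub> Z = X \<otimes>\<^bsub>diffs\<^esub> (Y \<otimes>\<^bsub>diffs\<^esub> Z)"
    using pq ab by (simp add: frac_mult m_ac)
qed (simp add: one_diffs)

text \<open>Antisymmetry is conicality of \<open>Q\<close>: inequalities in both directions produce
  r and s with r + s = 0. Transitivity adds the two witnesses and cancels the middle term.\<close>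

lemma abelian_po_group_diffs: "abelian_po_group diffs"
proof (rule abelian_po_groupI[OF comm_group_diffs])
  fix X assume X: "X \<in> carrier diffs"
  then obtain p q where pq: "p \<in> carrier Q" "q \<in> carrier Q" "X = frac p q" by (rule diffs_E)
  show "X \<preceq>\<^bsub>diffs\<^esub> X" unfolding pq using pq by (auto simp: frac_le intro: bexI[of _ \<one>])
  fix Y assume Y: "Y \<in> carrier diffs"
  then obtain a b where ab: "a \<in> carrier Q" "b \<in> carrier Q" "Y = frac a b" by (rule diffs_E)
  show "X = Y" if le: "X \<preceq>\<^bsub>diffs\<^esub> Y" "Y \<preceq>\<^bsub>diffs\<^esub> X"
  proof -
    obtain r s where r: "r \<in> carrier Q" "p \<otimes> b \<otimes> r = a \<otimes> q"
      and s: "s \<in> carrier Q" "a \<otimes> q \<otimes> s = p \<otimes> b"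
      using le pq ab by (auto simp: frac_le)
    have "(p \<otimes> b) \<otimes> (r \<otimes> s) = (p \<otimes> b \<otimes> r) \<otimes> s" using pq ab r(1) s(1) by (simp add: m_ac)
    also have "\<dots> = (p \<otimes> b) \<otimes> \<one>" unfolding r(2) s(2) using pq ab by simp
    finally have "r \<otimes> s = \<one>" by (rule l_cancel) (use pq ab r s in simp_all)
    then have "r = \<one>" using conical r s by blast
    then show ?thesis using r pq ab by (simp add: frac_eq)
  qed
  fix Z assume Z: "Z \<in> carrier diffs"
  then obtain x y where xy: "x \<in> carrier Q" "y \<in> carrier Q" "Z = frac x y" by (rule diffs_E)
  show "X \<preceq>\<^bsub>diffs\<^esub> Z" if le: "X \<preceq>\<^bsub>diffs\<^esub> Y" "Y \<preceq>\<^bsub>diffs\<^esub> Z"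
  proof -
    obtain r s where r: "r \<in> carrier Q" "p \<otimes> b \<otimes> r = a \<otimes> q"
      and s: "s \<in> carrier Q" "a \<otimes> y \<otimes> s = x \<otimes> b"
      using le pq ab xy by (auto simp: frac_le)
    have "(p \<otimes> b \<otimes> r) \<otimes> (a \<otimes> y \<otimes> s) = (a \<otimes> q) \<otimes> (x \<otimes> b)" using r s by simp
    then have "(a \<otimes> b) \<otimes> (p \<otimes> y \<otimes> (r \<otimes> s)) = (a \<otimes> b) \<otimes> (x \<otimes> q)"
      using pq(1,2) ab(1,2) xy(1,2) r(1) s(1) by (simp add: m_ac)
    then have "p \<otimes> y \<otimes> (r \<otimes> s) = x \<otimes> q"
      by (rule l_cancel) (use pq ab xy r s in simp_all)
    then show ?thesis using pq xy r(1) s(1) by (auto simp: frac_le intro: bexI[of _ "r \<otimes> s"])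
  qed
  show "X \<otimes>\<^bsub>diffs\<^esub> Z \<preceq>\<^bsub>diffs\<^esub> Y \<otimes>\<^bsub>diffs\<^esub> Z" if le: "X \<preceq>\<^bsub>diffs\<^esub> Y"
  proof -
    obtain r where r: "r \<in> carrier Q" "p \<otimes> b \<otimes> r = a \<otimes> q"
      using le pq ab by (auto simp: frac_le)
    then have "(p \<otimes> b \<otimes> r) \<otimes> (x \<otimes> y) = (a \<otimes> q) \<otimes> (x \<otimes> y)" by simp
    then have "(p \<otimes> x) \<otimes> (b \<otimes> y) \<otimes> r = (a \<otimes> x) \<otimes> (q \<otimes> y)"
      using pq(1,2) ab(1,2) xy(1,2) r(1) by (simp add: m_ac)
    then show ?thesis using pq ab xy r(1) by (auto simp: frac_mult frac_le)
  qed
qed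

sublocale D: abelian_po_group diffs
  by (rule abelian_po_group_diffs)

definition emb :: "'q \<Rightarrow> ('m \<times> 'm) set" where
  "emb q = frac q \<one>"

lemma emb_closed: "q \<in> carrier Q \<Longrightarrow> emb q \<in> carrier diffs"
  by (simp add: emb_def)

lemma emb_one: "emb \<one> = \<one>\<^bsub>diffs\<^esub>"
  by (simp add: emb_def one_diffs)

lemma emb_mult: "p \<in> carrier Q \<Longrightarrow> q \<in> carrier Q \<Longrightarrow> emb (p \<otimes> q) = emb p \<otimes>\<^bsub>diffs\<^esub> emb q"
  by (simp add: emb_def frac_mult)

lemma emb_eq_iff: "p \<in> carrier Q \<Longrightarrow> q \<in> carrier Q \<Longrightarrow> emb p = emb q \<longleftrightarrow> p = q"
  by (simp add: emb_def frac_eq)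

lemma pos_diffs: "pg_pos diffs = emb ` carrier Q"
proof (intro equalityI subsetI)
  fix X assume "X \<in> pg_pos diffs"
  then have X: "X \<in> carrier diffs" "\<one>\<^bsub>diffs\<^esub> \<preceq>\<^bsub>diffs\<^esub> X" by (simp_all add: pg_pos_def)
  obtain p q where pq: "p \<in> carrier Q" "q \<in> carrier Q" "X = frac p q" by (rule diffs_E[OF X(1)])
  obtain r where r: "r \<in> carrier Q" "q \<otimes> r = p" using X(2) pq by (auto simp: one_diffs frac_le)
  have "X = emb r" using pq r by (simp add: emb_def frac_eq m_ac)
  then show "X \<in> emb ` carrier Q" using r by blast
qed (auto simp: pg_pos_def emb_def one_diffs frac_le)

text \<open>The differences p - q and a - b both lie below p + a, since \<open>q\<close> and
  \<open>b\<close> are positive.\<close>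

lemma directed_diffs: "pg_directed diffs"
  unfolding pg_directed_def
proof (intro ballI)
  fix X Y assume "X \<in> carrier diffs" "Y \<in> carrier diffs"
  then obtain p q a b where pq: "p \<in> carrier Q" "q \<in> carrier Q" "X = frac p q"
    and ab: "a \<in> carrier Q" "b \<in> carrier Q" "Y = frac a b" by (metis diffs_E)
  have "X \<preceq>\<^bsub>diffs\<^esub> emb (p \<otimes> a)"
    unfolding pq emb_def using pq ab by (auto simp: frac_le m_ac intro!: bexI[of _ "q \<otimes> a"])
  moreover have "Y \<preceq>\<^bsub>diffs\<^esub> emb (p \<otimes> a)"
    unfolding ab emb_def using pq ab by (auto simp: frac_le m_ac intro!: bexI[of _ "p \<otimes> b"])
  ultimately show "\<exists>Z\<in>carrier diffs. X \<preceq>\<^bsub>diffs\<^esub> Z \<and> Y \<preceq>\<^bsub>diffs\<^esub> Z"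
    using pq ab emb_closed m_closed by blast
qed

text \<open>The positive cone is a copy of \<open>Q\<close> under \<open>emb\<close>, so this is the
  refinement property of \<open>Q\<close>.\<close>

lemma rdp_diffs: "pg_rdp diffs"
  unfolding pg_rdp_def pos_diffs
proof (intro ballI impI)
  fix A1 A2 B1 B2
  assume "A1 \<in> emb ` carrier Q" "A2 \<in> emb ` carrier Q" "B1 \<in> emb ` carrier Q" "B2 \<in> emb ` carrier Q"
    and eq: "A1 \<otimes>\<^bsub>diffs\<^esub> A2 = B1 \<otimes>\<^bsub>diffs\<^esub> B2"
  then obtain a1 a2 b1 b2 where Q: "a1 \<in> carrier Q" "a2 \<in> carrier Q" "b1 \<in> carrier Q" "b2 \<in> carrier Q"
    and ab: "A1 = emb a1" "A2 = emb a2" "B1 = emb b1" "B2 = emb b2" by blast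
  have "a1 \<otimes> a2 = b1 \<otimes> b2" using eq Q by (simp add: ab flip: emb_mult) (simp add: emb_eq_iff)
  from refinement[OF this Q] obtain w v t s
    where W: "w \<in> carrier Q" "v \<in> carrier Q" "t \<in> carrier Q" "s \<in> carrier Q"
    and *: "a1 = w \<otimes> v" "a2 = t \<otimes> s" "b1 = w \<otimes> t" "b2 = v \<otimes> s" by (elim bexE conjE)
  show "\<exists>c11\<in>emb ` carrier Q. \<exists>c12\<in>emb ` carrier Q. \<exists>c21\<in>emb ` carrier Q. \<exists>c22\<in>emb ` carrier Q.
      A1 = c11 \<otimes>\<^bsub>diffs\<^esub> c12 \<and> A2 = c21 \<otimes>\<^bsub>diffs\<^esub> c22 \<and> B1 = c11 \<otimes>\<^bsub>diffs\<^esub> c21 \<and> B2 = c12 \<otimes>\<^bsub>diffs\<^esub> c22"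
    unfolding ab * using W
    by (intro bexI[of _ "emb w"] bexI[of _ "emb v"] bexI[of _ "emb t"] bexI[of _ "emb s"])
      (simp_all add: emb_mult)
qed

end

section \<open>Antilattices\<close>

context abelian_po_group
begin

lemma is_glb_iff:
  assumes "x \<in> carrier G" "y \<in> carrier G"
  shows "is_glb (pg_order G) z {x, y} \<longleftrightarrow>
    z \<in> carrier G \<and> z \<preceq> x \<and> z \<preceq> y \<and> (\<forall>w\<in>carrier G. w \<preceq> x \<and> w \<preceq> y \<longrightarrow> w \<preceq> z)"
  using assms by (auto simp: greatest_def Lower_def pg_order_def)

lemma is_lub_iff:
  assumes "x \<in> carrier G" "y \<in> carrier G"
  shows "is_lub (pg_order G) z {x, y} \<longleftrightarrow>
    z \<in> carrier G \<and> x \<preceq> z \<and> y \<preceq> z \<and> (\<forall>w\<in>carrier G. x \<preceq> w \<and> y \<preceq> w \<longrightarrow> z \<preceq> w)"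
  using assms by (auto simp: least_def Upper_def pg_order_def)

lemma le_pos_one:
  assumes "x \<in> carrier G" "w \<in> pg_pos G" "x \<otimes> w \<preceq> x" shows "w = \<one>"
proof -
  have "w \<preceq> \<one>" using assms le_mult_iff[of w \<one> x] posD by simp
  then show ?thesis using assms(2) posD le_antisym by simp
qed

text \<open>Additively: if z is the infimum of incomparable x and y, then x - z and y - z are
  positive and nonzero, and a nonzero positive lower bound w of both makes z + w a common lower
  bound that is strictly larger than z. Dually, a supremum z could be lowered to z - w.\<close>

lemma antilatticeI:
  assumes "\<And>a b. \<lbrakk>a \<in> pg_pos G; b \<in> pg_pos G; a \<noteq> \<one>; b \<noteq> \<one>\<rbrakk> \<Longrightarrow>
    \<exists>w\<in>pg_pos G. w \<noteq> \<one> \<and> w \<preceq> a \<and> w \<preceq> b"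
  shows "antilattice (pg_order G)"
proof -
  have glb: "x \<preceq> y \<or> y \<preceq> x" if xy: "x \<in> carrier G" "y \<in> carrier G"
    and z: "z \<in> carrier G" "z \<preceq> x" "z \<preceq> y" "\<forall>w\<in>carrier G. w \<preceq> x \<and> w \<preceq> y \<longrightarrow> w \<preceq> z" for x y z
  proof (rule ccontr)
    assume inc: "\<not> (x \<preceq> y \<or> y \<preceq> x)"
    obtain a where a: "a \<in> pg_pos G" "x = z \<otimes> a" using z(2) le_iff_pos[OF z(1) xy(1)] by blast
    obtain b where b: "b \<in> pg_pos G" "y = z \<otimes> b" using z(3) le_iff_pos[OF z(1) xy(2)] by blast
    have "a \<noteq> \<one>" using a(2) inc z(1,3) by auto
    moreover have "b \<noteq> \<one>" using b(2) inc z(1,2) by auto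
    ultimately obtain w where w: "w \<in> pg_pos G" "w \<noteq> \<one>" "w \<preceq> a" "w \<preceq> b"
      using assms a(1) b(1) by blast
    have "z \<otimes> w \<preceq> x" "z \<otimes> w \<preceq> y" unfolding a b using a b w z(1) posD le_mult by blast+
    then have "z \<otimes> w \<preceq> z" using z w posD by blast
    then show False using le_pos_one w z(1) by blast
  qed
  have lub: "x \<preceq> y \<or> y \<preceq> x" if xy: "x \<in> carrier G" "y \<in> carrier G"
    and z: "z \<in> carrier G" "x \<preceq> z" "y \<preceq> z" "\<forall>w\<in>carrier G. x \<preceq> w \<and> y \<preceq> w \<longrightarrow> z \<preceq> w" for x y z
  proof (rule ccontr)
    assume inc: "\<not> (x \<preceq> y \<or> y \<preceq> x)"
    obtain a where a: "a \<in> pg_pos G" "z = x \<otimes> a" using z(2) le_iff_pos[OF xy(1) z(1)] by blast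
    obtain b where b: "b \<in> pg_pos G" "z = y \<otimes> b" using z(3) le_iff_pos[OF xy(2) z(1)] by blast
    have "a \<noteq> \<one>" using a(2) inc xy(1) z(3) by auto
    moreover have "b \<noteq> \<one>" using b(2) inc xy(2) z(2) by auto
    ultimately obtain w where w: "w \<in> pg_pos G" "w \<noteq> \<one>" "w \<preceq> a" "w \<preceq> b"
      using assms a(1) b(1) by blast
    obtain a' where a': "a' \<in> pg_pos G" "a = w \<otimes> a'"
      using le_iff_pos[of w a] w(1,3) a(1) posD by blast
    obtain b' where b': "b' \<in> pg_pos G" "b = w \<otimes> b'"
      using le_iff_pos[of w b] w(1,4) b(1) posD by blast
    have [simp]: "a' \<in> carrier G" "b' \<in> carrier G" "w \<in> carrier G" using a' b' w posD by blast+
    have za: "z = x \<otimes> a' \<otimes> w" unfolding a(2) a'(2) using xy by (simp add: m_ac)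
    have zb: "z = y \<otimes> b' \<otimes> w" unfolding b(2) b'(2) using xy by (simp add: m_ac)
    \<comment> \<open>This common value is z - w; it bounds both \<open>x\<close> and
      \<open>y\<close> from above, against the minimality of \<open>z\<close>.\<close>
    have "x \<otimes> a' = y \<otimes> b'" using za zb xy by simp
    then have "y \<preceq> x \<otimes> a'" using le_mult_pos[of y b'] xy b' by simp
    moreover have "x \<preceq> x \<otimes> a'" using le_mult_pos[of x a'] xy a' by simp
    ultimately have "z \<preceq> x \<otimes> a'" using z(4) xy by simp
    then have "x \<otimes> a' \<otimes> w \<preceq> x \<otimes> a'" using za by simp
    then show False using le_pos_one[of "x \<otimes> a'" w] w xy by simp
  qed
  show ?thesis unfolding antilattice_def
  proof (intro ballI impI)
    fix x y assume "x \<in> carrier (pg_order G)" "y \<in> carrier (pg_order G)"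
      and bd: "(\<exists>s. is_lub (pg_order G) s {x, y}) \<or> (\<exists>i. is_glb (pg_order G) i {x, y})"
    then have xy: "x \<in> carrier G" "y \<in> carrier G" by (simp_all add: pg_order_def)
    have "x \<preceq> y \<or> y \<preceq> x"
      using bd unfolding is_glb_iff[OF xy] is_lub_iff[OF xy] using lub[OF xy] glb[OF xy] by blast
    then show "x \<sqsubseteq>\<^bsub>pg_order G\<^esub> y \<or> y \<sqsubseteq>\<^bsub>pg_order G\<^esub> x" by (simp add: pg_order_def)
  qed
qed

end

section \<open>The universal group of an effect algebra with RDP\<close>

context rdp_algebra
begin

definition cls :: "'a multiset \<Rightarrow> 'a multiset set" where
  "cls A = {B. A \<approx> B}"

definition words :: "'a multiset set monoid" where
  "words = \<lparr>carrier = {cls A | A. set_mset A \<subseteq> carrier E},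
     monoid.mult = (\<lambda>X Y. {C. \<exists>A\<in>X. \<exists>B\<in>Y. A + B \<approx> C}), one = cls {#}\<rparr>"

lemma cls_closed: "set_mset A \<subseteq> carrier E \<Longrightarrow> cls A \<in> carrier words"
  by (auto simp: words_def)

lemma wordsE:
  assumes "X \<in> carrier words" obtains A where "set_mset A \<subseteq> carrier E" "X = cls A"
  using assms by (auto simp: words_def)

lemma cls_eq_iff:
  assumes "set_mset A \<subseteq> carrier E" shows "cls A = cls B \<longleftrightarrow> A \<approx> B"
proof
  assume "cls A = cls B"
  moreover have "A \<in> cls A" using eqv_refl[OF assms] by (simp add: cls_def)
  ultimately have "B \<approx> A" by (simp add: cls_def)
  then show "A \<approx> B" by (rule eqv_sym)
next
  assume "A \<approx> B"
  then show "cls A = cls B" unfolding cls_def using eqv_sym eqv_trans by blast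
qed

lemma cls_mult:
  assumes "set_mset A \<subseteq> carrier E" "set_mset B \<subseteq> carrier E"
  shows "cls A \<otimes>\<^bsub>words\<^esub> cls B = cls (A + B)"
proof (intro equalityI subsetI)
  fix C assume "C \<in> cls A \<otimes>\<^bsub>words\<^esub> cls B"
  then obtain A' B' where "A \<approx> A'" "B \<approx> B'" "A' + B' \<approx> C" by (auto simp: words_def cls_def)
  then show "C \<in> cls (A + B)" using eqv_trans[OF eqv_union] by (auto simp: cls_def)
next
  fix C assume "C \<in> cls (A + B)"
  then show "C \<in> cls A \<otimes>\<^bsub>words\<^esub> cls B"
    using eqv_refl assms by (auto simp: words_def cls_def)
qed

lemma words_one: "\<one>\<^bsub>words\<^esub> = cls {#}"
  by (simp add: words_def)

text \<open>Classes of words are named by lists over E, so that the group of differences gets the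
  element type \<open>('a list \<times> 'a list) set\<close>. Cancellation, conicality and
  refinement are the facts proved above for the equivalence of words.\<close>

lemma group_of_differences_words:
  "group_of_differences words (lists (carrier E)) (\<lambda>v. cls (mset v))"
proof (intro group_of_differences.intro group_of_differences_axioms.intro)
  show "comm_monoid words"
  proof (rule comm_monoidI)
    fix X Y Z assume X: "X \<in> carrier words" and Y: "Y \<in> carrier words"
    obtain A where A: "set_mset A \<subseteq> carrier E" "X = cls A" using X by (rule wordsE)
    obtain B where B: "set_mset B \<subseteq> carrier E" "Y = cls B" using Y by (rule wordsE)
    show "X \<otimes>\<^bsub>words\<^esub> Y \<in> carrier words" using A B by (simp add: cls_mult cls_closed)
    show "X \<otimes>\<^bsub>words\<^esub> Y = Y \<otimes>\<^bsub>words\<^esub> X" using A B by (simp add: cls_mult add.commute)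
    show "\<one>\<^bsub>words\<^esub> \<otimes>\<^bsub>words\<^esub> X = X" using A by (simp add: cls_mult words_one)
    assume Z: "Z \<in> carrier words"
    obtain C where C: "set_mset C \<subseteq> carrier E" "Z = cls C" using Z by (rule wordsE)
    show "X \<otimes>\<^bsub>words\<^esub> Y \<otimes>\<^bsub>words\<^esub> Z = X \<otimes>\<^bsub>words\<^esub> (Y \<otimes>\<^bsub>words\<^esub> Z)"
      using A B C by (simp add: cls_mult add.assoc)
  qed (simp add: words_one cls_closed)
  show "(\<lambda>v. cls (mset v)) ` lists (carrier E) = carrier words"
  proof (intro equalityI subsetI)
    fix X assume "X \<in> carrier words"
    then obtain A where A: "set_mset A \<subseteq> carrier E" "X = cls A" by (rule wordsE)
    obtain v where "mset v = A" using ex_mset by blast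
    with A show "X \<in> (\<lambda>v. cls (mset v)) ` lists (carrier E)" by (intro image_eqI[of _ _ v]) auto
  qed (auto intro!: cls_closed)
next
  fix X Y Z
  assume eq: "Z \<otimes>\<^bsub>words\<^esub> X = Z \<otimes>\<^bsub>words\<^esub> Y"
    and X: "X \<in> carrier words" and Y: "Y \<in> carrier words" and Z: "Z \<in> carrier words"
  obtain A where A: "set_mset A \<subseteq> carrier E" "X = cls A" using X by (rule wordsE)
  obtain B where B: "set_mset B \<subseteq> carrier E" "Y = cls B" using Y by (rule wordsE)
  obtain C where C: "set_mset C \<subseteq> carrier E" "Z = cls C" using Z by (rule wordsE)
  have "C + A \<approx> C + B" using eq A B C by (simp add: cls_mult cls_eq_iff)
  then show "X = Y" using A B by (simp add: cls_eq_iff) (rule eqv_cancel)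
next
  fix X Y
  assume eq: "X \<otimes>\<^bsub>words\<^esub> Y = \<one>\<^bsub>words\<^esub>" and X: "X \<in> carrier words" and Y: "Y \<in> carrier words"
  obtain A where A: "set_mset A \<subseteq> carrier E" "X = cls A" using X by (rule wordsE)
  obtain B where B: "set_mset B \<subseteq> carrier E" "Y = cls B" using Y by (rule wordsE)
  have "A + B \<approx> {#}" using eq A B by (simp add: cls_mult cls_eq_iff words_one)
  then show "X = \<one>\<^bsub>words\<^esub>" using A by (simp add: cls_eq_iff words_one) (rule eqv_empty)
next
  fix X1 X2 Y1 Y2
  assume eq: "X1 \<otimes>\<^bsub>words\<^esub> X2 = Y1 \<otimes>\<^bsub>words\<^esub> Y2"
    and X: "X1 \<in> carrier words" "X2 \<in> carrier words" "Y1 \<in> carrier words" "Y2 \<in> carrier words"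
  obtain A1 where A1: "set_mset A1 \<subseteq> carrier E" "X1 = cls A1" using X(1) by (rule wordsE)
  obtain A2 where A2: "set_mset A2 \<subseteq> carrier E" "X2 = cls A2" using X(2) by (rule wordsE)
  obtain B1 where B1: "set_mset B1 \<subseteq> carrier E" "Y1 = cls B1" using X(3) by (rule wordsE)
  obtain B2 where B2: "set_mset B2 \<subseteq> carrier E" "Y2 = cls B2" using X(4) by (rule wordsE)
  have "A1 + A2 \<approx> B1 + B2" using eq A1 A2 B1 B2 by (simp add: cls_mult cls_eq_iff)
  from eqv_refinement[OF this] obtain W V T S
    where *: "A1 \<approx> W + V" "A2 \<approx> T + S" "B1 \<approx> W + T" "B2 \<approx> V + S" by (elim exE conjE)
  have c: "set_mset W \<subseteq> carrier E" "set_mset V \<subseteq> carrier E" "set_mset T \<subseteq> carrier E"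
    "set_mset S \<subseteq> carrier E" using *[THEN eqv_closed(2)] by simp_all
  show "\<exists>w\<in>carrier words. \<exists>v\<in>carrier words. \<exists>t\<in>carrier words. \<exists>s\<in>carrier words.
      X1 = w \<otimes>\<^bsub>words\<^esub> v \<and> X2 = t \<otimes>\<^bsub>words\<^esub> s \<and> Y1 = w \<otimes>\<^bsub>words\<^esub> t \<and> Y2 = v \<otimes>\<^bsub>words\<^esub> s"
    using A1 A2 B1 B2 c *
    by (intro bexI[of _ "cls W"] bexI[of _ "cls V"] bexI[of _ "cls T"] bexI[of _ "cls S"])
      (simp_all add: cls_mult cls_closed cls_eq_iff)
qed

sublocale W: group_of_differences words "lists (carrier E)" "\<lambda>v. cls (mset v)"
  by (rule group_of_differences_words)

abbreviation univ :: "('a list \<times> 'a list) set pogroup" where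
  "univ \<equiv> W.diffs"

definition wemb :: "'a multiset \<Rightarrow> ('a list \<times> 'a list) set" where
  "wemb A = W.emb (cls A)"

definition iota :: "'a \<Rightarrow> ('a list \<times> 'a list) set" where
  "iota a = wemb {#a#}"

lemma wemb_pos: "set_mset A \<subseteq> carrier E \<Longrightarrow> wemb A \<in> pg_pos univ"
  unfolding W.pos_diffs wemb_def by (simp add: cls_closed)

lemma pos_univE:
  assumes "X \<in> pg_pos univ" obtains A where "set_mset A \<subseteq> carrier E" "X = wemb A"
proof -
  obtain q where q: "q \<in> carrier words" "X = W.emb q"
    using assms unfolding W.pos_diffs by (elim imageE)
  obtain A where "set_mset A \<subseteq> carrier E" "q = cls A" using q(1) by (rule wordsE)
  then show thesis using q(2) by (intro that[of A]) (simp_all add: wemb_def)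
qed

lemma wemb_union:
  "set_mset A \<subseteq> carrier E \<Longrightarrow> set_mset B \<subseteq> carrier E \<Longrightarrow> wemb (A + B) = wemb A \<otimes>\<^bsub>univ\<^esub> wemb B"
  by (simp add: wemb_def cls_closed flip: cls_mult W.emb_mult)

lemma wemb_eq_iff:
  "set_mset A \<subseteq> carrier E \<Longrightarrow> set_mset B \<subseteq> carrier E \<Longrightarrow> wemb A = wemb B \<longleftrightarrow> A \<approx> B"
  by (simp add: wemb_def cls_closed W.emb_eq_iff cls_eq_iff)

lemma wemb_empty: "wemb {#} = \<one>\<^bsub>univ\<^esub>"
  by (simp add: wemb_def W.emb_one flip: words_one)

lemma wemb_msum:
  assumes "msum A = Some a" shows "wemb A = iota a"
  unfolding iota_def using assms msum_closed_mem[OF assms] msum_closed[OF assms]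
  by (subst wemb_eq_iff) (auto intro!: msum_eqv simp: osum_zero)

text \<open>Equivalent words have the same sum, including whether it is defined. Hence an equation
  in the group forces the corresponding partial sum in E to exist, and the embedding of E reflects
  sums and order.\<close>

lemma msum_wemb:
  assumes "wemb A = iota a" "set_mset A \<subseteq> carrier E" "a \<in> carrier E" shows "msum A = Some a"
proof -
  have "A \<approx> {#a#}" using assms unfolding iota_def by (simp add: wemb_eq_iff)
  then show ?thesis using eqv_msum assms(3) by (simp add: osum_zero)
qed

lemma iota_pos: "a \<in> carrier E \<Longrightarrow> iota a \<in> pg_pos univ"
  unfolding iota_def by (intro wemb_pos) simp

lemma iota_closed: "a \<in> carrier E \<Longrightarrow> iota a \<in> carrier univ"
  using iota_pos W.D.posD by blast

lemma iota_osum_iff: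
  assumes "a \<in> carrier E" "b \<in> carrier E" "c \<in> carrier E"
  shows "iota c = iota a \<otimes>\<^bsub>univ\<^esub> iota b \<longleftrightarrow> Some a \<uplus> Some b = Some c"
proof -
  have *: "wemb {#a, b#} = iota a \<otimes>\<^bsub>univ\<^esub> iota b"
    using wemb_union[of "{#a#}" "{#b#}"] assms by (simp add: iota_def add_mset_commute)
  have **: "msum {#a, b#} = Some a \<uplus> Some b" using assms by (simp add: osum_zero)
  show ?thesis
    using wemb_msum[of "{#a, b#}" c] msum_wemb[of "{#a, b#}" c] assms unfolding * ** by auto
qed

lemma iota_inj: "a \<in> carrier E \<Longrightarrow> b \<in> carrier E \<Longrightarrow> iota a = iota b \<Longrightarrow> a = b"
  using msum_wemb[of "{#a#}" b] by (simp add: iota_def msum_single del: msum_simps)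

lemma iota_zero: "iota \<zero>\<^sub>E = \<one>\<^bsub>univ\<^esub>"
  using wemb_msum[of "{#}" "\<zero>\<^sub>E"] by (simp add: wemb_empty)

lemma iota_le_iff:
  assumes "a \<in> carrier E" "b \<in> carrier E"
  shows "iota a \<preceq>\<^bsub>univ\<^esub> iota b \<longleftrightarrow> ea_le E a b"
proof
  assume "iota a \<preceq>\<^bsub>univ\<^esub> iota b"
  then obtain X where X: "X \<in> pg_pos univ" "iota b = iota a \<otimes>\<^bsub>univ\<^esub> X"
    using W.D.le_iff_pos[OF iota_closed iota_closed] assms by blast
  obtain A where A: "set_mset A \<subseteq> carrier E" "X = wemb A" using X(1) by (rule pos_univE)
  have "wemb (add_mset a A) = iota b"
    using wemb_union[of "{#a#}" A] A X assms by (simp add: iota_def)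
  then have "msum (add_mset a A) = Some b" by (rule msum_wemb) (use A assms in auto)
  then have "Some a \<uplus> msum A = Some b" by simp
  then show "ea_le E a b" by (metis leI osum_eq_SomeE)
next
  assume "ea_le E a b"
  then obtain c where c: "c \<in> carrier E" "Some a \<uplus> Some c = Some b" by (rule leE)
  then have "iota b = iota a \<otimes>\<^bsub>univ\<^esub> iota c" using iota_osum_iff assms by blast
  then show "iota a \<preceq>\<^bsub>univ\<^esub> iota b"
    using W.D.le_mult_pos iota_closed iota_pos assms c by simp
qed

text \<open>\<open>X\<close> and its difference to the unit are given by words \<open>A\<close> and
  \<open>B\<close>. Their union represents the unit, so it has the sum 1 in E; in particular the sum
  of \<open>A\<close> exists, and \<open>X\<close> is its image.\<close>

lemma iota_surj:
  assumes "X \<in> carrier univ" "\<one>\<^bsub>univ\<^esub> \<preceq>\<^bsub>univ\<^esub> X" "X \<preceq>\<^bsub>univ\<^esub> iota \<one>\<^sub>E"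
  shows "X \<in> iota ` carrier E"
proof -
  have "X \<in> pg_pos univ" using assms by (simp add: pg_pos_def)
  then obtain A where A: "set_mset A \<subseteq> carrier E" "X = wemb A" by (rule pos_univE)
  obtain Y where Y: "Y \<in> pg_pos univ" "iota \<one>\<^sub>E = X \<otimes>\<^bsub>univ\<^esub> Y"
    using W.D.le_iff_pos[OF assms(1) iota_closed[OF one_closed]] assms(3) by blast
  obtain B where B: "set_mset B \<subseteq> carrier E" "Y = wemb B" using Y(1) by (rule pos_univE)
  have "wemb (A + B) = iota \<one>\<^sub>E" using A B Y by (simp add: wemb_union)
  then have "msum (A + B) = Some \<one>\<^sub>E" by (rule msum_wemb) (use A B one_closed in auto)
  then have "msum A \<uplus> msum B = Some \<one>\<^sub>E" by (simp add: msum_union)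
  then obtain a where "msum A = Some a" "a \<in> carrier E" by (metis osum_eq_SomeE)
  then show ?thesis using wemb_msum A by blast
qed

lemma iota_below_pos:
  assumes "X \<in> pg_pos univ" "X \<noteq> \<one>\<^bsub>univ\<^esub>"
  obtains a where "a \<in> carrier E" "a \<noteq> \<zero>\<^sub>E" "iota a \<preceq>\<^bsub>univ\<^esub> X"
proof -
  obtain A where A: "set_mset A \<subseteq> carrier E" "X = wemb A" using assms(1) by (rule pos_univE)
  have "\<exists>a\<in>#A. a \<noteq> \<zero>\<^sub>E"
  proof (rule ccontr)
    assume "\<not> (\<exists>a\<in>#A. a \<noteq> \<zero>\<^sub>E)"
    then have "msum A = Some \<zero>\<^sub>E"
      by (induction A) (auto simp: osum_zero zero_closed)
    then show False using wemb_msum A assms iota_zero by simp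
  qed
  then obtain a B where B: "A = add_mset a B" "a \<noteq> \<zero>\<^sub>E" by (metis insert_DiffM)
  have "X = iota a \<otimes>\<^bsub>univ\<^esub> wemb B"
    using wemb_union[of "{#a#}" B] A B by (simp add: iota_def)
  then have "iota a \<preceq>\<^bsub>univ\<^esub> X"
    using W.D.le_mult_pos[of "iota a" "wemb B"] wemb_pos[of B] iota_closed[of a] A B by simp
  then show thesis using that[of a] A B by simp
qed

lemma wemb_le_power:
  "set_mset A \<subseteq> carrier E \<Longrightarrow> wemb A \<preceq>\<^bsub>univ\<^esub> iota \<one>\<^sub>E [^]\<^bsub>univ\<^esub> size A"
proof (induction A)
  case empty
  then show ?case by (simp add: wemb_empty W.D.le_refl)
next
  case (add a A)
  have [simp]: "wemb A \<in> carrier univ" "iota a \<in> carrier univ" "iota \<one>\<^sub>E \<in> carrier univ"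
    using add.prems wemb_pos[of A] W.D.posD iota_closed one_closed by auto
  have "iota a \<preceq>\<^bsub>univ\<^esub> iota \<one>\<^sub>E" using add.prems iota_le_iff le_one one_closed by simp
  then have "wemb A \<otimes>\<^bsub>univ\<^esub> iota a \<preceq>\<^bsub>univ\<^esub> wemb A \<otimes>\<^bsub>univ\<^esub> iota \<one>\<^sub>E" by (intro W.D.le_mult[of "iota a"]) simp_all
  moreover have "wemb A \<otimes>\<^bsub>univ\<^esub> iota \<one>\<^sub>E \<preceq>\<^bsub>univ\<^esub> iota \<one>\<^sub>E [^]\<^bsub>univ\<^esub> Suc (size A)"
    using W.D.le_mult[of "wemb A" "iota \<one>\<^sub>E [^]\<^bsub>univ\<^esub> size A" "iota \<one>\<^sub>E"] add.IH add.prems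
      W.D.nat_pow_closed[of "iota \<one>\<^sub>E"] by (simp add: W.D.m_comm)
  ultimately have "wemb A \<otimes>\<^bsub>univ\<^esub> iota a \<preceq>\<^bsub>univ\<^esub> iota \<one>\<^sub>E [^]\<^bsub>univ\<^esub> Suc (size A)"
    using W.D.le_trans[of "wemb A \<otimes>\<^bsub>univ\<^esub> iota a" "wemb A \<otimes>\<^bsub>univ\<^esub> iota \<one>\<^sub>E"]
      W.D.nat_pow_closed[of "iota \<one>\<^sub>E" "Suc (size A)"] by simp
  moreover have "wemb (add_mset a A) = wemb A \<otimes>\<^bsub>univ\<^esub> iota a"
    using wemb_union[of A "{#a#}"] add.prems by (simp add: iota_def)
  ultimately show ?case by simp
qed

lemma strong_unit_univ: "pg_strong_unit univ (iota \<one>\<^sub>E)"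
  unfolding pg_strong_unit_def
proof (intro conjI ballI)
  show "iota \<one>\<^sub>E \<in> pg_pos univ" using iota_pos one_closed by blast
  fix X assume X: "X \<in> carrier univ"
  then obtain Y where Y: "Y \<in> carrier univ" "X \<preceq>\<^bsub>univ\<^esub> Y" "\<one>\<^bsub>univ\<^esub> \<preceq>\<^bsub>univ\<^esub> Y"
    using W.directed_diffs W.D.one_closed unfolding pg_directed_def by blast
  then have "Y \<in> pg_pos univ" by (simp add: pg_pos_def)
  then obtain A where A: "set_mset A \<subseteq> carrier E" "Y = wemb A" by (rule pos_univE)
  have "X \<preceq>\<^bsub>univ\<^esub> iota \<one>\<^sub>E [^]\<^bsub>univ\<^esub> size A"
    using W.D.le_trans[OF X Y(1) _ Y(2)] wemb_le_power[OF A(1)] A(2) iota_closed one_closed by simp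
  then show "\<exists>n::nat. X \<preceq>\<^bsub>univ\<^esub> iota \<one>\<^sub>E [^]\<^bsub>univ\<^esub> n" by blast
qed

text \<open>Every nonzero positive element of the group dominates a nonzero element of E, so the
  criterion for antilattices has to be checked in E only.\<close>

lemma antilattice_univ:
  assumes "\<And>a b. \<lbrakk>a \<in> carrier E; b \<in> carrier E; a \<noteq> \<zero>\<^sub>E; b \<noteq> \<zero>\<^sub>E\<rbrakk> \<Longrightarrow>
    \<exists>w. w \<noteq> \<zero>\<^sub>E \<and> ea_le E w a \<and> ea_le E w b"
  shows "antilattice (pg_order univ)"
proof (rule W.D.antilatticeI)
  fix X Y assume *: "X \<in> pg_pos univ" "Y \<in> pg_pos univ" "X \<noteq> \<one>\<^bsub>univ\<^esub>" "Y \<noteq> \<one>\<^bsub>univ\<^esub>"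
  obtain a where a: "a \<in> carrier E" "a \<noteq> \<zero>\<^sub>E" "iota a \<preceq>\<^bsub>univ\<^esub> X" using *(1,3) by (rule iota_below_pos)
  obtain b where b: "b \<in> carrier E" "b \<noteq> \<zero>\<^sub>E" "iota b \<preceq>\<^bsub>univ\<^esub> Y" using *(2,4) by (rule iota_below_pos)
  obtain w where w: "w \<noteq> \<zero>\<^sub>E" "ea_le E w a" "ea_le E w b" using assms a b by blast
  have wE: "w \<in> carrier E" using w le_closed by blast
  have "iota w \<preceq>\<^bsub>univ\<^esub> X"
    using W.D.le_trans[of "iota w" "iota a" X] w a wE * iota_le_iff iota_closed W.D.posD by simp
  moreover have "iota w \<preceq>\<^bsub>univ\<^esub> Y"
    using W.D.le_trans[of "iota w" "iota b" Y] w b wE * iota_le_iff iota_closed W.D.posD by simp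
  moreover have "iota w \<noteq> \<one>\<^bsub>univ\<^esub>" using iota_inj[OF wE zero_closed] w iota_zero by auto
  ultimately show "\<exists>w\<in>pg_pos univ. w \<noteq> \<one>\<^bsub>univ\<^esub> \<and> w \<preceq>\<^bsub>univ\<^esub> X \<and> w \<preceq>\<^bsub>univ\<^esub> Y"
    using iota_pos wE by blast
qed

end

section \<open>Interpolation and lexicographic products\<close>

text \<open>The Riesz interpolation property, which is equivalent to RDP for Abelian po-groups. It
  speaks of the order alone, and the order of a lexicographic product is easier to analyse than
  decompositions of sums.\<close>

definition pg_interp :: "'g pogroup \<Rightarrow> bool" where
  "pg_interp G \<longleftrightarrow> (\<forall>x1\<in>carrier G. \<forall>x2\<in>carrier G. \<forall>y1\<in>carrier G. \<forall>y2\<in>carrier G.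
     x1 \<preceq>\<^bsub>G\<^esub> y1 \<and> x1 \<preceq>\<^bsub>G\<^esub> y2 \<and> x2 \<preceq>\<^bsub>G\<^esub> y1 \<and> x2 \<preceq>\<^bsub>G\<^esub> y2 \<longrightarrow>
     (\<exists>z\<in>carrier G. x1 \<preceq>\<^bsub>G\<^esub> z \<and> x2 \<preceq>\<^bsub>G\<^esub> z \<and> z \<preceq>\<^bsub>G\<^esub> y1 \<and> z \<preceq>\<^bsub>G\<^esub> y2))"

context abelian_po_group
begin

text \<open>Additively, y1 - x1 and y2 - x2 have the same sum as y2 - x1 and y1 - x2. In a
  refinement of this equation, c11 is common to y1 - x1 and y2 - x1, and x1 + c11 interpolates: it
  lies below y1 and y2 by c12 and c21, and above x2 by c22.\<close>

lemma rdp_imp_interp: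
  assumes "pg_rdp G" shows "pg_interp G"
  unfolding pg_interp_def
proof (intro ballI impI)
  fix x1 x2 y1 y2
  assume C: "x1 \<in> carrier G" "x2 \<in> carrier G" "y1 \<in> carrier G" "y2 \<in> carrier G"
    and le: "x1 \<preceq> y1 \<and> x1 \<preceq> y2 \<and> x2 \<preceq> y1 \<and> x2 \<preceq> y2"
  obtain a where a: "a \<in> pg_pos G" "y1 = x1 \<otimes> a" using le_iff_pos[of x1 y1] C le by auto
  obtain b where b: "b \<in> pg_pos G" "y2 = x1 \<otimes> b" using le_iff_pos[of x1 y2] C le by auto
  obtain b' where b': "b' \<in> pg_pos G" "y1 = x2 \<otimes> b'" using le_iff_pos[of x2 y1] C le by auto
  obtain c where c: "c \<in> pg_pos G" "y2 = x2 \<otimes> c" using le_iff_pos[of x2 y2] C le by auto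
  have [simp]: "a \<in> carrier G" "b \<in> carrier G" "b' \<in> carrier G" "c \<in> carrier G"
    using a b b' c posD by blast+
  have "(x1 \<otimes> a) \<otimes> (x2 \<otimes> c) = (x2 \<otimes> b') \<otimes> (x1 \<otimes> b)" using a b b' c by metis
  then have "(x1 \<otimes> x2) \<otimes> (a \<otimes> c) = (x1 \<otimes> x2) \<otimes> (b \<otimes> b')" using C by (simp add: m_ac)
  then have "a \<otimes> c = b \<otimes> b'" using C by (simp del: m_assoc)
  then have "\<exists>c11\<in>pg_pos G. \<exists>c12\<in>pg_pos G. \<exists>c21\<in>pg_pos G. \<exists>c22\<in>pg_pos G.
        a = c11 \<otimes> c12 \<and> c = c21 \<otimes> c22 \<and> b = c11 \<otimes> c21 \<and> b' = c12 \<otimes> c22"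
    using assms[unfolded pg_rdp_def, rule_format, OF a(1) c(1) b(1) b'(1)] by blast
  then obtain c11 c12 c21 c22
    where p: "c11 \<in> pg_pos G" "c12 \<in> pg_pos G" "c21 \<in> pg_pos G" "c22 \<in> pg_pos G"
      and eq: "a = c11 \<otimes> c12" "c = c21 \<otimes> c22" "b = c11 \<otimes> c21" "b' = c12 \<otimes> c22"
    by (elim bexE conjE)
  have [simp]: "c11 \<in> carrier G" "c12 \<in> carrier G" "c21 \<in> carrier G" "c22 \<in> carrier G"
    using p posD by blast+
  define z where "z = x1 \<otimes> c11"
  have z: "z \<in> carrier G" using C by (simp add: z_def)
  have "x1 \<preceq> z" using le_mult_pos C p by (simp add: z_def)
  moreover have "y1 = z \<otimes> c12" "y2 = z \<otimes> c21" using a b eq C by (simp_all add: z_def m_ac)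
  then have "z \<preceq> y1" "z \<preceq> y2" using le_mult_pos[OF z] p by simp_all
  moreover have "c12 \<otimes> (x2 \<otimes> c22) = c12 \<otimes> z"
    using a(2) b'(2) eq C by (simp add: z_def m_ac)
  then have "x2 \<otimes> c22 = z" using C z by simp
  then have "x2 \<preceq> z" using le_mult_pos[of x2 c22] C p by simp
  ultimately show "\<exists>z\<in>carrier G. x1 \<preceq> z \<and> x2 \<preceq> z \<and> z \<preceq> y1 \<and> z \<preceq> y2" using z by blast
qed

text \<open>The entry c11 determines the others, and all four are positive iff 0 and a1 - b2 lie
  below c11 and c11 lies below a1 and b1. These are interpolation conditions; adding b2 to all of
  them removes the difference, so the interpolant \<open>z\<close> is b2 + c11.\<close>

lemma interp_imp_rdp:
  assumes "pg_interp G" shows "pg_rdp G"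
  unfolding pg_rdp_def
proof (intro ballI impI)
  fix a1 a2 b1 b2
  assume p: "a1 \<in> pg_pos G" "a2 \<in> pg_pos G" "b1 \<in> pg_pos G" "b2 \<in> pg_pos G"
    and eq: "a1 \<otimes> a2 = b1 \<otimes> b2"
  have C [simp]: "a1 \<in> carrier G" "a2 \<in> carrier G" "b1 \<in> carrier G" "b2 \<in> carrier G"
    using p posD by blast+
  have "b2 \<preceq> a1 \<otimes> b2" "b2 \<preceq> a1 \<otimes> a2" "a1 \<preceq> a1 \<otimes> b2" "a1 \<preceq> a1 \<otimes> a2"
    using le_mult_pos[of b2 a1] le_mult_pos[of b2 b1] le_mult_pos[of a1 b2] le_mult_pos[of a1 a2]
      m_comm[of b2 a1] m_comm[of b2 b1] eq p by simp_all
  then have "\<exists>z\<in>carrier G. b2 \<preceq> z \<and> a1 \<preceq> z \<and> z \<preceq> a1 \<otimes> b2 \<and> z \<preceq> a1 \<otimes> a2"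
    using assms[unfolded pg_interp_def, rule_format, of b2 a1 "a1 \<otimes> b2" "a1 \<otimes> a2"] C by simp
  then obtain z where z: "z \<in> carrier G" and le: "b2 \<preceq> z" "a1 \<preceq> z" "z \<preceq> a1 \<otimes> b2" "z \<preceq> a1 \<otimes> a2"
    by blast
  obtain c11 where 1: "c11 \<in> pg_pos G" "z = b2 \<otimes> c11" using le_iff_pos[of b2 z] le z by auto
  obtain c22 where 2: "c22 \<in> pg_pos G" "z = a1 \<otimes> c22" using le_iff_pos[of a1 z] le z by auto
  obtain c12 where 3: "c12 \<in> pg_pos G" "a1 \<otimes> b2 = z \<otimes> c12"
    using le_iff_pos[of z "a1 \<otimes> b2"] le z by auto
  obtain c21 where 4: "c21 \<in> pg_pos G" "a1 \<otimes> a2 = z \<otimes> c21"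
    using le_iff_pos[of z "a1 \<otimes> a2"] le z by auto
  have D [simp]: "c11 \<in> carrier G" "c12 \<in> carrier G" "c21 \<in> carrier G" "c22 \<in> carrier G"
    using 1 2 3 4 posD by blast+
  have "b2 \<otimes> a1 = b2 \<otimes> (c11 \<otimes> c12)" using 3(2) 1(2) by (simp add: m_ac)
  then have r1: "a1 = c11 \<otimes> c12" by simp
  have "b2 \<otimes> b1 = b2 \<otimes> (c11 \<otimes> c21)" using 4(2) 1(2) eq by (simp add: m_ac)
  then have r2: "b1 = c11 \<otimes> c21" by simp
  have "c11 \<otimes> b2 = c11 \<otimes> (c12 \<otimes> c22)" using 1(2) 2(2) r1 by (simp add: m_ac)
  then have r3: "b2 = c12 \<otimes> c22" by simp
  have "a1 \<otimes> a2 = a1 \<otimes> (c21 \<otimes> c22)" using 4(2) 2(2) by (simp add: m_ac)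
  then have r4: "a2 = c21 \<otimes> c22" by simp
  show "\<exists>c11\<in>pg_pos G. \<exists>c12\<in>pg_pos G. \<exists>c21\<in>pg_pos G. \<exists>c22\<in>pg_pos G.
        a1 = c11 \<otimes> c12 \<and> a2 = c21 \<otimes> c22 \<and> b1 = c11 \<otimes> c21 \<and> b2 = c12 \<otimes> c22"
    using 1(1) 2(1) 3(1) 4(1) r1 r2 r3 r4 by blast
qed

lemma directed_lower:
  assumes "pg_directed G" "a \<in> carrier G" "b \<in> carrier G"
  shows "\<exists>c\<in>carrier G. c \<preceq> a \<and> c \<preceq> b"
proof -
  obtain d where d: "d \<in> carrier G" "inv a \<preceq> d" "inv b \<preceq> d"
    using assms unfolding pg_directed_def by (meson inv_closed)
  have *: "inv d \<preceq> x" if x: "x \<in> carrier G" "inv x \<preceq> d" for x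
  proof -
    have "(x \<otimes> inv d) \<otimes> inv x \<preceq> (x \<otimes> inv d) \<otimes> d"
      using x d by (intro le_mult[OF _ _ _ x(2)]) simp_all
    moreover have "(x \<otimes> inv d) \<otimes> inv x = inv d"
      using x d m_comm[of x "inv d"] by (simp add: m_assoc)
    moreover have "(x \<otimes> inv d) \<otimes> d = x"
      using x d by (simp add: m_assoc)
    ultimately show ?thesis by simp
  qed
  then show ?thesis using assms d by blast
qed

text \<open>A common upper bound c of x and 0 writes x as the difference of the positive elements c
  and d, which cannot both be 0.\<close>

lemma directed_pos:
  assumes "pg_directed G" "pg_nontrivial G"
  obtains p where "p \<in> pg_pos G" "p \<noteq> \<one>"
proof -
  obtain x where x: "x \<in> carrier G" "x \<noteq> \<one>" using assms(2) unfolding pg_nontrivial_def by auto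
  obtain c where c: "c \<in> carrier G" "x \<preceq> c" "\<one> \<preceq> c"
    using assms(1) x(1) unfolding pg_directed_def by (meson one_closed)
  then have cp: "c \<in> pg_pos G" by (simp add: pg_pos_def)
  obtain d where d: "d \<in> pg_pos G" "c = x \<otimes> d" using le_iff_pos[of x c] x c by auto
  show thesis
  proof (cases "c = \<one>")
    case True
    then have "d \<noteq> \<one>" using d x by auto
    then show thesis using d that by blast
  qed (use cp that in blast)
qed

text \<open>A converse of \<open>antilatticeI\<close> under interpolation. If 0 were the only
  positive common lower bound, then any common lower bound v would be below 0, by interpolating
  between 0, v and a, b; so 0 would be the infimum. Then \<open>a\<close> and \<open>b\<close> would
  be comparable, and the smaller one is a nonzero common lower bound.\<close>

lemma antilatticeD:
  assumes "antilattice (pg_order G)" "pg_interp G"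
    and a: "a \<in> pg_pos G" "a \<noteq> \<one>" and b: "b \<in> pg_pos G" "b \<noteq> \<one>"
  shows "\<exists>w\<in>pg_pos G. w \<noteq> \<one> \<and> w \<preceq> a \<and> w \<preceq> b"
proof (rule ccontr)
  assume no: "\<not> ?thesis"
  have C: "a \<in> carrier G" "b \<in> carrier G" "\<one> \<preceq> a" "\<one> \<preceq> b" using a b posD by blast+
  have "v \<preceq> \<one>" if v: "v \<in> carrier G" "v \<preceq> a" "v \<preceq> b" for v
  proof -
    have "\<exists>w\<in>carrier G. \<one> \<preceq> w \<and> v \<preceq> w \<and> w \<preceq> a \<and> w \<preceq> b"
      using assms(2)[unfolded pg_interp_def, rule_format, of \<one> v a b] C v by simp
    then obtain w where w: "w \<in> carrier G" "\<one> \<preceq> w" "v \<preceq> w" "w \<preceq> a" "w \<preceq> b" by blast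
    then have "w = \<one>" using no by (auto simp: pg_pos_def)
    then show ?thesis using w by simp
  qed
  then have "is_glb (pg_order G) \<one> {a, b}" using C by (simp add: is_glb_iff)
  then have "a \<preceq> b \<or> b \<preceq> a" using assms(1) C unfolding antilattice_def by (auto simp: pg_order_def)
  then show False using no a b C le_refl by blast
qed

end

lemma lex_prod_simps [simp]:
  "carrier (H \<times>\<^sub>l\<^sub>e\<^sub>x G) = carrier H \<times> carrier G"
  "(a, x) \<otimes>\<^bsub>H \<times>\<^sub>l\<^sub>e\<^sub>x G\<^esub> (b, y) = (a \<otimes>\<^bsub>H\<^esub> b, x \<otimes>\<^bsub>G\<^esub> y)"
  "\<one>\<^bsub>H \<times>\<^sub>l\<^sub>e\<^sub>x G\<^esub> = (\<one>\<^bsub>H\<^esub>, \<one>\<^bsub>G\<^esub>)"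
  "(a, x) \<preceq>\<^bsub>H \<times>\<^sub>l\<^sub>e\<^sub>x G\<^esub> (b, y) \<longleftrightarrow> (a \<preceq>\<^bsub>H\<^esub> b \<and> a \<noteq> b) \<or> (a = b \<and> x \<preceq>\<^bsub>G\<^esub> y)"
  by (simp_all add: lex_prod_def monoid.defs pogroup.defs DirProd_def)

locale lex_product = H: abelian_po_group H + G: abelian_po_group G
  for H :: "'h pogroup" and G :: "'g pogroup"
begin

lemma abelian_po_group_lex: "abelian_po_group (H \<times>\<^sub>l\<^sub>e\<^sub>x G)"
proof (rule abelian_po_groupI)
  show "comm_group (H \<times>\<^sub>l\<^sub>e\<^sub>x G)"
  proof (rule comm_groupI)
    fix x assume "x \<in> carrier (H \<times>\<^sub>l\<^sub>e\<^sub>x G)"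
    then show "\<exists>y\<in>carrier (H \<times>\<^sub>l\<^sub>e\<^sub>x G). y \<otimes>\<^bsub>H \<times>\<^sub>l\<^sub>e\<^sub>x G\<^esub> x = \<one>\<^bsub>H \<times>\<^sub>l\<^sub>e\<^sub>x G\<^esub>"
      by (intro bexI[of _ "(inv\<^bsub>H\<^esub> fst x, inv\<^bsub>G\<^esub> snd x)"]) auto
  qed (auto simp: H.m_ac G.m_ac)
next
  fix x y z
  assume C: "x \<in> carrier (H \<times>\<^sub>l\<^sub>e\<^sub>x G)" "y \<in> carrier (H \<times>\<^sub>l\<^sub>e\<^sub>x G)" "z \<in> carrier (H \<times>\<^sub>l\<^sub>e\<^sub>x G)"
  obtain a1 a2 b1 b2 c1 c2 where xyz: "x = (a1, a2)" "y = (b1, b2)" "z = (c1, c2)"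
    by (cases x; cases y; cases z)
  show "x \<preceq>\<^bsub>H \<times>\<^sub>l\<^sub>e\<^sub>x G\<^esub> z" if le: "x \<preceq>\<^bsub>H \<times>\<^sub>l\<^sub>e\<^sub>x G\<^esub> y" "y \<preceq>\<^bsub>H \<times>\<^sub>l\<^sub>e\<^sub>x G\<^esub> z"
    using le C H.le_trans[of a1 b1 c1] G.le_trans[of a2 b2 c2] H.le_antisym[of a1 b1]
    unfolding xyz by auto
  show "x \<otimes>\<^bsub>H \<times>\<^sub>l\<^sub>e\<^sub>x G\<^esub> z \<preceq>\<^bsub>H \<times>\<^sub>l\<^sub>e\<^sub>x G\<^esub> y \<otimes>\<^bsub>H \<times>\<^sub>l\<^sub>e\<^sub>x G\<^esub> z" if le: "x \<preceq>\<^bsub>H \<times>\<^sub>l\<^sub>e\<^sub>x G\<^esub> y"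
    using le C H.le_mult[of a1 b1 c1] G.le_mult[of a2 b2 c2]
    unfolding xyz by (auto simp: H.m_comm[of _ c1] G.m_comm[of _ c2])
next
  fix x y
  assume "x \<in> carrier (H \<times>\<^sub>l\<^sub>e\<^sub>x G)" "y \<in> carrier (H \<times>\<^sub>l\<^sub>e\<^sub>x G)"
    "x \<preceq>\<^bsub>H \<times>\<^sub>l\<^sub>e\<^sub>x G\<^esub> y" "y \<preceq>\<^bsub>H \<times>\<^sub>l\<^sub>e\<^sub>x G\<^esub> x"
  then show "x = y" by (cases x; cases y) (auto intro: H.le_antisym G.le_antisym)
qed (auto simp: G.le_refl)

sublocale L: abelian_po_group "H \<times>\<^sub>l\<^sub>e\<^sub>x G"
  by (rule abelian_po_group_lex)

text \<open>First components are interpolated by some \<open>m\<close> in H. A bound restricts the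
  second component only if its own first component equals \<open>m\<close>. If only upper or only
  lower bounds are active, directedness of G gives a suitable element; if there are active bounds of
  both kinds, interpolation in G does.\<close>

lemma interp_lex:
  assumes H: "pg_interp H" and G: "pg_interp G" and dir: "pg_directed G"
  shows "pg_interp (H \<times>\<^sub>l\<^sub>e\<^sub>x G)"
  unfolding pg_interp_def
proof (intro ballI impI)
  fix x1 x2 y1 y2
  assume C: "x1 \<in> carrier (H \<times>\<^sub>l\<^sub>e\<^sub>x G)" "x2 \<in> carrier (H \<times>\<^sub>l\<^sub>e\<^sub>x G)"
    "y1 \<in> carrier (H \<times>\<^sub>l\<^sub>e\<^sub>x G)" "y2 \<in> carrier (H \<times>\<^sub>l\<^sub>e\<^sub>x G)"
    and le: "x1 \<preceq>\<^bsub>H \<times>\<^sub>l\<^sub>e\<^sub>x G\<^esub> y1 \<and> x1 \<preceq>\<^bsub>H \<times>\<^sub>l\<^sub>e\<^sub>x G\<^esub> y2 \<and> x2 \<preceq>\<^bsub>H \<times>\<^sub>l\<^sub>e\<^sub>x G\<^esub> y1 \<and> x2 \<preceq>\<^bsub>H \<times>\<^sub>l\<^sub>e\<^sub>x G\<^esub> y2"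
  obtain h1 g1 h2 g2 k1 l1 k2 l2
    where xy: "x1 = (h1, g1)" "x2 = (h2, g2)" "y1 = (k1, l1)" "y2 = (k2, l2)"
    by (cases x1; cases x2; cases y1; cases y2)
  have c: "h1 \<in> carrier H" "h2 \<in> carrier H" "k1 \<in> carrier H" "k2 \<in> carrier H"
    "g1 \<in> carrier G" "g2 \<in> carrier G" "l1 \<in> carrier G" "l2 \<in> carrier G"
    using C unfolding xy by simp_all
  have "h1 \<preceq>\<^bsub>H\<^esub> k1 \<and> h1 \<preceq>\<^bsub>H\<^esub> k2 \<and> h2 \<preceq>\<^bsub>H\<^esub> k1 \<and> h2 \<preceq>\<^bsub>H\<^esub> k2"
    using le c H.le_refl unfolding xy by auto
  then have "\<exists>m\<in>carrier H. h1 \<preceq>\<^bsub>H\<^esub> m \<and> h2 \<preceq>\<^bsub>H\<^esub> m \<and> m \<preceq>\<^bsub>H\<^esub> k1 \<and> m \<preceq>\<^bsub>H\<^esub> k2"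
    by (rule H[unfolded pg_interp_def, rule_format, OF c(1-4)])
  then obtain m where m: "m \<in> carrier H" "h1 \<preceq>\<^bsub>H\<^esub> m" "h2 \<preceq>\<^bsub>H\<^esub> m" "m \<preceq>\<^bsub>H\<^esub> k1" "m \<preceq>\<^bsub>H\<^esub> k2"
    by blast
  have "\<exists>g\<in>carrier G. (h1 = m \<longrightarrow> g1 \<preceq>\<^bsub>G\<^esub> g) \<and> (h2 = m \<longrightarrow> g2 \<preceq>\<^bsub>G\<^esub> g) \<and>
      (k1 = m \<longrightarrow> g \<preceq>\<^bsub>G\<^esub> l1) \<and> (k2 = m \<longrightarrow> g \<preceq>\<^bsub>G\<^esub> l2)"
  proof -
    consider "h1 \<noteq> m \<and> h2 \<noteq> m" | "k1 \<noteq> m \<and> k2 \<noteq> m" | "(h1 = m \<or> h2 = m) \<and> (k1 = m \<or> k2 = m)" by blast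
    then show ?thesis
    proof cases
      case 1
      then show ?thesis using G.directed_lower[OF dir c(7,8)] by blast
    next
      case 2
      then show ?thesis using dir c(5,6) unfolding pg_directed_def by blast
    next
      case 3
      \<comment> \<open>An inactive bound is replaced by the active one on the same side, so that
        interpolation always receives two lower and two upper bounds.\<close>
      define g1' where "g1' = (if h1 = m then g1 else g2)"
      define g2' where "g2' = (if h2 = m then g2 else g1)"
      define l1' where "l1' = (if k1 = m then l1 else l2)"
      define l2' where "l2' = (if k2 = m then l2 else l1)"
      have c': "g1' \<in> carrier G" "g2' \<in> carrier G" "l1' \<in> carrier G" "l2' \<in> carrier G"
        using c by (simp_all add: g1'_def g2'_def l1'_def l2'_def)
      have "g1' \<preceq>\<^bsub>G\<^esub> l1' \<and> g1' \<preceq>\<^bsub>G\<^esub> l2' \<and> g2' \<preceq>\<^bsub>G\<^esub> l1' \<and> g2' \<preceq>\<^bsub>G\<^esub> l2'"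
        using le 3 unfolding xy g1'_def g2'_def l1'_def l2'_def by auto
      then have "\<exists>g\<in>carrier G. g1' \<preceq>\<^bsub>G\<^esub> g \<and> g2' \<preceq>\<^bsub>G\<^esub> g \<and> g \<preceq>\<^bsub>G\<^esub> l1' \<and> g \<preceq>\<^bsub>G\<^esub> l2'"
        by (rule G[unfolded pg_interp_def, rule_format, OF c'])
      then show ?thesis unfolding g1'_def g2'_def l1'_def l2'_def by (elim bexE) (auto intro!: bexI)
    qed
  qed
  then obtain g where "g \<in> carrier G" "h1 = m \<longrightarrow> g1 \<preceq>\<^bsub>G\<^esub> g" "h2 = m \<longrightarrow> g2 \<preceq>\<^bsub>G\<^esub> g"
      "k1 = m \<longrightarrow> g \<preceq>\<^bsub>G\<^esub> l1" "k2 = m \<longrightarrow> g \<preceq>\<^bsub>G\<^esub> l2" by blast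
  then show "\<exists>z\<in>carrier (H \<times>\<^sub>l\<^sub>e\<^sub>x G). x1 \<preceq>\<^bsub>H \<times>\<^sub>l\<^sub>e\<^sub>x G\<^esub> z \<and> x2 \<preceq>\<^bsub>H \<times>\<^sub>l\<^sub>e\<^sub>x G\<^esub> z \<and>
      z \<preceq>\<^bsub>H \<times>\<^sub>l\<^sub>e\<^sub>x G\<^esub> y1 \<and> z \<preceq>\<^bsub>H \<times>\<^sub>l\<^sub>e\<^sub>x G\<^esub> y2"
    unfolding xy using m by (intro bexI[of _ "(m, g)"]) auto
qed

end

section \<open>Isomorphisms onto intervals\<close>

lemma Gamma_simps [simp]:
  "carrier (Gamma K u) = {k \<in> carrier K. \<one>\<^bsub>K\<^esub> \<preceq>\<^bsub>K\<^esub> k \<and> k \<preceq>\<^bsub>K\<^esub> u}"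
  "ea_one (Gamma K u) = u"
  by (simp_all add: Gamma_def)

context abelian_po_group
begin

lemma Gamma_plus:
  assumes "u \<in> carrier G" "a \<in> carrier (Gamma G u)" "b \<in> carrier (Gamma G u)"
  shows "a \<boxplus>\<^bsub>Gamma G u\<^esub> b = Some c \<longleftrightarrow> c = a \<otimes> b \<and> c \<preceq> u"
  using assms le_inv[of a b u] by (auto simp: Gamma_def m_comm)

text \<open>The equivalence \<open>sum\<close> preserves sums in one direction and reflects them in
  the other, which makes the inverse a homomorphism too. \<open>F\<close> is an arbitrary structure
  of the given signature, so the criterion applies to quotients and generated subalgebras without a
  prior proof that they are effect algebras.\<close>

lemma iso_GammaI:
  assumes u: "u \<in> carrier G"
    and bij: "bij_betw f (carrier F) (carrier (Gamma G u))"
    and one: "ea_one F \<in> carrier F" "f (ea_one F) = u"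
    and closed: "\<And>x y z. \<lbrakk>x \<in> carrier F; y \<in> carrier F; x \<boxplus>\<^bsub>F\<^esub> y = Some z\<rbrakk> \<Longrightarrow> z \<in> carrier F"
    and sum: "\<And>x y z. \<lbrakk>x \<in> carrier F; y \<in> carrier F; z \<in> carrier F\<rbrakk> \<Longrightarrow>
      x \<boxplus>\<^bsub>F\<^esub> y = Some z \<longleftrightarrow> f z = f x \<otimes> f y"
  shows "F \<cong>\<^sub>e Gamma G u"
proof -
  have f: "f x \<in> carrier (Gamma G u)" if "x \<in> carrier F" for x
    using bij that by (rule bij_betw_apply)
  have hom: "f \<in> ea_hom F (Gamma G u)"
    unfolding ea_hom_def
  proof (intro CollectI conjI ballI allI impI)
    fix x y z assume x: "x \<in> carrier F" and y: "y \<in> carrier F" and xyz: "x \<boxplus>\<^bsub>F\<^esub> y = Some z"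
    have z: "z \<in> carrier F" using closed x y xyz by blast
    then have "f z = f x \<otimes> f y" using sum x y xyz by blast
    then show "f x \<boxplus>\<^bsub>Gamma G u\<^esub> f y = Some (f z)" using Gamma_plus[OF u f f] x y f[OF z] by simp
  qed (use f one in auto)
  define k where "k = inv_into (carrier F) f"
  have k: "k a \<in> carrier F" "f (k a) = a" if "a \<in> carrier (Gamma G u)" for a
    using bij_betw_inv_into[OF bij] that bij_betw_inv_into_right[OF bij that]
    unfolding k_def by (auto dest: bij_betw_apply)
  have "k \<in> ea_hom (Gamma G u) F"
    unfolding ea_hom_def
  proof (intro CollectI conjI ballI allI impI)
    have "k (f (ea_one F)) = ea_one F" unfolding k_def by (rule bij_betw_inv_into_left[OF bij one(1)])
    then show "k (ea_one (Gamma G u)) = ea_one F" using one by simp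
    fix a b c assume a: "a \<in> carrier (Gamma G u)" and b: "b \<in> carrier (Gamma G u)"
      and abc: "a \<boxplus>\<^bsub>Gamma G u\<^esub> b = Some c"
    then have c: "c = a \<otimes> b" "c \<preceq> u"
      using abc unfolding Gamma_plus[OF u a b] by simp_all
    then have "c \<in> carrier (Gamma G u)"
      using pos_mult[of a b] a b by (auto simp: pg_pos_def)
    then show "k a \<boxplus>\<^bsub>F\<^esub> k b = Some (k c)" using sum[of "k a" "k b" "k c"] k a b c by simp
  qed (use k in auto)
  then show ?thesis unfolding ea_isomorphic_def ea_iso_def using hom bij k_def by blast
qed

lemma iso_GammaD:
  assumes u: "u \<in> carrier G" and f: "f \<in> ea_iso F (Gamma G u)"
    and closed: "\<And>x y z. \<lbrakk>x \<in> carrier F; y \<in> carrier F; x \<boxplus>\<^bsub>F\<^esub> y = Some z\<rbrakk> \<Longrightarrow> z \<in> carrier F"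
  shows "bij_betw f (carrier F) (carrier (Gamma G u))" "f (ea_one F) = u"
    "\<And>x y z. \<lbrakk>x \<in> carrier F; y \<in> carrier F; z \<in> carrier F\<rbrakk> \<Longrightarrow>
      x \<boxplus>\<^bsub>F\<^esub> y = Some z \<longleftrightarrow> f z = f x \<otimes> f y"
proof -
  have hom: "f \<in> ea_hom F (Gamma G u)" and ihom: "inv_into (carrier F) f \<in> ea_hom (Gamma G u) F"
    and bij: "bij_betw f (carrier F) (carrier (Gamma G u))"
    using f by (simp_all add: ea_iso_def)
  show "bij_betw f (carrier F) (carrier (Gamma G u))" by fact
  show "f (ea_one F) = u" using hom by (simp add: ea_hom_def)
  fix x y z assume x: "x \<in> carrier F" and y: "y \<in> carrier F" and z: "z \<in> carrier F"
  have c: "f x \<in> carrier (Gamma G u)" "f y \<in> carrier (Gamma G u)" "f z \<in> carrier (Gamma G u)"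
    using bij x y z by (auto dest: bij_betw_apply)
  show "x \<boxplus>\<^bsub>F\<^esub> y = Some z \<longleftrightarrow> f z = f x \<otimes> f y"
  proof
    assume "x \<boxplus>\<^bsub>F\<^esub> y = Some z"
    then have "f x \<boxplus>\<^bsub>Gamma G u\<^esub> f y = Some (f z)" using hom x y by (simp add: ea_hom_def)
    then show "f z = f x \<otimes> f y" using Gamma_plus[OF u c(1,2)] by simp
  next
    assume "f z = f x \<otimes> f y"
    then have "f x \<boxplus>\<^bsub>Gamma G u\<^esub> f y = Some (f z)" using Gamma_plus[OF u c(1,2)] c(3) by simp
    then have "inv_into (carrier F) f (f x) \<boxplus>\<^bsub>F\<^esub> inv_into (carrier F) f (f y) =
        Some (inv_into (carrier F) f (f z))"
      using ihom c(1,2) unfolding ea_hom_def by blast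
    then show "x \<boxplus>\<^bsub>F\<^esub> y = Some z" using bij_betw_inv_into_left[OF bij] x y z by simp
  qed
qed

end

section \<open>Effect algebras represented by intervals\<close>

locale interval_rep = effect_algebra E + K: abelian_po_group K
  for E :: "'a effalg" (structure) and K :: "'k pogroup" +
  fixes f :: "'a \<Rightarrow> 'k" and v :: 'k
  assumes v_pos: "v \<in> pg_pos K"
    and bij: "bij_betw f (carrier E) (carrier (Gamma K v))"
    and f_one: "f \<one>\<^sub>E = v"
    and sum: "\<lbrakk>x \<in> carrier E; y \<in> carrier E; z \<in> carrier E\<rbrakk> \<Longrightarrow>
      Some x \<uplus> Some y = Some z \<longleftrightarrow> f z = f x \<otimes>\<^bsub>K\<^esub> f y"
begin

lemma f_pos: "x \<in> carrier E \<Longrightarrow> f x \<in> pg_pos K"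
  using bij_betw_apply[OF bij, of x] by (simp add: pg_pos_def)

lemma f_closed: "x \<in> carrier E \<Longrightarrow> f x \<in> carrier K"
  using f_pos K.posD by blast

lemma f_le: "x \<in> carrier E \<Longrightarrow> f x \<preceq>\<^bsub>K\<^esub> v"
  using bij_betw_apply[OF bij, of x] by simp

lemma f_surj:
  assumes "k \<in> pg_pos K" "k \<preceq>\<^bsub>K\<^esub> v" shows "\<exists>x\<in>carrier E. f x = k"
proof -
  have "k \<in> carrier (Gamma K v)" using assms by (simp add: pg_pos_def)
  then have "k \<in> f ` carrier E" using bij by (simp add: bij_betw_def)
  then show ?thesis by blast
qed

lemma f_inj: "\<lbrakk>x \<in> carrier E; y \<in> carrier E; f x = f y\<rbrakk> \<Longrightarrow> x = y"
  using bij unfolding bij_betw_def by (meson inj_onD)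

lemma f_sum: "Some x \<uplus> Some y = Some z \<Longrightarrow> f z = f x \<otimes>\<^bsub>K\<^esub> f y"
  using sum osum_closed by metis

lemma f_zero: "f \<zero>\<^sub>E = \<one>\<^bsub>K\<^esub>"
  using f_sum[OF one_zero] f_closed[OF one_closed] f_closed[OF zero_closed] by simp

lemma f_le_iff:
  assumes "x \<in> carrier E" "y \<in> carrier E"
  shows "ea_le E x y \<longleftrightarrow> f x \<preceq>\<^bsub>K\<^esub> f y"
proof
  assume "ea_le E x y"
  then obtain c where "c \<in> carrier E" "Some x \<uplus> Some c = Some y" by (rule leE)
  then show "f x \<preceq>\<^bsub>K\<^esub> f y" using f_sum K.le_mult_pos f_closed f_pos assms by metis
next
  assume "f x \<preceq>\<^bsub>K\<^esub> f y"
  then obtain k where k: "k \<in> pg_pos K" "f y = f x \<otimes>\<^bsub>K\<^esub> k"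
    using K.le_iff_pos f_closed assms by metis
  have kc: "k \<in> carrier K" using k K.posD by blast
  have "k \<preceq>\<^bsub>K\<^esub> f y"
    using k(2) kc K.le_mult_pos[of k "f x"] f_pos f_closed assms by (simp add: K.m_comm)
  then have "k \<preceq>\<^bsub>K\<^esub> v"
    using K.le_trans[OF kc _ _ _ f_le] f_closed assms K.posD(1)[OF v_pos] by blast
  then obtain c where "c \<in> carrier E" "f c = k" using f_surj k by blast
  then show "ea_le E x y" using sum assms k leI by metis
qed

text \<open>The entries of a refinement found in \<open>K\<close> are positive and lie below
  elements of the interval, hence they belong to the interval and come from E.\<close>

lemma rdp_rep:
  assumes "pg_rdp K" shows "ea_rdp E"
proof (rule rdpI)
  fix a1 a2 b1 b2 d assume a: "Some a1 \<uplus> Some a2 = Some d" and b: "Some b1 \<uplus> Some b2 = Some d"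
  note E = osum_closed[OF a] osum_closed[OF b]
  have "f a1 \<otimes>\<^bsub>K\<^esub> f a2 = f b1 \<otimes>\<^bsub>K\<^esub> f b2" using f_sum a b by metis
  from assms[unfolded pg_rdp_def, rule_format, OF f_pos[OF E(1)] f_pos[OF E(2)] f_pos[OF E(4)]
    f_pos[OF E(5)] this]
  obtain c11 c12 c21 c22
    where p: "c11 \<in> pg_pos K" "c12 \<in> pg_pos K" "c21 \<in> pg_pos K" "c22 \<in> pg_pos K"
      and eq: "f a1 = c11 \<otimes>\<^bsub>K\<^esub> c12" "f a2 = c21 \<otimes>\<^bsub>K\<^esub> c22"
        "f b1 = c11 \<otimes>\<^bsub>K\<^esub> c21" "f b2 = c12 \<otimes>\<^bsub>K\<^esub> c22"
    by (elim bexE conjE)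
  have ex: "\<exists>x\<in>carrier E. f x = p" if "p \<in> pg_pos K" "q \<in> pg_pos K" "f a = p \<otimes>\<^bsub>K\<^esub> q" "a \<in> carrier E"
    for p q a
  proof (rule f_surj)
    have "p \<preceq>\<^bsub>K\<^esub> f a" using K.le_mult_pos K.posD that by metis
    then show "p \<preceq>\<^bsub>K\<^esub> v"
      using K.le_trans[of p "f a" v] f_le f_closed that K.posD(1)[OF v_pos] K.posD(1) by blast
  qed fact
  have c: "c11 \<in> carrier K" "c12 \<in> carrier K" "c21 \<in> carrier K" "c22 \<in> carrier K"
    using p K.posD by blast+
  obtain x11 where 1: "x11 \<in> carrier E" "f x11 = c11" using ex[OF p(1,2) eq(1) E(1)] by blast
  obtain x12 where 2: "x12 \<in> carrier E" "f x12 = c12" using ex[OF p(2,4) eq(4) E(5)] by blast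
  obtain x21 where 3: "x21 \<in> carrier E" "f x21 = c21" using ex[OF p(3,4) eq(2) E(2)] by blast
  have "f b2 = c22 \<otimes>\<^bsub>K\<^esub> c12" using eq c K.m_comm by metis
  then obtain x22 where 4: "x22 \<in> carrier E" "f x22 = c22" using ex[OF p(4,2) _ E(5)] by blast
  have "Some x11 \<uplus> Some x12 = Some a1" "Some x21 \<uplus> Some x22 = Some a2"
    "Some x11 \<uplus> Some x21 = Some b1" "Some x12 \<uplus> Some x22 = Some b2"
    using 1 2 3 4 eq E by (simp_all add: sum)
  then show "\<exists>c11 c12 c21 c22. Some c11 \<uplus> Some c12 = Some a1 \<and> Some c21 \<uplus> Some c22 = Some a2 \<and>
      Some c11 \<uplus> Some c21 = Some b1 \<and> Some c12 \<uplus> Some c22 = Some b2" by blast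
qed

end

section \<open>The congruence of an ideal, and the quotient by the elements with first component
  0\<close>

context effect_algebra
begin

text \<open>The two equal differences of the definition are made explicit as a common part r with a
  = r + e and b = r + f; this form is suited to calculations with sums.\<close>

lemma cong_iff:
  assumes "I \<subseteq> carrier E"
  shows "(a, b) \<in> ea_cong E I \<longleftrightarrow> a \<in> carrier E \<and> b \<in> carrier E \<and>
    (\<exists>e\<in>I. \<exists>f\<in>I. \<exists>r. Some r \<uplus> Some e = Some a \<and> Some r \<uplus> Some f = Some b)"
proof
  assume "(a, b) \<in> ea_cong E I"
  then have ab: "a \<in> carrier E" "b \<in> carrier E"
    and "\<exists>e\<in>I. \<exists>f\<in>I. ea_le E e a \<and> ea_le E f b \<and> ea_diff E a e = ea_diff E b f"
    unfolding ea_cong_def by simp_all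
  then obtain e f where ef: "e \<in> I" "f \<in> I" "ea_le E e a" "ea_le E f b"
    "ea_diff E a e = ea_diff E b f" by (elim bexE conjE)
  obtain r where r: "Some e \<uplus> Some r = Some a" using ef(3) by (rule leE)
  obtain s where s: "Some f \<uplus> Some s = Some b" using ef(4) by (rule leE)
  have "r = s" using diff_eq[OF r] diff_eq[OF s] ef(5) by simp
  then have "Some r \<uplus> Some e = Some a \<and> Some r \<uplus> Some f = Some b"
    using r s by (simp add: osum_commute)
  with ab ef(1,2) show "a \<in> carrier E \<and> b \<in> carrier E \<and>
      (\<exists>e\<in>I. \<exists>f\<in>I. \<exists>r. Some r \<uplus> Some e = Some a \<and> Some r \<uplus> Some f = Some b)" by blast
next
  assume "a \<in> carrier E \<and> b \<in> carrier E \<and>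
      (\<exists>e\<in>I. \<exists>f\<in>I. \<exists>r. Some r \<uplus> Some e = Some a \<and> Some r \<uplus> Some f = Some b)"
  then obtain e f r where *: "a \<in> carrier E" "b \<in> carrier E" "e \<in> I" "f \<in> I"
    "Some e \<uplus> Some r = Some a" "Some f \<uplus> Some r = Some b" by (metis osum_commute)
  then have "ea_le E e a" "ea_le E f b" "ea_diff E a e = ea_diff E b f"
    using leI diff_eq by simp_all
  with * show "(a, b) \<in> ea_cong E I" unfolding ea_cong_def by blast
qed

lemma quot_carrier: "carrier (ea_quot E I) = ea_proj E I ` carrier E"
  by (auto simp: ea_quot_def ea_proj_def quotient_def)

lemma quot_one: "ea_one (ea_quot E I) = ea_proj E I \<one>\<^sub>E"
  by (simp add: ea_quot_def)

end

text \<open>The common ground of both implications: in the converse \<open>h\<close> and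
  \<open>g\<close> are the components of a given isomorphism, in the direct part they are x
  \<mapsto> \<rho> x and x \<mapsto> x - \<rho> x, up to the embeddings into H and G.\<close>

locale lex_rep = lex_product H G + interval_rep E "H \<times>\<^sub>l\<^sub>e\<^sub>x G" "\<lambda>x. (h x, g x)" "(u, \<one>\<^bsub>G\<^esub>)"
  for H :: "'h pogroup" and G :: "'g pogroup" and E :: "'a effalg" (structure) and h g u +
  assumes u: "u \<in> pg_pos H" "u \<noteq> \<one>\<^bsub>H\<^esub>"
    and dir: "pg_directed G"
begin

lemma h_closed: "x \<in> carrier E \<Longrightarrow> h x \<in> carrier H"
  using f_closed[of x] by simp

lemma g_closed: "x \<in> carrier E \<Longrightarrow> g x \<in> carrier G"
  using f_closed[of x] by simp

lemma u_closed: "u \<in> carrier H" "\<one>\<^bsub>H\<^esub> \<preceq>\<^bsub>H\<^esub> u"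
  using u H.posD by blast+

lemma h_pos: "x \<in> carrier E \<Longrightarrow> h x \<in> pg_pos H"
  using f_pos[of x] H.le_refl[of "\<one>\<^bsub>H\<^esub>"] by (auto simp: pg_pos_def)

lemma h_le: "x \<in> carrier E \<Longrightarrow> h x \<preceq>\<^bsub>H\<^esub> u"
  using f_le[of x] H.le_refl[OF u_closed(1)] by auto

lemma g_pos: "x \<in> carrier E \<Longrightarrow> h x = \<one>\<^bsub>H\<^esub> \<Longrightarrow> g x \<in> pg_pos G"
  using f_pos[of x] by (auto simp: pg_pos_def)

lemma g_le: "x \<in> carrier E \<Longrightarrow> h x = u \<Longrightarrow> g x \<preceq>\<^bsub>G\<^esub> \<one>\<^bsub>G\<^esub>"
  using f_le[of x] by auto

lemma hg_surj:
  assumes "a \<in> pg_pos H" "a \<preceq>\<^bsub>H\<^esub> u" "b \<in> carrier G"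
    "a = \<one>\<^bsub>H\<^esub> \<Longrightarrow> b \<in> pg_pos G" "a = u \<Longrightarrow> b \<preceq>\<^bsub>G\<^esub> \<one>\<^bsub>G\<^esub>"
  obtains x where "x \<in> carrier E" "h x = a" "g x = b"
proof -
  have "(a, b) \<in> pg_pos (H \<times>\<^sub>l\<^sub>e\<^sub>x G)" "(a, b) \<preceq>\<^bsub>H \<times>\<^sub>l\<^sub>e\<^sub>x G\<^esub> (u, \<one>\<^bsub>G\<^esub>)"
    using assms H.posD[OF assms(1)] by (auto simp: pg_pos_def)
  then obtain x where "x \<in> carrier E" "(h x, g x) = (a, b)" using f_surj by blast
  then show thesis by (intro that[of x]) simp_all
qed

lemma hg_inj: "\<lbrakk>x \<in> carrier E; y \<in> carrier E; h x = h y; g x = g y\<rbrakk> \<Longrightarrow> x = y"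
  using f_inj[of x y] by simp

lemma hg_sum: "\<lbrakk>x \<in> carrier E; y \<in> carrier E; z \<in> carrier E\<rbrakk> \<Longrightarrow>
    Some x \<uplus> Some y = Some z \<longleftrightarrow> h z = h x \<otimes>\<^bsub>H\<^esub> h y \<and> g z = g x \<otimes>\<^bsub>G\<^esub> g y"
  using sum[of x y z] by simp

lemma h_sum: "Some x \<uplus> Some y = Some z \<Longrightarrow> h z = h x \<otimes>\<^bsub>H\<^esub> h y"
  using f_sum[of x y z] by simp

lemma hg_one: "h \<one>\<^sub>E = u" "g \<one>\<^sub>E = \<one>\<^bsub>G\<^esub>"
  using f_one by simp_all

lemma hg_zero: "h \<zero>\<^sub>E = \<one>\<^bsub>H\<^esub>" "g \<zero>\<^sub>E = \<one>\<^bsub>G\<^esub>"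
  using f_zero by simp_all

lemma hg_le_iff: "\<lbrakk>x \<in> carrier E; y \<in> carrier E\<rbrakk> \<Longrightarrow>
    ea_le E x y \<longleftrightarrow> h x \<preceq>\<^bsub>H\<^esub> h y \<and> h x \<noteq> h y \<or> h x = h y \<and> g x \<preceq>\<^bsub>G\<^esub> g y"
  using f_le_iff[of x y] by simp

definition inf_ideal :: "'a set" where
  "inf_ideal = {x \<in> carrier E. h x = \<one>\<^bsub>H\<^esub>}"

lemma inf_idealD: "x \<in> inf_ideal \<Longrightarrow> x \<in> carrier E" "x \<in> inf_ideal \<Longrightarrow> h x = \<one>\<^bsub>H\<^esub>"
  by (simp_all add: inf_ideal_def)

lemma inf_ideal_ideal: "ea_ideal E inf_ideal"
proof (rule idealI)
  show "inf_ideal \<noteq> {}" using hg_zero zero_closed by (auto simp: inf_ideal_def)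
  fix a b assume "ea_le E a b" "b \<in> inf_ideal"
  moreover from this have E: "a \<in> carrier E" "b \<in> carrier E" using le_closed by blast+
  ultimately have "h a \<preceq>\<^bsub>H\<^esub> \<one>\<^bsub>H\<^esub>" using hg_le_iff inf_idealD H.le_refl by auto
  then have "h a = \<one>\<^bsub>H\<^esub>" using H.le_antisym h_closed[OF E(1)] H.posD(2)[OF h_pos[OF E(1)]] by simp
  then show "a \<in> inf_ideal" using E by (simp add: inf_ideal_def)
next
  fix a b c assume "a \<in> inf_ideal" "b \<in> inf_ideal" and s: "Some a \<uplus> Some b = Some c"
  then show "c \<in> inf_ideal"
    using h_sum[OF s] osum_closed[OF s] by (simp add: inf_ideal_def)
qed (auto simp: inf_ideal_def)

text \<open>Elements on the same level have a common part on this level: a second component below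
  both \<open>g x\<close> and \<open>g y\<close> exists since G is directed, and the remainders are
  (0, p) with p positive. On level 0 this part could fail to be positive, but there \<open>x\<close>
  and \<open>y\<close> lie in the ideal themselves and 0 serves as the common part.\<close>

lemma inf_ideal_cong:
  assumes x: "x \<in> carrier E" and y: "y \<in> carrier E"
  shows "(x, y) \<in> ea_cong E inf_ideal \<longleftrightarrow> h x = h y"
proof
  assume "(x, y) \<in> ea_cong E inf_ideal"
  then have "\<exists>e\<in>inf_ideal. \<exists>f\<in>inf_ideal. \<exists>r. Some r \<uplus> Some e = Some x \<and> Some r \<uplus> Some f = Some y"
    using cong_iff[OF idealD(1)[OF inf_ideal_ideal]] by blast
  then obtain e f r where *: "e \<in> inf_ideal" "f \<in> inf_ideal" "Some r \<uplus> Some e = Some x"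
    "Some r \<uplus> Some f = Some y" by (elim bexE exE conjE)
  have "r \<in> carrier E" using * osum_closed by blast
  then show "h x = h y" using h_sum[OF *(3)] h_sum[OF *(4)] inf_idealD *(1,2) h_closed by simp
next
  assume eq: "h x = h y"
  have "\<exists>e\<in>inf_ideal. \<exists>f\<in>inf_ideal. \<exists>r. Some r \<uplus> Some e = Some x \<and> Some r \<uplus> Some f = Some y"
  proof (cases "h x = \<one>\<^bsub>H\<^esub>")
    case True
    then have "x \<in> inf_ideal" "y \<in> inf_ideal" using x y eq by (simp_all add: inf_ideal_def)
    then show ?thesis using osum_zero x y by blast
  next
    case False
    obtain b where b: "b \<in> carrier G" "b \<preceq>\<^bsub>G\<^esub> g x" "b \<preceq>\<^bsub>G\<^esub> g y"
      using G.directed_lower[OF dir g_closed[OF x] g_closed[OF y]] by blast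
    \<comment> \<open>On the top level the interval contains only elements with second component at
      most 0; \<open>b\<close> inherits this from \<open>g x\<close>.\<close>
    have "b \<preceq>\<^bsub>G\<^esub> \<one>\<^bsub>G\<^esub>" if "h x = u"
      using G.le_trans[OF b(1) g_closed[OF x] _ b(2) g_le[OF x that]] by simp
    then obtain r where r: "r \<in> carrier E" "h r = h x" "g r = b"
      using hg_surj[of "h x" b] h_pos h_le x b False by metis
    have *: "\<exists>e\<in>inf_ideal. Some r \<uplus> Some e = Some z"
      if z: "z \<in> carrier E" "h z = h x" "b \<preceq>\<^bsub>G\<^esub> g z" for z
    proof -
      obtain p where p: "p \<in> pg_pos G" "g z = b \<otimes>\<^bsub>G\<^esub> p"
        using z(3) G.le_iff_pos[OF b(1) g_closed[OF z(1)]] by blast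
      obtain e where e: "e \<in> carrier E" "h e = \<one>\<^bsub>H\<^esub>" "g e = p"
        using hg_surj[of "\<one>\<^bsub>H\<^esub>" p] H.one_pos u_closed p G.posD u by metis
      have "Some r \<uplus> Some e = Some z"
        using hg_sum[OF r(1) e(1) z(1)] r e z p h_closed x by simp
      then show ?thesis using e by (auto simp: inf_ideal_def)
    qed
    obtain e where "e \<in> inf_ideal" "Some r \<uplus> Some e = Some x" using *[OF x refl b(2)] by blast
    moreover obtain f where "f \<in> inf_ideal" "Some r \<uplus> Some f = Some y"
      using *[OF y eq[symmetric] b(3)] by blast
    ultimately show ?thesis by blast
  qed
  then show "(x, y) \<in> ea_cong E inf_ideal"
    using cong_iff[OF idealD(1)[OF inf_ideal_ideal]] x y by blast
qed

abbreviation Q :: "'a set effalg" where "Q \<equiv> ea_quot E inf_ideal"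
abbreviation proj :: "'a \<Rightarrow> 'a set" where "proj \<equiv> ea_proj E inf_ideal"

lemma proj_eq: "x \<in> carrier E \<Longrightarrow> proj x = {y \<in> carrier E. h y = h x}"
proof -
  assume x: "x \<in> carrier E"
  have "proj x \<subseteq> carrier E" by (auto simp: ea_proj_def ea_cong_def)
  moreover have "y \<in> proj x \<longleftrightarrow> h y = h x" if "y \<in> carrier E" for y
    using inf_ideal_cong[OF x that] by (auto simp: ea_proj_def)
  ultimately show "proj x = {y \<in> carrier E. h y = h x}" by blast
qed

lemma proj_eq_iff: "x \<in> carrier E \<Longrightarrow> y \<in> carrier E \<Longrightarrow> proj x = proj y \<longleftrightarrow> h x = h y"
  by (auto simp: proj_eq)

text \<open>The pairs (a, 0) always lie in the interval. They are the canonical representatives of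
  the classes, and they form the image of the retraction constructed below.\<close>

lemma proj_section:
  assumes "a \<in> pg_pos H" "a \<preceq>\<^bsub>H\<^esub> u"
  obtains x where "x \<in> carrier E" "h x = a" "g x = \<one>\<^bsub>G\<^esub>"
  using hg_surj[of a "\<one>\<^bsub>G\<^esub>"] assms G.one_pos G.le_refl G.one_closed by blast

text \<open>Addition of classes is addition of levels. All summable representatives give the same
  class, because the level of a sum depends only on the levels of the summands.\<close>

lemma quot_plus:
  assumes x: "x \<in> carrier E" and y: "y \<in> carrier E"
  shows "proj x \<boxplus>\<^bsub>Q\<^esub> proj y = Some Z \<longleftrightarrow> (\<exists>z\<in>carrier E. Z = proj z \<and> h z = h x \<otimes>\<^bsub>H\<^esub> h y)"
proof -
  have plus: "proj x \<boxplus>\<^bsub>Q\<^esub> proj y = (if \<exists>a\<in>proj x. \<exists>b\<in>proj y. a \<boxplus> b \<noteq> None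
      then Some (\<Union>{proj c | c. \<exists>a\<in>proj x. \<exists>b\<in>proj y. a \<boxplus> b = Some c}) else None)"
    by (simp add: ea_quot_def)
  have hc: "c \<in> carrier E \<and> h c = h x \<otimes>\<^bsub>H\<^esub> h y"
    if abc: "a \<in> proj x" "b \<in> proj y" "a \<boxplus> b = Some c" for a b c
  proof -
    have ab: "a \<in> carrier E" "b \<in> carrier E" "h a = h x" "h b = h y"
      using abc by (simp_all add: proj_eq x y)
    then have "Some a \<uplus> Some b = Some c" using abc osum_Some by simp
    then show ?thesis using h_sum ab osum_closed by metis
  qed
  have val: "proj x \<boxplus>\<^bsub>Q\<^esub> proj y = Some (proj c)"
    if abc: "a \<in> proj x" "b \<in> proj y" "a \<boxplus> b = Some c" for a b c
  proof -
    have "proj c' = proj c" if "a' \<in> proj x" "b' \<in> proj y" "a' \<boxplus> b' = Some c'" for a' b' c'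
      using hc[OF that] hc[OF abc] proj_eq_iff by metis
    then have "{proj c | c. \<exists>a\<in>proj x. \<exists>b\<in>proj y. a \<boxplus> b = Some c} = {proj c}" using abc by blast
    moreover have "\<exists>a\<in>proj x. \<exists>b\<in>proj y. a \<boxplus> b \<noteq> None" using abc by blast
    ultimately show ?thesis unfolding plus by simp
  qed
  show ?thesis
  proof
    assume Z: "proj x \<boxplus>\<^bsub>Q\<^esub> proj y = Some Z"
    then have "\<exists>a\<in>proj x. \<exists>b\<in>proj y. a \<boxplus> b \<noteq> None" unfolding plus by (metis option.distinct(1))
    then obtain a b c where "a \<in> proj x" "b \<in> proj y" "a \<boxplus> b = Some c" by blast
    then show "\<exists>z\<in>carrier E. Z = proj z \<and> h z = h x \<otimes>\<^bsub>H\<^esub> h y" using val hc Z by fastforce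
  next
    assume "\<exists>z\<in>carrier E. Z = proj z \<and> h z = h x \<otimes>\<^bsub>H\<^esub> h y"
    then obtain z where z: "z \<in> carrier E" "Z = proj z" "h z = h x \<otimes>\<^bsub>H\<^esub> h y" by blast
    \<comment> \<open>The elements \<open>x\<close> and \<open>y\<close> need not be summable
      themselves: if their levels add up to \<open>u\<close>, their second components may have a sum
      that is not below 0. Representatives with second component 0 avoid this.\<close>
    obtain a where a: "a \<in> carrier E" "h a = h x" "g a = \<one>\<^bsub>G\<^esub>"
      using proj_section[OF h_pos[OF x] h_le[OF x]] by blast
    obtain b where b: "b \<in> carrier E" "h b = h y" "g b = \<one>\<^bsub>G\<^esub>"
      using proj_section[OF h_pos[OF y] h_le[OF y]] by blast
    obtain c where c: "c \<in> carrier E" "h c = h z" "g c = \<one>\<^bsub>G\<^esub>"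
      using proj_section[OF h_pos[OF z(1)] h_le[OF z(1)]] by blast
    have "Some a \<uplus> Some b = Some c" using hg_sum[OF a(1) b(1) c(1)] a b c z by simp
    then have "a \<boxplus> b = Some c" by (simp add: osum_Some_iff)
    moreover have "a \<in> proj x" "b \<in> proj y" using a b x y by (simp_all add: proj_eq)
    ultimately have "proj x \<boxplus>\<^bsub>Q\<^esub> proj y = Some (proj c)" using val by blast
    then show "proj x \<boxplus>\<^bsub>Q\<^esub> proj y = Some Z" using proj_eq_iff[OF c(1) z(1)] c z by simp
  qed
qed

definition hq :: "'a set \<Rightarrow> 'h" where
  "hq X = h (SOME x. x \<in> X)"

lemma hq_proj: "x \<in> carrier E \<Longrightarrow> hq (proj x) = h x"
  unfolding hq_def proj_eq by (rule someI2[of _ x]) auto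

lemma quot_iso: "Q \<cong>\<^sub>e Gamma H u"
proof (rule H.iso_GammaI[where f = hq])
  show "u \<in> carrier H" by (rule u_closed)
  show "bij_betw hq (carrier Q) (carrier (Gamma H u))"
    unfolding bij_betw_def quot_carrier
  proof (intro conjI)
    show "inj_on hq (proj ` carrier E)" by (auto simp: inj_on_def hq_proj proj_eq_iff)
    show "hq ` proj ` carrier E = carrier (Gamma H u)"
    proof (intro equalityI subsetI)
      fix a assume "a \<in> carrier (Gamma H u)"
      then have "a \<in> pg_pos H" "a \<preceq>\<^bsub>H\<^esub> u" by (simp_all add: pg_pos_def)
      then obtain x where x: "x \<in> carrier E" "h x = a" by (rule proj_section)
      then have "a = hq (proj x)" by (simp add: hq_proj)
      then show "a \<in> hq ` proj ` carrier E" using x by blast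
    qed (use h_pos h_le in \<open>auto simp: hq_proj pg_pos_def\<close>)
  qed
  show "ea_one Q \<in> carrier Q" "hq (ea_one Q) = u"
    using one_closed by (simp_all add: quot_one quot_carrier hq_proj hg_one)
  fix X Y Z assume "X \<in> carrier Q" "Y \<in> carrier Q"
  then obtain x y where xy: "x \<in> carrier E" "y \<in> carrier E" "X = proj x" "Y = proj y"
    unfolding quot_carrier by blast
  show "Z \<in> carrier Q" if "X \<boxplus>\<^bsub>Q\<^esub> Y = Some Z"
    using that quot_plus[OF xy(1,2)] unfolding xy quot_carrier by blast
  assume "Z \<in> carrier Q"
  then obtain z where z: "z \<in> carrier E" "Z = proj z" unfolding quot_carrier by blast
  show "X \<boxplus>\<^bsub>Q\<^esub> Y = Some Z \<longleftrightarrow> hq Z = hq X \<otimes>\<^bsub>H\<^esub> hq Y"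
    unfolding xy z quot_plus[OF xy(1,2)] using xy z by (auto simp: hq_proj proj_eq_iff)
qed

lemma inf_ideal_strict: "ea_strict E inf_ideal"
  unfolding ea_strict_def
proof (intro ballI impI)
  fix x y assume x: "x \<in> carrier E" and y: "y \<in> carrier E" and "ea_less Q (proj x) (proj y)"
  then have ne: "proj x \<noteq> proj y" and "\<exists>W\<in>carrier Q. proj x \<boxplus>\<^bsub>Q\<^esub> W = Some (proj y)"
    by (simp_all add: ea_less_def ea_le_def)
  then obtain w where w: "w \<in> carrier E" "proj x \<boxplus>\<^bsub>Q\<^esub> proj w = Some (proj y)"
    unfolding quot_carrier by blast
  then have "h y = h x \<otimes>\<^bsub>H\<^esub> h w" using quot_plus[OF x w(1)] proj_eq_iff[OF y] by auto
  then have "h x \<preceq>\<^bsub>H\<^esub> h y" using H.le_mult_pos[OF h_closed[OF x] h_pos[OF w(1)]] by simp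
  moreover have "h x \<noteq> h y" using ne proj_eq_iff x y by simp
  ultimately show "ea_less E x y" unfolding ea_less_def using hg_le_iff x y by auto
qed

lemma inf_ideal_retractive: "ea_retractive E inf_ideal"
proof -
  \<comment> \<open>The retraction sends a class to its representative with second component 0;
    these representatives are closed under existing sums, which makes it a homomorphism.\<close>
  have "\<forall>X\<in>carrier Q. \<exists>d. d \<in> carrier E \<and> g d = \<one>\<^bsub>G\<^esub> \<and> proj d = X"
  proof
    fix X assume "X \<in> carrier Q"
    then obtain x where x: "x \<in> carrier E" "X = proj x" unfolding quot_carrier by blast
    obtain d where "d \<in> carrier E" "h d = h x" "g d = \<one>\<^bsub>G\<^esub>"
      using proj_section[OF h_pos[OF x(1)] h_le[OF x(1)]] by blast
    then show "\<exists>d. d \<in> carrier E \<and> g d = \<one>\<^bsub>G\<^esub> \<and> proj d = X" using x proj_eq_iff by metis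
  qed
  then obtain \<delta> where \<delta>: "\<And>X. X \<in> carrier Q \<Longrightarrow> \<delta> X \<in> carrier E \<and> g (\<delta> X) = \<one>\<^bsub>G\<^esub> \<and> proj (\<delta> X) = X"
    by metis
  have h\<delta>: "h (\<delta> (proj x)) = h x" if "x \<in> carrier E" for x
    using \<delta>[of "proj x"] that proj_eq_iff quot_carrier by blast
  have "\<delta> \<in> ea_hom Q E"
    unfolding ea_hom_def
  proof (intro CollectI conjI ballI allI impI)
    show "\<delta> \<in> carrier Q \<rightarrow> carrier E" using \<delta> by blast
    have "proj \<one>\<^sub>E \<in> carrier Q" using one_closed quot_carrier by blast
    then show "\<delta> (ea_one Q) = \<one>\<^sub>E"
      unfolding quot_one using \<delta>[of "proj \<one>\<^sub>E"] h\<delta>[OF one_closed] hg_one one_closed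
      by (intro hg_inj) simp_all
    fix X Y Z assume X: "X \<in> carrier Q" and Y: "Y \<in> carrier Q" and XYZ: "X \<boxplus>\<^bsub>Q\<^esub> Y = Some Z"
    obtain x where x: "x \<in> carrier E" "X = proj x" using X unfolding quot_carrier by blast
    obtain y where y: "y \<in> carrier E" "Y = proj y" using Y unfolding quot_carrier by blast
    obtain z where z: "z \<in> carrier E" "Z = proj z" "h z = h x \<otimes>\<^bsub>H\<^esub> h y"
      using XYZ quot_plus[OF x(1) y(1)] unfolding x y by blast
    have Z: "Z \<in> carrier Q" using z quot_carrier by blast
    have "Some (\<delta> X) \<uplus> Some (\<delta> Y) = Some (\<delta> Z)"
      using hg_sum[of "\<delta> X" "\<delta> Y" "\<delta> Z"] \<delta>[OF X] \<delta>[OF Y] \<delta>[OF Z] h\<delta> x y z by simp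
    then show "\<delta> X \<boxplus> \<delta> Y = Some (\<delta> Z)" by (simp add: osum_Some_iff)
  qed
  then show ?thesis unfolding ea_retractive_def using \<delta> by blast
qed

text \<open>If neither \<open>x\<close> nor \<open>y\<close> has level 0, the antilattice property
  provides a nonzero \<open>w\<close> below both levels. An element of level \<open>w\<close> with
  second component below \<open>g x\<close> and \<open>g y\<close> lies below \<open>x\<close> and
  \<open>y\<close>, even if \<open>w\<close> equals one of their levels, and so belongs to both
  principal ideals without belonging to the ideal.\<close>

lemma inf_ideal_prime:
  assumes "antilattice (pg_order H)" "pg_interp H"
  shows "ea_prime E inf_ideal"
  unfolding ea_prime_def
proof (intro ballI impI)
  fix x y assume x: "x \<in> carrier E" and y: "y \<in> carrier E"
    and sub: "ea_principal E x \<inter> ea_principal E y \<subseteq> inf_ideal"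
  show "x \<in> inf_ideal \<or> y \<in> inf_ideal"
  proof (rule ccontr)
    assume "\<not> (x \<in> inf_ideal \<or> y \<in> inf_ideal)"
    then have "h x \<noteq> \<one>\<^bsub>H\<^esub>" "h y \<noteq> \<one>\<^bsub>H\<^esub>" using x y by (simp_all add: inf_ideal_def)
    then obtain w where w: "w \<in> pg_pos H" "w \<noteq> \<one>\<^bsub>H\<^esub>" "w \<preceq>\<^bsub>H\<^esub> h x" "w \<preceq>\<^bsub>H\<^esub> h y"
      using H.antilatticeD[OF assms h_pos[OF x] _ h_pos[OF y]] by blast
    obtain b where b: "b \<in> carrier G" "b \<preceq>\<^bsub>G\<^esub> g x" "b \<preceq>\<^bsub>G\<^esub> g y"
      using G.directed_lower[OF dir g_closed[OF x] g_closed[OF y]] by blast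
    have wc: "w \<in> carrier H" using w H.posD by blast
    have wu: "w \<preceq>\<^bsub>H\<^esub> u" using H.le_trans[OF wc h_closed[OF x] u_closed(1) w(3) h_le[OF x]] .
    \<comment> \<open>For w = u the element must respect the top of the interval. Then
      \<open>x\<close> has level \<open>u\<close> as well, so \<open>g x\<close>, and with it
      \<open>b\<close>, lies below 0.\<close>
    have "b \<preceq>\<^bsub>G\<^esub> \<one>\<^bsub>G\<^esub>" if "w = u"
    proof -
      have "h x = u" using H.le_antisym[OF h_closed[OF x] u_closed(1) h_le[OF x]] w that by simp
      then show ?thesis using G.le_trans[OF b(1) g_closed[OF x] _ b(2) g_le[OF x]] by simp
    qed
    then obtain z where z: "z \<in> carrier E" "h z = w" "g z = b"
      using hg_surj[of w b] w wu b by metis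
    have "ea_le E z x" "ea_le E z y" using hg_le_iff z x y w b by auto
    then have "z \<in> ea_principal E x" "z \<in> ea_principal E y"
      unfolding ea_principal_def using idealD(3) by blast+
    then have "z \<in> inf_ideal" using sub by blast
    then show False using z w by (simp add: inf_ideal_def)
  qed
qed

lemma inf_ideal_lexicographic:
  assumes "antilattice (pg_order H)" "pg_rdp H" "pg_rdp G" "pg_nontrivial G"
  shows "lexicographic_ideal E inf_ideal"
proof unfold_locales
  have int: "pg_interp H" "pg_interp G" using assms H.rdp_imp_interp G.rdp_imp_interp by blast+
  show "ea_rdp E" by (rule rdp_rep) (rule L.interp_imp_rdp[OF interp_lex[OF int dir]])
  show "ea_prime E inf_ideal" using inf_ideal_prime assms(1) int(1) .
  obtain p where p: "p \<in> pg_pos G" "p \<noteq> \<one>\<^bsub>G\<^esub>" using dir assms(4) by (rule G.directed_pos)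
  obtain x where "x \<in> carrier E" "h x = \<one>\<^bsub>H\<^esub>" "g x = p"
    using hg_surj[of "\<one>\<^bsub>H\<^esub>" p] H.one_pos u_closed p G.posD u by metis
  then have "x \<in> inf_ideal" "x \<noteq> \<zero>\<^sub>E" using p hg_zero by (auto simp: inf_ideal_def)
  then show "inf_ideal \<noteq> {\<zero>\<^sub>E}" by blast
  have "\<one>\<^sub>E \<notin> inf_ideal" using hg_one u by (simp add: inf_ideal_def)
  then show "inf_ideal \<noteq> carrier E" using one_closed by blast
qed (rule inf_ideal_ideal inf_ideal_strict inf_ideal_retractive)+

end

lemma int_pogroup_simps [simp]:
  "carrier int_pogroup = UNIV" "a \<otimes>\<^bsub>int_pogroup\<^esub> b = a + b" "\<one>\<^bsub>int_pogroup\<^esub> = 0"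
  "a \<preceq>\<^bsub>int_pogroup\<^esub> b \<longleftrightarrow> a \<le> b"
  by (simp_all add: int_pogroup_def integer_group_def monoid.defs pogroup.defs)

lemma abelian_po_group_int: "abelian_po_group int_pogroup"
proof (rule abelian_po_groupI)
  show "comm_group int_pogroup"
    by (rule comm_groupI) (auto intro: exI[of _ "- x" for x])
qed auto

section \<open>The effect subalgebra generated by the ideal\<close>

context lex_rep
begin

text \<open>The ideal together with the complements of its elements: the two extreme levels of the
  interval.\<close>

definition near :: "'a set" where
  "near = {x \<in> carrier E. h x = \<one>\<^bsub>H\<^esub> \<or> h x = u}"

lemma u_square: "\<not> u \<otimes>\<^bsub>H\<^esub> u \<preceq>\<^bsub>H\<^esub> u"
  using H.le_pos_one[of u u] u u_closed by blast

lemma near_sum: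
  assumes "a \<in> near" "b \<in> near" "Some a \<uplus> Some b = Some c" shows "c \<in> near"
proof -
  have E: "a \<in> carrier E" "b \<in> carrier E" "c \<in> carrier E" using assms osum_closed by blast+
  have hc: "h c = h a \<otimes>\<^bsub>H\<^esub> h b" using h_sum assms by blast
  have "\<not> (h a = u \<and> h b = u)" using hc u_square h_le[OF E(3)] by auto
  then show ?thesis using assms(1,2) E hc u_closed by (auto simp: near_def)
qed

lemma h_compl:
  assumes x: "x \<in> carrier E" shows "h x \<otimes>\<^bsub>H\<^esub> h (ea_compl E x) = u"
  using h_sum[OF compl(2)[OF x]] hg_one by simp

lemma near_subalgebra: "ea_subalgebra E near"
  unfolding ea_subalgebra_def
proof (intro conjI ballI allI impI)
  show "near \<subseteq> carrier E" by (auto simp: near_def)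
  show "\<one>\<^sub>E \<in> near" using one_closed hg_one by (simp add: near_def)
  fix a assume a: "a \<in> near"
  then have E: "a \<in> carrier E" "ea_compl E a \<in> carrier E" using compl by (simp_all add: near_def)
  have c: "h a \<otimes>\<^bsub>H\<^esub> h (ea_compl E a) = u" by (rule h_compl) fact
  consider "h a = \<one>\<^bsub>H\<^esub>" | "h a = u" using a by (auto simp: near_def)
  then show "ea_compl E a \<in> near"
  proof cases
    case 1
    then show ?thesis using c E h_closed by (simp add: near_def)
  next
    case 2
    then have "h (ea_compl E a) = \<one>\<^bsub>H\<^esub>" using c h_closed[OF E(2)] u_closed by simp
    then show ?thesis using E by (simp add: near_def)
  qed
  fix b c assume b: "b \<in> near" and "a \<boxplus> b = Some c"
  then have "Some a \<uplus> Some b = Some c" using E by (simp add: osum_Some near_def)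
  then show "c \<in> near" using near_sum a b by blast
qed

text \<open>An element of level \<open>u\<close> is the complement of its complement, which has
  level 0; so every subalgebra that contains the ideal contains both levels.\<close>

lemma generated_eq: "ea_generated E inf_ideal = E\<lparr>carrier := near\<rparr>"
proof -
  have "near \<subseteq> S" if S: "ea_subalgebra E S" "inf_ideal \<subseteq> S" for S
  proof
    fix x assume "x \<in> near"
    then have x: "x \<in> carrier E" "h x = \<one>\<^bsub>H\<^esub> \<or> h x = u" by (auto simp: near_def)
    show "x \<in> S"
    proof (cases "h x = \<one>\<^bsub>H\<^esub>")
      case True
      then show ?thesis using S x by (auto simp: inf_ideal_def)
    next
      case False
      have cx: "ea_compl E x \<in> carrier E" using compl x by blast
      have "h (ea_compl E x) = \<one>\<^bsub>H\<^esub>"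
        using False x(2) h_compl[OF x(1)] h_closed[OF cx] u_closed by simp
      then have "ea_compl E x \<in> S" using S cx by (auto simp: inf_ideal_def)
      moreover have "\<forall>a\<in>S. ea_compl E a \<in> S" using S(1) unfolding ea_subalgebra_def by (elim conjE)
      ultimately have "ea_compl E (ea_compl E x) \<in> S" by blast
      then show ?thesis using compl_compl x by simp
    qed
  qed
  moreover have "inf_ideal \<subseteq> near" by (auto simp: inf_ideal_def near_def)
  ultimately have "\<Inter>{S. ea_subalgebra E S \<and> inf_ideal \<subseteq> S} = near"
    using near_subalgebra by blast
  then show ?thesis by (simp add: ea_generated_def)
qed

text \<open>The levels 0 and \<open>u\<close> are renamed to the integers 0 and 1, and the second
  component is kept. The interval up to (1, 0) over the integers has the same restrictions on second
  components: positive on level 0, negative on level 1.\<close>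

lemma generated_iso:
  "ea_generated E inf_ideal \<cong>\<^sub>e Gamma (int_pogroup \<times>\<^sub>l\<^sub>e\<^sub>x G) (1, \<one>\<^bsub>G\<^esub>)"
proof -
  interpret Z: lex_product int_pogroup G
    by (intro lex_product.intro abelian_po_group_int G.abelian_po_group_axioms)
  define k where "k x = (if h x = \<one>\<^bsub>H\<^esub> then 0 else 1 :: int)" for x
  show ?thesis unfolding generated_eq
  proof (rule Z.L.iso_GammaI[where f = "\<lambda>x. (k x, g x)"])
    have nE: "x \<in> carrier E" "h x = \<one>\<^bsub>H\<^esub> \<or> h x = u" if "x \<in> near" for x
      using that by (auto simp: near_def)
    show "bij_betw (\<lambda>x. (k x, g x)) (carrier (E\<lparr>carrier := near\<rparr>))
        (carrier (Gamma (int_pogroup \<times>\<^sub>l\<^sub>e\<^sub>x G) (1, \<one>\<^bsub>G\<^esub>)))"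
      unfolding bij_betw_def
    proof (intro conjI equalityI subsetI)
      show "inj_on (\<lambda>x. (k x, g x)) (carrier (E\<lparr>carrier := near\<rparr>))"
      proof (rule inj_onI)
        fix x y assume "x \<in> carrier (E\<lparr>carrier := near\<rparr>)" "y \<in> carrier (E\<lparr>carrier := near\<rparr>)"
          and eq: "(k x, g x) = (k y, g y)"
        then have "x \<in> near" "y \<in> near" by simp_all
        moreover have "h x = h y" using nE[OF \<open>x \<in> near\<close>] nE[OF \<open>y \<in> near\<close>] eq
          by (auto simp: k_def split: if_splits)
        ultimately show "x = y" using hg_inj nE eq by simp
      qed
    next
      fix p assume "p \<in> (\<lambda>x. (k x, g x)) ` carrier (E\<lparr>carrier := near\<rparr>)"
      then obtain x where x: "x \<in> near" "p = (k x, g x)" by auto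
      note n = nE[OF x(1)]
      have "g x \<in> carrier G" using g_closed n by blast
      then show "p \<in> carrier (Gamma (int_pogroup \<times>\<^sub>l\<^sub>e\<^sub>x G) (1, \<one>\<^bsub>G\<^esub>))"
        using x n g_pos[OF n(1)] g_le[OF n(1)] u G.posD by (auto simp: k_def)
    next
      fix p assume "p \<in> carrier (Gamma (int_pogroup \<times>\<^sub>l\<^sub>e\<^sub>x G) (1, \<one>\<^bsub>G\<^esub>))"
      then obtain n b where p: "p = (n, b)" "b \<in> carrier G"
        "n > 0 \<or> n = 0 \<and> \<one>\<^bsub>G\<^esub> \<preceq>\<^bsub>G\<^esub> b" "n < 1 \<or> n = 1 \<and> b \<preceq>\<^bsub>G\<^esub> \<one>\<^bsub>G\<^esub>"
        by (cases p) auto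
      then consider "n = 0" "b \<in> pg_pos G" | "n = 1" "b \<preceq>\<^bsub>G\<^esub> \<one>\<^bsub>G\<^esub>"
        by (auto simp: pg_pos_def)
      then have "\<exists>x\<in>near. k x = n \<and> g x = b"
      proof cases
        case 1
        obtain x where "x \<in> carrier E" "h x = \<one>\<^bsub>H\<^esub>" "g x = b"
          using hg_surj[of "\<one>\<^bsub>H\<^esub>" b] H.one_pos u_closed 1 p u by metis
        then show ?thesis using 1 by (auto simp: near_def k_def)
      next
        case 2
        obtain x where "x \<in> carrier E" "h x = u" "g x = b"
          using hg_surj[of u b] H.le_refl u_closed 2 p u by metis
        then show ?thesis using 2 u by (auto simp: near_def k_def)
      qed
      then show "p \<in> (\<lambda>x. (k x, g x)) ` carrier (E\<lparr>carrier := near\<rparr>)" using p by auto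
    qed
    show "ea_one (E\<lparr>carrier := near\<rparr>) \<in> carrier (E\<lparr>carrier := near\<rparr>)"
      using one_closed hg_one by (simp add: near_def)
    show "(k (ea_one (E\<lparr>carrier := near\<rparr>)), g (ea_one (E\<lparr>carrier := near\<rparr>))) = (1, \<one>\<^bsub>G\<^esub>)"
      using hg_one u by (simp add: k_def)
    fix x y z
    assume "x \<in> carrier (E\<lparr>carrier := near\<rparr>)" "y \<in> carrier (E\<lparr>carrier := near\<rparr>)"
    then have xy: "x \<in> near" "y \<in> near" by simp_all
    note x = nE[OF xy(1)] note y = nE[OF xy(2)]
    have plus: "x \<boxplus>\<^bsub>E\<lparr>carrier := near\<rparr>\<^esub> y = Some z \<longleftrightarrow> Some x \<uplus> Some y = Some z"
      using osum_Some[OF x(1) y(1)] by simp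
    show "z \<in> carrier (E\<lparr>carrier := near\<rparr>)" if "x \<boxplus>\<^bsub>E\<lparr>carrier := near\<rparr>\<^esub> y = Some z"
      using that near_sum[OF xy] unfolding plus by simp
    assume "z \<in> carrier (E\<lparr>carrier := near\<rparr>)"
    then have z: "z \<in> carrier E" "h z = \<one>\<^bsub>H\<^esub> \<or> h z = u" using nE by simp_all
    have "u \<otimes>\<^bsub>H\<^esub> u \<noteq> \<one>\<^bsub>H\<^esub>" "u \<otimes>\<^bsub>H\<^esub> u \<noteq> u"
      using H.pos_mult_one[of u u] u u_square H.le_refl[OF u_closed(1)] by auto
    then have "h z = h x \<otimes>\<^bsub>H\<^esub> h y \<longleftrightarrow> k z = k x + k y"
      using x(2) y(2) z(2) u u_closed by (elim disjE) (simp_all add: k_def)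
    then show "x \<boxplus>\<^bsub>E\<lparr>carrier := near\<rparr>\<^esub> y = Some z \<longleftrightarrow>
        (k z, g z) = (k x, g x) \<otimes>\<^bsub>int_pogroup \<times>\<^sub>l\<^sub>e\<^sub>x G\<^esub> (k y, g y)"
      unfolding plus hg_sum[OF x(1) y(1) z(1)] by simp
  qed simp
qed

end

lemma lexicographic_ideal_of_iso:
  fixes E :: "'a effalg" and H :: "'h pogroup" and G :: "'g pogroup"
  assumes E: "effect_algebra E"
    and H: "abelian_po_group H" "pg_strong_unit H u" "pg_nontrivial H"
      "antilattice (pg_order H)" "pg_rdp H"
    and G: "abelian_po_group G" "pg_nontrivial G" "pg_directed G" "pg_rdp G"
    and iso: "E \<cong>\<^sub>e Gamma (H \<times>\<^sub>l\<^sub>e\<^sub>x G) (u, \<one>\<^bsub>G\<^esub>)"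
  shows "\<exists>I. lexicographic_ideal E I \<and> ea_quot E I \<cong>\<^sub>e Gamma H u \<and>
    ea_generated E I \<cong>\<^sub>e Gamma (int_pogroup \<times>\<^sub>l\<^sub>e\<^sub>x G) (1, \<one>\<^bsub>G\<^esub>)"
proof -
  interpret effect_algebra E by fact
  interpret lex_product H G by (intro lex_product.intro H(1) G(1))
  have u: "u \<in> pg_pos H" using H(2) by (simp add: pg_strong_unit_def)
  \<comment> \<open>A strong unit equal to 0 would bound every element and its inverse by 0, and H
    would be trivial.\<close>
  have "u \<noteq> \<one>\<^bsub>H\<^esub>"
  proof
    assume u1: "u = \<one>\<^bsub>H\<^esub>"
    have le: "x \<preceq>\<^bsub>H\<^esub> \<one>\<^bsub>H\<^esub>" if x: "x \<in> carrier H" for x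
      using H(2) x unfolding pg_strong_unit_def u1 by auto
    have "x = \<one>\<^bsub>H\<^esub>" if x: "x \<in> carrier H" for x
    proof -
      obtain p where p: "p \<in> pg_pos H" "\<one>\<^bsub>H\<^esub> = inv\<^bsub>H\<^esub> x \<otimes>\<^bsub>H\<^esub> p"
        using le[of "inv\<^bsub>H\<^esub> x"] H.le_iff_pos[of "inv\<^bsub>H\<^esub> x" "\<one>\<^bsub>H\<^esub>"] x by auto
      have pc: "p \<in> carrier H" using p H.posD by blast
      have p1: "p = \<one>\<^bsub>H\<^esub>" using le[OF pc] H.posD(2)[OF p(1)] H.le_antisym[OF pc] by simp
      have "inv\<^bsub>H\<^esub> x = inv\<^bsub>H\<^esub> x \<otimes>\<^bsub>H\<^esub> \<one>\<^bsub>H\<^esub>" using x by simp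
      also have "\<dots> = \<one>\<^bsub>H\<^esub>" using p(2)[symmetric] unfolding p1 .
      finally have "inv\<^bsub>H\<^esub> x = \<one>\<^bsub>H\<^esub>" .
      then show ?thesis using x H.inv_inv[OF x] by simp
    qed
    then show False using H(3) by (auto simp: pg_nontrivial_def)
  qed
  have uc: "(u, \<one>\<^bsub>G\<^esub>) \<in> carrier (H \<times>\<^sub>l\<^sub>e\<^sub>x G)" using u H.posD by simp
  obtain f where f: "f \<in> ea_iso E (Gamma (H \<times>\<^sub>l\<^sub>e\<^sub>x G) (u, \<one>\<^bsub>G\<^esub>))"
    using iso unfolding ea_isomorphic_def by blast
  note D = L.iso_GammaD[OF uc f plus_closed]
  interpret lex_rep H G E "fst \<circ> f" "snd \<circ> f" u
  proof unfold_locales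
    show "(u, \<one>\<^bsub>G\<^esub>) \<in> pg_pos (H \<times>\<^sub>l\<^sub>e\<^sub>x G)"
      using u uc H.posD[OF u] G.le_refl by (auto simp: pg_pos_def)
    show "bij_betw (\<lambda>x. ((fst \<circ> f) x, (snd \<circ> f) x)) (carrier E)
        (carrier (Gamma (H \<times>\<^sub>l\<^sub>e\<^sub>x G) (u, \<one>\<^bsub>G\<^esub>)))" using D(1) by simp
    show "((fst \<circ> f) \<one>\<^sub>E, (snd \<circ> f) \<one>\<^sub>E) = (u, \<one>\<^bsub>G\<^esub>)" using D(2) by simp
    fix x y z assume E: "x \<in> carrier E" "y \<in> carrier E" "z \<in> carrier E"
    then show "Some x \<uplus> Some y = Some z \<longleftrightarrow> ((fst \<circ> f) z, (snd \<circ> f) z) =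
        ((fst \<circ> f) x, (snd \<circ> f) x) \<otimes>\<^bsub>H \<times>\<^sub>l\<^sub>e\<^sub>x G\<^esub> ((fst \<circ> f) y, (snd \<circ> f) y)"
      using D(3)[OF _ _ _ E] E by (simp add: osum_Some del: lex_prod_simps)
  qed fact+
  show ?thesis using inf_ideal_lexicographic H G quot_iso generated_iso by blast
qed

section \<open>Effect algebras with a lexicographic ideal\<close>

locale lex_retract = rdp_algebra +
  fixes I :: "'a set" and \<delta> :: "'a set \<Rightarrow> 'a"
  assumes lex: "lexicographic_ideal E I"
    and \<delta>_hom: "\<delta> \<in> ea_hom (ea_quot E I) E"
    and \<delta>_section: "\<And>X. X \<in> carrier (ea_quot E I) \<Longrightarrow> ea_proj E I (\<delta> X) = X"
begin

abbreviation Q :: "'a set effalg" where "Q \<equiv> ea_quot E I"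
abbreviation proj :: "'a \<Rightarrow> 'a set" where "proj \<equiv> ea_proj E I"

lemma I_ideal: "ea_ideal E I"
  using lex by (rule lexicographic_ideal.ideal)

lemmas I_sub = idealD(1)[OF I_ideal]
lemmas zero_I = idealD(2)[OF I_ideal]
lemmas I_down = idealD(3)[OF I_ideal]
lemmas I_sum = idealD(4)[OF I_ideal]

lemma I_carrier: "x \<in> I \<Longrightarrow> x \<in> carrier E"
  using I_sub by blast

lemma one_notin_I: "\<one>\<^sub>E \<notin> I"
proof
  assume "\<one>\<^sub>E \<in> I"
  then have "carrier E \<subseteq> I" using I_down le_one by blast
  then show False using I_sub lexicographic_ideal.proper[OF lex] by blast
qed

lemma one_ne_zero: "\<one>\<^sub>E \<noteq> \<zero>\<^sub>E"
  using one_notin_I zero_I by metis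

lemma congI:
  "\<lbrakk>Some r \<uplus> Some e = Some a; Some r \<uplus> Some f = Some b; e \<in> I; f \<in> I\<rbrakk> \<Longrightarrow> (a, b) \<in> ea_cong E I"
  unfolding cong_iff[OF I_sub] using osum_closed by blast

lemma congE:
  assumes "(a, b) \<in> ea_cong E I"
  obtains r e f where "Some r \<uplus> Some e = Some a" "Some r \<uplus> Some f = Some b" "e \<in> I" "f \<in> I"
  using assms unfolding cong_iff[OF I_sub] by (elim conjE bexE exE)

lemma cong_refl: "a \<in> carrier E \<Longrightarrow> (a, a) \<in> ea_cong E I"
  using congI osum_zero zero_I by blast

lemma cong_sym:
  assumes "(a, b) \<in> ea_cong E I" shows "(b, a) \<in> ea_cong E I"
proof -
  obtain r e f where "Some r \<uplus> Some e = Some a" "Some r \<uplus> Some f = Some b" "e \<in> I" "f \<in> I"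
    using assms by (rule congE)
  then show ?thesis by (intro congI[of r f b e a])
qed

text \<open>RDP is applied to the two decompositions r + f and s + e' of \<open>b\<close>. The part
  \<open>p\<close> shared by \<open>r\<close> and \<open>s\<close> is the new common part;
  \<open>q\<close> lies below \<open>e'\<close> and \<open>p'\<close> below \<open>f\<close>, hence
  both are in I.\<close>

lemma cong_trans:
  assumes "(a, b) \<in> ea_cong E I" "(b, c) \<in> ea_cong E I" shows "(a, c) \<in> ea_cong E I"
proof -
  obtain r e f where 1: "Some r \<uplus> Some e = Some a" "Some r \<uplus> Some f = Some b" "e \<in> I" "f \<in> I"
    using assms(1) by (rule congE)
  obtain s e' f' where 2: "Some s \<uplus> Some e' = Some b" "Some s \<uplus> Some f' = Some c" "e' \<in> I" "f' \<in> I"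
    using assms(2) by (rule congE)
  obtain p q p' q' where p: "Some p \<uplus> Some q = Some r" "Some p' \<uplus> Some q' = Some f"
    "Some p \<uplus> Some p' = Some s" "Some q \<uplus> Some q' = Some e'"
    by (rule rdp_osum[OF rdp 1(2) 2(1)])
  have I: "q \<in> I" "p' \<in> I" using I_down leI p 1 2 by metis+
  have "Some p \<uplus> (Some q \<uplus> Some e) = Some a" "Some p \<uplus> (Some p' \<uplus> Some f') = Some c"
    using p 1 2 by (metis osum_assoc)+
  then obtain x y where "Some q \<uplus> Some e = Some x" "Some p \<uplus> Some x = Some a"
    "Some p' \<uplus> Some f' = Some y" "Some p \<uplus> Some y = Some c" by (metis osum_eq_SomeE)
  then show ?thesis using I_sum I 1 2 by (metis congI)
qed

text \<open>Regrouping (r + e) + (s + e') shows that r + s exists; it is the common part of the two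
  sums.\<close>

lemma cong_sum:
  assumes "(a, a') \<in> ea_cong E I" "(b, b') \<in> ea_cong E I"
    and c: "Some a \<uplus> Some b = Some c" and c': "Some a' \<uplus> Some b' = Some c'"
  shows "(c, c') \<in> ea_cong E I"
proof -
  obtain r e f where 1: "Some r \<uplus> Some e = Some a" "Some r \<uplus> Some f = Some a'" "e \<in> I" "f \<in> I"
    using assms(1) by (rule congE)
  obtain s e' f' where 2: "Some s \<uplus> Some e' = Some b" "Some s \<uplus> Some f' = Some b'" "e' \<in> I" "f' \<in> I"
    using assms(2) by (rule congE)
  have "Some r \<uplus> Some s \<uplus> (Some e \<uplus> Some e') = Some r \<uplus> Some e \<uplus> (Some s \<uplus> Some e')"
    by (simp only: osum_ac)
  then have A: "Some r \<uplus> Some s \<uplus> (Some e \<uplus> Some e') = Some c" using 1(1) 2(1) c by simp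
  have "Some r \<uplus> Some s \<uplus> (Some f \<uplus> Some f') = Some r \<uplus> Some f \<uplus> (Some s \<uplus> Some f')"
    by (simp only: osum_ac)
  then have B: "Some r \<uplus> Some s \<uplus> (Some f \<uplus> Some f') = Some c'" using 1(2) 2(2) c' by simp
  obtain t x where t: "Some r \<uplus> Some s = Some t" "Some e \<uplus> Some e' = Some x"
    using A by (metis osum_eq_SomeE)
  obtain y where y: "Some f \<uplus> Some f' = Some y" using B by (metis osum_eq_SomeE)
  have "x \<in> I" "y \<in> I" using I_sum t y 1 2 by blast+
  then show ?thesis using congI A B t y by metis
qed

lemma proj_mem: "y \<in> proj x \<longleftrightarrow> (x, y) \<in> ea_cong E I"
  by (simp add: ea_proj_def)

lemma proj_eq_iff:
  assumes "x \<in> carrier E" "y \<in> carrier E"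
  shows "proj x = proj y \<longleftrightarrow> (x, y) \<in> ea_cong E I"
proof
  assume "proj x = proj y"
  then show "(x, y) \<in> ea_cong E I" using proj_mem cong_refl assms by metis
next
  assume "(x, y) \<in> ea_cong E I"
  then show "proj x = proj y" using proj_mem cong_sym cong_trans by blast
qed

lemma proj_closed: "x \<in> carrier E \<Longrightarrow> proj x \<in> carrier Q"
  unfolding quot_carrier by blast

lemma proj_sum:
  assumes c: "Some a \<uplus> Some b = Some c" shows "proj a \<boxplus>\<^bsub>Q\<^esub> proj b = Some (proj c)"
proof -
  have ab: "a \<in> carrier E" "b \<in> carrier E" "c \<in> carrier E" "a \<boxplus> b = Some c"
    using c osum_closed osum_Some_iff by blast+
  have mem: "a \<in> proj a" "b \<in> proj b" using ab cong_refl by (simp_all add: proj_mem)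
  have eq: "proj c' = proj c" if c': "a' \<in> proj a" "b' \<in> proj b" "a' \<boxplus> b' = Some c'" for a' b' c'
  proof -
    have "a' \<in> carrier E" "b' \<in> carrier E" using c' by (auto simp: proj_mem ea_cong_def)
    then have s: "Some a' \<uplus> Some b' = Some c'" using c' osum_Some by simp
    have "(c, c') \<in> ea_cong E I" using cong_sum[OF _ _ c s] c' by (simp add: proj_mem)
    then show ?thesis using proj_eq_iff ab osum_closed[OF s] by blast
  qed
  have "{proj c' | c'. \<exists>a'\<in>proj a. \<exists>b'\<in>proj b. a' \<boxplus> b' = Some c'} = {proj c}"
    using eq mem ab by blast
  moreover have "\<exists>a'\<in>proj a. \<exists>b'\<in>proj b. a' \<boxplus> b' \<noteq> None" using mem ab by blast
  ultimately show ?thesis unfolding ea_quot_def effalg.simps by simp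
qed

definition \<rho> :: "'a \<Rightarrow> 'a" where
  "\<rho> x = \<delta> (proj x)"

lemma \<rho>_closed: "x \<in> carrier E \<Longrightarrow> \<rho> x \<in> carrier E"
  unfolding \<rho>_def using \<delta>_hom proj_closed by (auto simp: ea_hom_def)

lemma proj_\<rho>: "x \<in> carrier E \<Longrightarrow> proj (\<rho> x) = proj x"
  unfolding \<rho>_def by (intro \<delta>_section proj_closed)

lemma \<rho>_\<rho>: "x \<in> carrier E \<Longrightarrow> \<rho> (\<rho> x) = \<rho> x"
  using proj_\<rho> by (simp add: \<rho>_def)

lemma \<rho>_one: "\<rho> \<one>\<^sub>E = \<one>\<^sub>E"
  using \<delta>_hom by (simp add: \<rho>_def ea_hom_def quot_one)

lemma \<rho>_sum:
  assumes c: "Some a \<uplus> Some b = Some c" shows "Some (\<rho> a) \<uplus> Some (\<rho> b) = Some (\<rho> c)"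
proof -
  have ab: "a \<in> carrier E" "b \<in> carrier E" using c osum_closed by blast+
  have "\<forall>A\<in>carrier Q. \<forall>B\<in>carrier Q. \<forall>C. A \<boxplus>\<^bsub>Q\<^esub> B = Some C \<longrightarrow> \<delta> A \<boxplus> \<delta> B = Some (\<delta> C)"
    using \<delta>_hom unfolding ea_hom_def by blast
  then have "\<rho> a \<boxplus> \<rho> b = Some (\<rho> c)"
    unfolding \<rho>_def using proj_sum[OF c] proj_closed ab by blast
  then show ?thesis using osum_Some \<rho>_closed ab by simp
qed

lemma \<rho>_zero: "\<rho> \<zero>\<^sub>E = \<zero>\<^sub>E"
proof -
  have "Some \<one>\<^sub>E \<uplus> Some (\<rho> \<zero>\<^sub>E) = Some \<one>\<^sub>E" using \<rho>_sum[OF one_zero] \<rho>_one by simp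
  then show ?thesis by (rule one_osum)
qed

lemma \<rho>_compl: "x \<in> carrier E \<Longrightarrow> \<rho> (ea_compl E x) = ea_compl E (\<rho> x)"
  using \<rho>_sum[OF compl(2)] \<rho>_one compl_unique by metis

lemma \<rho>_decomp:
  assumes "x \<in> carrier E"
  obtains r e f where "Some r \<uplus> Some e = Some x" "Some r \<uplus> Some f = Some (\<rho> x)" "e \<in> I" "f \<in> I"
proof -
  have "(x, \<rho> x) \<in> ea_cong E I" using proj_\<rho> proj_eq_iff \<rho>_closed assms by metis
  then show thesis using that by (rule congE)
qed

text \<open>The ideal is the class of 0. Conversely, if \<rho> x = 0, then the common part of
  \<open>x\<close> and \<rho> x lies below 0, so \<open>x\<close> is equal to its remainder in
  I.\<close>

lemma I_iff: assumes "x \<in> carrier E" shows "x \<in> I \<longleftrightarrow> \<rho> x = \<zero>\<^sub>E"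
proof
  assume "x \<in> I"
  then have "(x, \<zero>\<^sub>E) \<in> ea_cong E I"
    using congI[of "\<zero>\<^sub>E" x x "\<zero>\<^sub>E" "\<zero>\<^sub>E"] osum_zero assms zero_I zero_closed by blast
  then have "proj x = proj \<zero>\<^sub>E" using proj_eq_iff assms zero_closed by blast
  then show "\<rho> x = \<zero>\<^sub>E" using \<rho>_zero by (simp add: \<rho>_def)
next
  assume 0: "\<rho> x = \<zero>\<^sub>E"
  obtain r e f where r: "Some r \<uplus> Some e = Some x" "Some r \<uplus> Some f = Some (\<rho> x)" "e \<in> I"
    using assms by (rule \<rho>_decomp)
  have "Some r = Some \<zero>\<^sub>E" using r(2) unfolding 0 by (rule osum_eq_zero)
  then have "x = e" using r(1) osum_zero(2)[OF I_carrier[OF r(3)]] by simp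
  then show "x \<in> I" using r by simp
qed

text \<open>Strictness with the quotient replaced by its copy in E: a strict inequality between
  images under \<rho> projects to a strict inequality of classes.\<close>

lemma strict_le:
  assumes x: "x \<in> carrier E" and y: "y \<in> carrier E" and le: "ea_le E (\<rho> x) (\<rho> y)" "\<rho> x \<noteq> \<rho> y"
  shows "ea_le E x y"
proof -
  obtain c where c: "c \<in> carrier E" "Some (\<rho> x) \<uplus> Some c = Some (\<rho> y)" using le(1) by (rule leE)
  have "proj x \<boxplus>\<^bsub>Q\<^esub> proj c = Some (proj y)" using proj_sum[OF c(2)] proj_\<rho> x y by simp
  moreover have "proj x \<noteq> proj y" using le(2) by (auto simp: \<rho>_def)
  ultimately have "ea_less Q (proj x) (proj y)"
    unfolding ea_less_def ea_le_def using proj_closed x y c by blast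
  then have "ea_less E x y"
    using lexicographic_ideal.strict[OF lex] x y unfolding ea_strict_def by blast
  then show ?thesis by (simp add: ea_less_def)
qed

definition isum :: "'a \<Rightarrow> 'a \<Rightarrow> 'a" where
  "isum e f = the (Some e \<uplus> Some f)"

text \<open>The complement of \<open>f\<close> is mapped to 1 by \<rho>, and \<open>e\<close> to 0,
  which differs from 1. By strictness \<open>e\<close> lies below the complement of
  \<open>f\<close>, which means that e + f is defined.\<close>

lemma isum:
  assumes e: "e \<in> I" and f: "f \<in> I"
  shows "Some e \<uplus> Some f = Some (isum e f)" "isum e f \<in> I"
proof -
  have E: "e \<in> carrier E" "f \<in> carrier E" "ea_compl E f \<in> carrier E"
    using I_carrier e f compl by blast+
  have z: "\<rho> e = \<zero>\<^sub>E" "\<rho> f = \<zero>\<^sub>E" using I_iff E e f by blast+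
  have "Some \<zero>\<^sub>E \<uplus> Some (\<rho> (ea_compl E f)) = Some \<one>\<^sub>E"
    using \<rho>_sum[OF compl(2)[OF E(2)]] z \<rho>_one by simp
  then have "\<rho> (ea_compl E f) = \<one>\<^sub>E" using osum_zero(2)[OF \<rho>_closed[OF E(3)]] by simp
  then have "ea_le E e (ea_compl E f)"
    using strict_le[OF E(1,3)] z zero_le one_closed one_ne_zero by simp
  then obtain c where c: "Some e \<uplus> Some f = Some c" using osum_defined_iff E by blast
  then have *: "isum e f = c" by (simp add: isum_def)
  show "Some e \<uplus> Some f = Some (isum e f)" using c * by simp
  show "isum e f \<in> I" using I_sum[OF e f c] * by simp
qed

definition I_monoid :: "'a monoid" where
  "I_monoid = \<lparr>carrier = I, monoid.mult = isum, one = \<zero>\<^sub>E\<rparr>"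

lemma I_monoid_simps [simp]:
  "carrier I_monoid = I" "x \<otimes>\<^bsub>I_monoid\<^esub> y = isum x y" "\<one>\<^bsub>I_monoid\<^esub> = \<zero>\<^sub>E"
  by (simp_all add: I_monoid_def)

lemma isum_eqI: "Some e \<uplus> Some f = Some c \<Longrightarrow> isum e f = c"
  by (simp add: isum_def)

lemma group_of_differences_I: "group_of_differences I_monoid I (\<lambda>x. x)"
proof (intro group_of_differences.intro group_of_differences_axioms.intro)
  show "comm_monoid I_monoid"
  proof (rule comm_monoidI, unfold I_monoid_simps)
    fix x y z assume x: "x \<in> I" and y: "y \<in> I"
    show "isum x y \<in> I" using isum x y by blast
    show "isum x y = isum y x" by (simp add: isum_def osum_commute)
    show "isum \<zero>\<^sub>E x = x" using osum_zero I_carrier[OF x] by (intro isum_eqI) simp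
    assume z: "z \<in> I"
    have "Some x \<uplus> Some y \<uplus> Some z = Some (isum (isum x y) z)" using isum x y z by simp
    moreover have "Some x \<uplus> (Some y \<uplus> Some z) = Some (isum x (isum y z))" using isum x y z by simp
    ultimately show "isum (isum x y) z = isum x (isum y z)" by (simp add: osum_assoc)
  qed (rule zero_I)
  show "(\<lambda>x. x) ` I = carrier I_monoid" by simp
next
  fix x y z assume "z \<otimes>\<^bsub>I_monoid\<^esub> x = z \<otimes>\<^bsub>I_monoid\<^esub> y"
    "x \<in> carrier I_monoid" "y \<in> carrier I_monoid" "z \<in> carrier I_monoid"
  then show "x = y" using isum(1)[of z x] isum(1)[of z y] osum_cancel_Some by simp
next
  fix x y assume "x \<otimes>\<^bsub>I_monoid\<^esub> y = \<one>\<^bsub>I_monoid\<^esub>" "x \<in> carrier I_monoid" "y \<in> carrier I_monoid"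
  then show "x = \<one>\<^bsub>I_monoid\<^esub>" using isum(1)[of x y] osum_eq_zero(1)[of "Some x" "Some y"] by simp
next
  fix x1 x2 y1 y2 assume "x1 \<otimes>\<^bsub>I_monoid\<^esub> x2 = y1 \<otimes>\<^bsub>I_monoid\<^esub> y2"
    "x1 \<in> carrier I_monoid" "x2 \<in> carrier I_monoid" "y1 \<in> carrier I_monoid" "y2 \<in> carrier I_monoid"
  then have I: "x1 \<in> I" "x2 \<in> I" "y1 \<in> I" "y2 \<in> I" and "isum x1 x2 = isum y1 y2" by simp_all
  then have "Some x1 \<uplus> Some x2 = Some (isum x1 x2)" "Some y1 \<uplus> Some y2 = Some (isum x1 x2)"
    using isum by simp_all
  then obtain w v t s where *: "Some w \<uplus> Some v = Some x1" "Some t \<uplus> Some s = Some x2"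
    "Some w \<uplus> Some t = Some y1" "Some v \<uplus> Some s = Some y2"
    by (rule rdp_osum[OF rdp])
  have "w \<in> I" "v \<in> I" "t \<in> I" using I_down[OF leI[OF *(1)] I(1)] I_down[OF leI[OF *(2)] I(2)]
      I_down[OF leI[OF *(4)] I(4)] by blast+
  moreover have "s \<in> I" using I_down[OF leI, of s t x2] * I by (simp add: osum_commute)
  ultimately show "\<exists>w\<in>carrier I_monoid. \<exists>v\<in>carrier I_monoid. \<exists>t\<in>carrier I_monoid. \<exists>s\<in>carrier I_monoid.
      x1 = w \<otimes>\<^bsub>I_monoid\<^esub> v \<and> x2 = t \<otimes>\<^bsub>I_monoid\<^esub> s \<and> y1 = w \<otimes>\<^bsub>I_monoid\<^esub> t \<and> y2 = v \<otimes>\<^bsub>I_monoid\<^esub> s"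
    using *[THEN isum_eqI] by (intro bexI[of _ w] bexI[of _ v] bexI[of _ t] bexI[of _ s]) simp_all
qed

sublocale G: group_of_differences I_monoid I "\<lambda>x. x"
  by (rule group_of_differences_I)

text \<open>In the universal group of \<open>E\<close> this says that \<open>x - \<rho> x = e - f\<close>.\<close>

definition gam :: "'a \<Rightarrow> 'a \<Rightarrow> 'a \<Rightarrow> bool" where
  "gam x e f \<longleftrightarrow> e \<in> I \<and> f \<in> I \<and> iota x \<otimes>\<^bsub>univ\<^esub> iota f = iota (\<rho> x) \<otimes>\<^bsub>univ\<^esub> iota e"

lemma iota_osum: "Some a \<uplus> Some b = Some c \<Longrightarrow> iota c = iota a \<otimes>\<^bsub>univ\<^esub> iota b"
  using iota_osum_iff osum_closed by metis

lemma gamI: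
  assumes "Some r \<uplus> Some e = Some x" "Some r \<uplus> Some f = Some (\<rho> x)" "e \<in> I" "f \<in> I"
  shows "gam x e f"
proof -
  have "r \<in> carrier E" using osum_closed assms by blast
  then have [simp]: "iota r \<in> carrier univ" "iota e \<in> carrier univ" "iota f \<in> carrier univ"
    using iota_closed I_carrier assms by blast+
  show ?thesis unfolding gam_def iota_osum[OF assms(1)] iota_osum[OF assms(2)]
    using assms by (simp add: W.D.m_ac)
qed

lemma gam_ex: "x \<in> carrier E \<Longrightarrow> \<exists>e f. gam x e f"
  using \<rho>_decomp gamI by metis

text \<open>Combining the two equations and cancelling \<open>iota x\<close> and
  \<open>iota (\<rho> x)\<close> in the universal group leaves e + f' = e' + f. Both sides are sums
  in I, so the equation holds in E by injectivity of \<open>iota\<close>, and there it says that the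
  fractions agree.\<close>

lemma gam_unique:
  assumes x: "x \<in> carrier E" and "gam x e f" "gam x e' f'"
  shows "G.frac e f = G.frac e' f'"
proof -
  have I: "e \<in> I" "f \<in> I" "e' \<in> I" "f' \<in> I"
    and eq: "iota x \<otimes>\<^bsub>univ\<^esub> iota f = iota (\<rho> x) \<otimes>\<^bsub>univ\<^esub> iota e"
      "iota x \<otimes>\<^bsub>univ\<^esub> iota f' = iota (\<rho> x) \<otimes>\<^bsub>univ\<^esub> iota e'"
    using assms by (simp_all add: gam_def)
  have [simp]: "iota x \<in> carrier univ" "iota (\<rho> x) \<in> carrier univ" "iota e \<in> carrier univ"
    "iota f \<in> carrier univ" "iota e' \<in> carrier univ" "iota f' \<in> carrier univ"
    using iota_closed I_carrier I x \<rho>_closed by blast+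
  have "(iota x \<otimes>\<^bsub>univ\<^esub> iota f') \<otimes>\<^bsub>univ\<^esub> (iota (\<rho> x) \<otimes>\<^bsub>univ\<^esub> iota e) =
      (iota (\<rho> x) \<otimes>\<^bsub>univ\<^esub> iota e') \<otimes>\<^bsub>univ\<^esub> (iota x \<otimes>\<^bsub>univ\<^esub> iota f)" using eq by simp
  then have "(iota x \<otimes>\<^bsub>univ\<^esub> iota (\<rho> x)) \<otimes>\<^bsub>univ\<^esub> (iota e \<otimes>\<^bsub>univ\<^esub> iota f') =
      (iota x \<otimes>\<^bsub>univ\<^esub> iota (\<rho> x)) \<otimes>\<^bsub>univ\<^esub> (iota e' \<otimes>\<^bsub>univ\<^esub> iota f)"
    by (simp add: W.D.m_ac)
  then have "iota e \<otimes>\<^bsub>univ\<^esub> iota f' = iota e' \<otimes>\<^bsub>univ\<^esub> iota f" by simp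
  then have "iota (isum e f') = iota (isum e' f)"
    using iota_osum[OF isum(1)] I by simp
  then have "isum e f' = isum e' f" using iota_inj isum(2) I_carrier I by blast
  then show ?thesis using G.frac_eq I by simp
qed

text \<open>The second coordinate x - \<rho> x. The defining equation lives in the universal group
  of E, but the value is taken in the group of differences of I, whose elements have type
  \<open>('a \<times> 'a) set\<close>.\<close>

definition \<gamma> :: "'a \<Rightarrow> ('a \<times> 'a) set" where
  "\<gamma> x = (THE s. \<exists>e f. gam x e f \<and> s = G.frac e f)"

lemma \<gamma>_eq: "x \<in> carrier E \<Longrightarrow> gam x e f \<Longrightarrow> \<gamma> x = G.frac e f"
  unfolding \<gamma>_def by (rule the_equality) (use gam_unique in blast)+

lemma gam_sum:
  assumes z: "Some x \<uplus> Some y = Some z" and "gam x e f" "gam y e' f'"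
  shows "gam z (isum e e') (isum f f')"
proof -
  have I: "e \<in> I" "f \<in> I" "e' \<in> I" "f' \<in> I"
    and eq: "iota x \<otimes>\<^bsub>univ\<^esub> iota f = iota (\<rho> x) \<otimes>\<^bsub>univ\<^esub> iota e"
      "iota y \<otimes>\<^bsub>univ\<^esub> iota f' = iota (\<rho> y) \<otimes>\<^bsub>univ\<^esub> iota e'"
    using assms by (simp_all add: gam_def)
  have E: "x \<in> carrier E" "y \<in> carrier E" using z osum_closed by blast+
  have [simp]: "iota x \<in> carrier univ" "iota (\<rho> x) \<in> carrier univ"
    "iota y \<in> carrier univ" "iota (\<rho> y) \<in> carrier univ" "iota e \<in> carrier univ"
    "iota f \<in> carrier univ" "iota e' \<in> carrier univ" "iota f' \<in> carrier univ"
    using iota_closed I_carrier I E \<rho>_closed by blast+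
  have "(iota x \<otimes>\<^bsub>univ\<^esub> iota f) \<otimes>\<^bsub>univ\<^esub> (iota y \<otimes>\<^bsub>univ\<^esub> iota f') =
      (iota (\<rho> x) \<otimes>\<^bsub>univ\<^esub> iota e) \<otimes>\<^bsub>univ\<^esub> (iota (\<rho> y) \<otimes>\<^bsub>univ\<^esub> iota e')" using eq by simp
  then have "iota z \<otimes>\<^bsub>univ\<^esub> iota (isum f f') = iota (\<rho> z) \<otimes>\<^bsub>univ\<^esub> iota (isum e e')"
    unfolding iota_osum[OF z] iota_osum[OF \<rho>_sum[OF z]] iota_osum[OF isum(1)[OF I(2,4)]]
      iota_osum[OF isum(1)[OF I(1,3)]] by (simp add: W.D.m_ac)
  then show ?thesis using isum(2) I by (simp add: gam_def)
qed

lemma \<gamma>_sum: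
  assumes z: "Some x \<uplus> Some y = Some z"
  shows "\<gamma> z = \<gamma> x \<otimes>\<^bsub>G.diffs\<^esub> \<gamma> y"
proof -
  have E: "x \<in> carrier E" "y \<in> carrier E" "z \<in> carrier E" using z osum_closed by blast+
  obtain e f where g: "gam x e f" using gam_ex E(1) by blast
  obtain e' f' where g': "gam y e' f'" using gam_ex E(2) by blast
  have I: "e \<in> I" "f \<in> I" "e' \<in> I" "f' \<in> I" using g g' by (simp_all add: gam_def)
  show ?thesis using \<gamma>_eq[OF E(3) gam_sum[OF z g g']] \<gamma>_eq[OF E(1) g] \<gamma>_eq[OF E(2) g'] I
    by (simp add: G.frac_mult)
qed

lemma \<gamma>_closed:
  assumes "x \<in> carrier E" shows "\<gamma> x \<in> carrier G.diffs"
proof -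
  obtain e f where g: "gam x e f" using gam_ex assms by blast
  then show ?thesis using \<gamma>_eq[OF assms g] G.frac_closed by (simp add: gam_def)
qed

text \<open>In the universal group \<open>x\<close> is recovered from its coordinates as \<rho> x +
  (e - f). Adding these equations for \<open>x\<close> and \<open>y\<close>, and cancelling the
  negative parts \<open>f\<close>, \<open>f'\<close> and \<open>b\<close>, turns the two coordinate
  equations into one between the images of \<open>x\<close>, \<open>y\<close> and \<open>z\<close>;
  the embedding of E reflects it as a sum.\<close>

lemma sum_if_\<gamma>:
  assumes E: "x \<in> carrier E" "y \<in> carrier E" "z \<in> carrier E"
    and \<rho>: "Some (\<rho> x) \<uplus> Some (\<rho> y) = Some (\<rho> z)" and \<gamma>: "\<gamma> z = \<gamma> x \<otimes>\<^bsub>G.diffs\<^esub> \<gamma> y"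
  shows "Some x \<uplus> Some y = Some z"
proof -
  obtain e f where g: "gam x e f" using gam_ex E(1) by blast
  obtain e' f' where g': "gam y e' f'" using gam_ex E(2) by blast
  obtain a b where g'': "gam z a b" using gam_ex E(3) by blast
  have I: "e \<in> I" "f \<in> I" "e' \<in> I" "f' \<in> I" "a \<in> I" "b \<in> I"
    and eq: "iota x \<otimes>\<^bsub>univ\<^esub> iota f = iota (\<rho> x) \<otimes>\<^bsub>univ\<^esub> iota e"
      "iota y \<otimes>\<^bsub>univ\<^esub> iota f' = iota (\<rho> y) \<otimes>\<^bsub>univ\<^esub> iota e'"
      "iota z \<otimes>\<^bsub>univ\<^esub> iota b = iota (\<rho> z) \<otimes>\<^bsub>univ\<^esub> iota a"
    using g g' g'' by (simp_all add: gam_def)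
  have [simp]: "iota x \<in> carrier univ" "iota (\<rho> x) \<in> carrier univ" "iota z \<in> carrier univ"
    "iota y \<in> carrier univ" "iota (\<rho> y) \<in> carrier univ" "iota e \<in> carrier univ"
    "iota f \<in> carrier univ" "iota e' \<in> carrier univ" "iota f' \<in> carrier univ"
    "iota a \<in> carrier univ" "iota b \<in> carrier univ"
    using iota_closed I_carrier I E \<rho>_closed by blast+
  have "G.frac a b = G.frac (isum e e') (isum f f')"
    using \<gamma> \<gamma>_eq[OF E(3) g''] \<gamma>_eq[OF E(1) g] \<gamma>_eq[OF E(2) g'] I by (simp add: G.frac_mult)
  then have "isum a (isum f f') = isum (isum e e') b" using I isum(2) by (simp add: G.frac_eq)
  then have "iota (isum a (isum f f')) = iota (isum (isum e e') b)" by simp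
  then have 1: "iota a \<otimes>\<^bsub>univ\<^esub> (iota f \<otimes>\<^bsub>univ\<^esub> iota f') = iota e \<otimes>\<^bsub>univ\<^esub> iota e' \<otimes>\<^bsub>univ\<^esub> iota b"
    using iota_osum[OF isum(1)] isum(2) I by simp
  define m where "m = iota (\<rho> x) \<otimes>\<^bsub>univ\<^esub> iota (\<rho> y)"
  have m: "m \<in> carrier univ" "iota (\<rho> z) = m" using iota_osum[OF \<rho>] by (simp_all add: m_def)
  have 2: "(iota x \<otimes>\<^bsub>univ\<^esub> iota f) \<otimes>\<^bsub>univ\<^esub> (iota y \<otimes>\<^bsub>univ\<^esub> iota f') =
      m \<otimes>\<^bsub>univ\<^esub> (iota e \<otimes>\<^bsub>univ\<^esub> iota e')"
    unfolding eq m_def by (simp add: W.D.m_ac)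
  have "(iota f \<otimes>\<^bsub>univ\<^esub> iota f' \<otimes>\<^bsub>univ\<^esub> iota b) \<otimes>\<^bsub>univ\<^esub> iota z =
      (iota z \<otimes>\<^bsub>univ\<^esub> iota b) \<otimes>\<^bsub>univ\<^esub> (iota f \<otimes>\<^bsub>univ\<^esub> iota f')" by (simp add: W.D.m_ac)
  also have "\<dots> = m \<otimes>\<^bsub>univ\<^esub> (iota a \<otimes>\<^bsub>univ\<^esub> (iota f \<otimes>\<^bsub>univ\<^esub> iota f'))"
    unfolding eq(3) m(2) using m(1) by (simp add: W.D.m_assoc)
  also have "\<dots> = m \<otimes>\<^bsub>univ\<^esub> (iota e \<otimes>\<^bsub>univ\<^esub> iota e') \<otimes>\<^bsub>univ\<^esub> iota b"
    unfolding 1 using m(1) by (simp add: W.D.m_assoc)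
  also have "\<dots> = (iota f \<otimes>\<^bsub>univ\<^esub> iota f' \<otimes>\<^bsub>univ\<^esub> iota b) \<otimes>\<^bsub>univ\<^esub> (iota x \<otimes>\<^bsub>univ\<^esub> iota y)"
    unfolding 2[symmetric] by (simp add: W.D.m_ac)
  finally have "iota z = iota x \<otimes>\<^bsub>univ\<^esub> iota y" by (simp del: W.D.m_assoc)
  then show ?thesis using iota_osum_iff E by blast
qed

end

section \<open>The image of the retraction, and the representation by two coordinates\<close>

context lex_retract
begin

text \<open>The copy of E/I inside E, with elements of type \<open>'a\<close>. Since 0 and 1 are
  fixed by \<rho> and sums and complements are respected, it carries the operations of E
  unchanged.\<close>

definition ret :: "'a effalg" where
  "ret = E\<lparr>carrier := \<rho> ` carrier E\<rparr>"

lemma ret_simps [simp]: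
  "carrier ret = \<rho> ` carrier E" "a \<boxplus>\<^bsub>ret\<^esub> b = a \<boxplus> b" "ea_zero ret = \<zero>\<^sub>E" "ea_one ret = \<one>\<^sub>E"
  by (simp_all add: ret_def)

lemma ret_iff: "a \<in> \<rho> ` carrier E \<longleftrightarrow> a \<in> carrier E \<and> \<rho> a = a"
  using \<rho>_closed \<rho>_\<rho> by force

lemma ret_sum:
  assumes "Some a \<uplus> Some b = Some c" "\<rho> a = a" "\<rho> b = b" shows "\<rho> c = c"
  using \<rho>_sum[OF assms(1)] assms by simp

lemma effect_algebra_ret: "effect_algebra ret"
proof (rule effect_algebra.intro; (unfold ret_simps)?; (unfold ret_iff)?)
  show "\<zero>\<^sub>E \<in> carrier E \<and> \<rho> \<zero>\<^sub>E = \<zero>\<^sub>E" using zero_closed \<rho>_zero by blast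
  show "\<one>\<^sub>E \<in> carrier E \<and> \<rho> \<one>\<^sub>E = \<one>\<^sub>E" using one_closed \<rho>_one by blast
next
  fix a b c assume *: "a \<in> carrier E \<and> \<rho> a = a" "b \<in> carrier E \<and> \<rho> b = b" "a \<boxplus> b = Some c"
  then have s: "Some a \<uplus> Some b = Some c" using osum_Some by simp
  then show "c \<in> carrier E \<and> \<rho> c = c" using ret_sum[OF s] osum_closed[OF s] * by blast
next
  fix a b assume "a \<in> carrier E \<and> \<rho> a = a" "b \<in> carrier E \<and> \<rho> b = b"
  then show "a \<boxplus> b = b \<boxplus> a" using plus_commute by blast
next
  fix a b c
  assume "a \<in> carrier E \<and> \<rho> a = a" "b \<in> carrier E \<and> \<rho> b = b" "c \<in> carrier E \<and> \<rho> c = c"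
  then have c: "a \<in> carrier E" "b \<in> carrier E" "c \<in> carrier E" by simp_all
  show "Option.bind (a \<boxplus> b) (\<lambda>x. x \<boxplus> c) = Option.bind (b \<boxplus> c) (\<lambda>y. a \<boxplus> y)"
    using plus_assoc[OF c] .
next
  fix a assume a: "a \<in> carrier E \<and> \<rho> a = a"
  then have c: "ea_compl E a \<in> carrier E" "Some a \<uplus> Some (ea_compl E a) = Some \<one>\<^sub>E"
    using compl by blast+
  show "\<exists>!x. (x \<in> carrier E \<and> \<rho> x = x) \<and> a \<boxplus> x = Some \<one>\<^sub>E"
  proof (rule ex1I[of _ "ea_compl E a"])
    show "(ea_compl E a \<in> carrier E \<and> \<rho> (ea_compl E a) = ea_compl E a) \<and>
        a \<boxplus> ea_compl E a = Some \<one>\<^sub>E"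
      using a c \<rho>_compl osum_Some_iff by simp
    fix x assume "(x \<in> carrier E \<and> \<rho> x = x) \<and> a \<boxplus> x = Some \<one>\<^sub>E"
    then have "Some a \<uplus> Some x = Some \<one>\<^sub>E" using a osum_Some by simp
    then show "x = ea_compl E a" by (rule compl_unique)
  qed
next
  fix a assume "a \<in> carrier E \<and> \<rho> a = a" "a \<boxplus> \<one>\<^sub>E \<noteq> None"
  then show "a = \<zero>\<^sub>E" using plus_one_defined by blast
qed

text \<open>A refinement found in E is mapped by \<rho> to one in the image; the row and column sums
  are fixed by \<rho> and so remain the same.\<close>

lemma rdp_ret: "ea_rdp ret"
  unfolding ea_rdp_def ret_simps
proof (intro ballI impI)
  fix a1 a2 b1 b2
  assume *: "a1 \<in> \<rho> ` carrier E" "a2 \<in> \<rho> ` carrier E" "b1 \<in> \<rho> ` carrier E" "b2 \<in> \<rho> ` carrier E"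
    and s: "a1 \<boxplus> a2 \<noteq> None \<and> a1 \<boxplus> a2 = b1 \<boxplus> b2"
  then have E: "a1 \<in> carrier E" "a2 \<in> carrier E" "b1 \<in> carrier E" "b2 \<in> carrier E"
    and \<rho>: "\<rho> a1 = a1" "\<rho> a2 = a2" "\<rho> b1 = b1" "\<rho> b2 = b2" unfolding ret_iff by simp_all
  obtain d where "a1 \<boxplus> a2 = Some d" using s by blast
  then have d: "Some a1 \<uplus> Some a2 = Some d" "Some b1 \<uplus> Some b2 = Some d"
    using E s by (simp_all add: osum_Some)
  obtain c11 c12 c21 c22 where c: "Some c11 \<uplus> Some c12 = Some a1" "Some c21 \<uplus> Some c22 = Some a2"
    "Some c11 \<uplus> Some c21 = Some b1" "Some c12 \<uplus> Some c22 = Some b2"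
    by (rule rdp_osum[OF rdp d])
  have cE: "c11 \<in> carrier E" "c12 \<in> carrier E" "c21 \<in> carrier E" "c22 \<in> carrier E"
    using c osum_closed by blast+
  have "\<rho> c11 \<boxplus> \<rho> c12 = Some a1" "\<rho> c21 \<boxplus> \<rho> c22 = Some a2" "\<rho> c11 \<boxplus> \<rho> c21 = Some b1"
    "\<rho> c12 \<boxplus> \<rho> c22 = Some b2"
    using c[THEN \<rho>_sum] \<rho> by (simp_all add: osum_Some_iff)
  then show "\<exists>c11\<in>\<rho> ` carrier E. \<exists>c12\<in>\<rho> ` carrier E. \<exists>c21\<in>\<rho> ` carrier E. \<exists>c22\<in>\<rho> ` carrier E.
      c11 \<boxplus> c12 = Some a1 \<and> c21 \<boxplus> c22 = Some a2 \<and> c11 \<boxplus> c21 = Some b1 \<and> c12 \<boxplus> c22 = Some b2"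
    using cE by blast
qed

sublocale R: rdp_algebra ret
  by (intro rdp_algebra.intro effect_algebra_ret rdp_algebra_axioms.intro rdp_ret)

abbreviation H :: "('a list \<times> 'a list) set pogroup" where "H \<equiv> R.univ"
abbreviation u :: "('a list \<times> 'a list) set" where "u \<equiv> R.iota \<one>\<^sub>E"

definition hh :: "'a \<Rightarrow> ('a list \<times> 'a list) set" where
  "hh x = R.iota (\<rho> x)"

lemma R_osum:
  assumes "a \<in> \<rho> ` carrier E" "b \<in> \<rho> ` carrier E"
  shows "R.osum (Some a) (Some b) = Some a \<uplus> Some b"
proof -
  have "R.osum (Some a) (Some b) = a \<boxplus>\<^bsub>ret\<^esub> b"
    by (rule R.osum_Some) (simp_all only: ret_simps assms)
  also have "\<dots> = a \<boxplus> b" by (rule ret_simps)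
  also have "\<dots> = Some a \<uplus> Some b" using assms osum_Some[of a b] unfolding ret_iff by simp
  finally show ?thesis .
qed

lemma R_le_imp:
  assumes "ea_le ret a b" shows "ea_le E a b"
proof -
  note A = assms[unfolded ea_le_def ret_simps]
  have ab: "a \<in> \<rho> ` carrier E" using A by (elim conjE)
  have "\<exists>c\<in>\<rho> ` carrier E. a \<boxplus> c = Some b" using A by (elim conjE)
  then obtain c where "c \<in> \<rho> ` carrier E" "a \<boxplus> c = Some b" by (elim bexE)
  then have "Some a \<uplus> Some c = Some b" using ab osum_Some[of a c] by (simp add: ret_iff)
  then show ?thesis by (rule leI)
qed

text \<open>If a + c = b with \<open>a\<close> and \<open>b\<close> fixed by \<rho>, then also a +
  \<rho> c = b, so the difference can be chosen in the image.\<close>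

lemma R_le_iff:
  assumes "a \<in> \<rho> ` carrier E" "b \<in> \<rho> ` carrier E"
  shows "ea_le ret a b \<longleftrightarrow> ea_le E a b"
proof
  assume "ea_le E a b"
  then obtain c where c: "c \<in> carrier E" "Some a \<uplus> Some c = Some b" by (rule leE)
  then have "Some a \<uplus> Some (\<rho> c) = Some b" using \<rho>_sum[OF c(2)] assms by (simp add: ret_iff)
  then have "a \<boxplus> \<rho> c = Some b" by (simp add: osum_Some_iff)
  then show "ea_le ret a b" unfolding ea_le_def ret_simps using assms c by blast
qed (rule R_le_imp)

lemma hh_closed: "x \<in> carrier E \<Longrightarrow> hh x \<in> carrier H"
  unfolding hh_def by (intro R.iota_closed) simp

lemma hh_pos: "x \<in> carrier E \<Longrightarrow> hh x \<in> pg_pos H"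
  unfolding hh_def by (intro R.iota_pos) simp

lemma hh_le: "x \<in> carrier E \<Longrightarrow> hh x \<preceq>\<^bsub>H\<^esub> u"
  unfolding hh_def using R.iota_le_iff[of "\<rho> x" "\<one>\<^sub>E"] R.le_one[of "\<rho> x"] R.one_closed by simp

lemma hh_eq_iff:
  assumes "x \<in> carrier E" "y \<in> carrier E" shows "hh x = hh y \<longleftrightarrow> \<rho> x = \<rho> y"
  unfolding hh_def using R.iota_inj[of "\<rho> x" "\<rho> y"] assms by auto

lemma hh_zero: "hh \<zero>\<^sub>E = \<one>\<^bsub>H\<^esub>"
  unfolding hh_def \<rho>_zero using R.iota_zero by simp

lemma hh_one: "hh \<one>\<^sub>E = u"
  unfolding hh_def \<rho>_one ..

lemma hh_eq_one: "x \<in> carrier E \<Longrightarrow> hh x = \<one>\<^bsub>H\<^esub> \<longleftrightarrow> x \<in> I"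
  using hh_eq_iff[of x "\<zero>\<^sub>E"] hh_zero zero_closed I_iff \<rho>_zero by simp

lemma hh_sum_iff:
  assumes "x \<in> carrier E" "y \<in> carrier E" "z \<in> carrier E"
  shows "hh z = hh x \<otimes>\<^bsub>H\<^esub> hh y \<longleftrightarrow> Some (\<rho> x) \<uplus> Some (\<rho> y) = Some (\<rho> z)"
  unfolding hh_def using R.iota_osum_iff[of "\<rho> x" "\<rho> y" "\<rho> z"] R_osum assms by simp

lemma \<gamma>_I: assumes "x \<in> I" shows "\<gamma> x = G.frac x \<zero>\<^sub>E"
proof -
  have x: "x \<in> carrier E" using I_carrier assms .
  have "gam x x \<zero>\<^sub>E"
    using gamI[of "\<zero>\<^sub>E" x x "\<zero>\<^sub>E"] osum_zero x assms zero_I zero_closed I_iff[OF x] by simp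
  then show ?thesis by (rule \<gamma>_eq[OF x])
qed

text \<open>The complement of \<open>f\<close> is mapped to 1 by \<rho>, and it differs from 1 by
  exactly \<open>f\<close>; its second coordinate is therefore -f.\<close>

lemma \<gamma>_compl: assumes f: "f \<in> I" shows "\<gamma> (ea_compl E f) = G.frac \<zero>\<^sub>E f"
proof -
  have x: "f \<in> carrier E" "ea_compl E f \<in> carrier E" using I_carrier f compl by blast+
  have "\<rho> f = \<zero>\<^sub>E" using I_iff x f by blast
  then have "\<rho> (ea_compl E f) = \<one>\<^sub>E"
    using \<rho>_compl[OF x(1)] compl_unique[OF osum_zero(2)[OF one_closed]] by simp
  then have "gam (ea_compl E f) \<zero>\<^sub>E f"
    using gamI[of "ea_compl E f" "\<zero>\<^sub>E" "ea_compl E f" f] osum_zero[OF x(2)] compl(2)[OF x(1)] f zero_I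
    by (simp add: osum_commute)
  then show ?thesis by (rule \<gamma>_eq[OF x(2)])
qed

lemma G_one: "\<one>\<^bsub>G.diffs\<^esub> = G.frac \<zero>\<^sub>E \<zero>\<^sub>E"
  using G.one_diffs by simp

lemma \<rho>_eq_one:
  assumes "x \<in> carrier E" shows "\<rho> x = \<one>\<^sub>E \<longleftrightarrow> ea_compl E x \<in> I"
proof -
  have "ea_compl E \<one>\<^sub>E = \<zero>\<^sub>E" using compl_unique[OF one_zero] by simp
  then have "\<rho> x = \<one>\<^sub>E \<longleftrightarrow> ea_compl E (\<rho> x) = \<zero>\<^sub>E"
    using compl_inj[OF \<rho>_closed[OF assms] one_closed] by auto
  then show ?thesis using I_iff compl(1) assms \<rho>_compl by simp
qed

lemma isum_zero: "e \<in> I \<Longrightarrow> isum e \<zero>\<^sub>E = e" "e \<in> I \<Longrightarrow> isum \<zero>\<^sub>E e = e"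
  using osum_zero I_carrier isum_eqI by blast+

lemma \<gamma>_pos: assumes "x \<in> I" shows "\<one>\<^bsub>G.diffs\<^esub> \<preceq>\<^bsub>G.diffs\<^esub> \<gamma> x"
  unfolding \<gamma>_I[OF assms] G_one using assms zero_I by (auto simp: G.frac_le isum_zero)

lemma \<gamma>_neg:
  assumes x: "x \<in> carrier E" "\<rho> x = \<one>\<^sub>E" shows "\<gamma> x \<preceq>\<^bsub>G.diffs\<^esub> \<one>\<^bsub>G.diffs\<^esub>"
proof -
  define f where "f = ea_compl E x"
  have f: "f \<in> I" "ea_compl E f = x" using \<rho>_eq_one compl_compl x by (simp_all add: f_def)
  have "\<gamma> x = G.frac \<zero>\<^sub>E f" using \<gamma>_compl[OF f(1)] f(2) by simp
  then show ?thesis unfolding G_one using f(1) zero_I by (auto simp: G.frac_le isum_zero)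
qed

text \<open>For s = e - f the preimage is d - f + e, provided it can be formed in E. On level 0
  positivity of \<open>s\<close> makes it an element r = e - f of I; on level 1 it is the complement
  of r = f - e; on the levels in between strictness leaves room for both operations.\<close>

lemma hh_\<gamma>_surj:
  assumes d: "d \<in> \<rho> ` carrier E" and s: "s \<in> carrier G.diffs"
    and pos: "d = \<zero>\<^sub>E \<Longrightarrow> \<one>\<^bsub>G.diffs\<^esub> \<preceq>\<^bsub>G.diffs\<^esub> s" and neg: "d = \<one>\<^sub>E \<Longrightarrow> s \<preceq>\<^bsub>G.diffs\<^esub> \<one>\<^bsub>G.diffs\<^esub>"
  shows "\<exists>x\<in>carrier E. \<rho> x = d \<and> \<gamma> x = s"
proof -
  have dE: "d \<in> carrier E" "\<rho> d = d" using d by (simp_all add: ret_iff)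
  obtain e f where s': "e \<in> carrier I_monoid" "f \<in> carrier I_monoid" "s = G.frac e f"
    using s by (rule G.diffs_E)
  then have I: "e \<in> I" "f \<in> I" by simp_all
  have E: "e \<in> carrier E" "f \<in> carrier E" using I I_carrier by blast+
  have \<rho>0: "\<rho> e = \<zero>\<^sub>E" "\<rho> f = \<zero>\<^sub>E" using I_iff E I by blast+
  consider "d = \<zero>\<^sub>E" | "d = \<one>\<^sub>E" | "d \<noteq> \<zero>\<^sub>E" "d \<noteq> \<one>\<^sub>E" by blast
  then show ?thesis
  proof cases
    case 1
    then have "\<exists>r\<in>I. isum (isum \<zero>\<^sub>E f) r = isum e \<zero>\<^sub>E"
      using pos s' I zero_I unfolding G_one by (simp add: G.frac_le)
    then obtain r where r: "r \<in> I" "isum f r = e" using I by (auto simp: isum_zero)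
    have "\<gamma> r = s" unfolding \<gamma>_I[OF r(1)] s' using r I zero_I
      by (simp add: G.frac_eq isum_zero) (simp add: isum_def osum_commute)
    then show ?thesis using I_iff I_carrier r 1 by blast
  next
    case 2
    then have "\<exists>r\<in>I. isum (isum e \<zero>\<^sub>E) r = isum \<zero>\<^sub>E f"
      using neg s' I zero_I unfolding G_one by (simp add: G.frac_le)
    then obtain r where r: "r \<in> I" "isum e r = f" using I by (auto simp: isum_zero)
    have rE: "r \<in> carrier E" "ea_compl E r \<in> carrier E" using r I_carrier compl by blast+
    have "\<gamma> (ea_compl E r) = s" unfolding \<gamma>_compl[OF r(1)] s' using r I zero_I
      by (simp add: G.frac_eq isum_zero)
    moreover have "\<rho> (ea_compl E r) = \<one>\<^sub>E"
      using \<rho>_eq_one[OF rE(2)] compl_compl[OF rE(1)] r by simp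
    ultimately show ?thesis using 2 rE by blast
  next
    case 3
    \<comment> \<open>Elements of I are mapped to 0 by \<rho>, and d is neither 0 nor 1. So
      \<open>f\<close> lies strictly below \<open>d\<close>, and once r = d - f is formed,
      \<open>e\<close> lies below the complement of \<open>r\<close>, because r is still on level
      \<open>d\<close>.\<close>
    have "ea_le E f d"
      using strict_le[OF E(2) dE(1)] \<rho>0 dE zero_le 3 by auto
    then obtain r where r: "r \<in> carrier E" "Some r \<uplus> Some f = Some d" by (metis leE osum_commute)
    have \<rho>r: "\<rho> r = d" using \<rho>_sum[OF r(2)] \<rho>0 dE osum_zero(1)[OF \<rho>_closed[OF r(1)]] by simp
    have rc: "ea_compl E r \<in> carrier E" using compl r by blast
    have "\<rho> (ea_compl E r) \<noteq> \<zero>\<^sub>E"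
    proof
      assume "\<rho> (ea_compl E r) = \<zero>\<^sub>E"
      then have "ea_compl E r \<in> I" using I_iff rc by blast
      then show False using \<rho>_eq_one[OF r(1)] \<rho>r 3 by simp
    qed
    then have "ea_le E e (ea_compl E r)"
      using strict_le[OF E(1) rc] \<rho>0 zero_le[OF \<rho>_closed[OF rc]] by auto
    then obtain x where x: "Some r \<uplus> Some e = Some x"
      using osum_defined_iff[OF E(1) r(1)] by (auto simp: osum_commute)
    have xE: "x \<in> carrier E" using osum_closed x by blast
    have \<rho>x: "\<rho> x = d" using \<rho>_sum[OF x] \<rho>0 \<rho>r osum_zero(1)[OF dE(1)] by simp
    have "gam x e f" using gamI[OF x _ I] r(2) \<rho>x by simp
    then have "\<gamma> x = s" using \<gamma>_eq xE s' by simp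
    then show ?thesis using xE \<rho>x by blast
  qed
qed

lemma hh_ne: "u \<noteq> \<one>\<^bsub>H\<^esub>"
  using hh_eq_one[OF one_closed] one_notin_I hh_one by simp

text \<open>The lexicographic order is nowhere compared directly: it enters only through the range
  of the coordinate map, that is, through the sign of the second coordinate on the levels 0 and
  \<open>u\<close>.\<close>

lemma lex_rep_E: "lex_rep H G.diffs E hh \<gamma> u"
proof (intro lex_rep.intro lex_rep_axioms.intro interval_rep.intro interval_rep_axioms.intro
    lex_product.intro)
  interpret lex_product H G.diffs
    by (intro lex_product.intro R.W.abelian_po_group_diffs G.abelian_po_group_diffs)
  show "abelian_po_group H" "abelian_po_group G.diffs" "effect_algebra E"
    by (rule R.W.abelian_po_group_diffs G.abelian_po_group_diffs effect_algebra_axioms)+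
  show "abelian_po_group (H \<times>\<^sub>l\<^sub>e\<^sub>x G.diffs)" by (rule abelian_po_group_lex)
  show u: "u \<in> pg_pos H" using hh_pos[OF one_closed] hh_one by simp
  show "u \<noteq> \<one>\<^bsub>H\<^esub>" by (rule hh_ne)
  show "pg_directed G.diffs" by (rule G.directed_diffs)
  show "(u, \<one>\<^bsub>G.diffs\<^esub>) \<in> pg_pos (H \<times>\<^sub>l\<^sub>e\<^sub>x G.diffs)"
    using R.W.D.posD[OF u] G.D.le_refl by (auto simp: pg_pos_def)
  show "(hh \<one>\<^sub>E, \<gamma> \<one>\<^sub>E) = (u, \<one>\<^bsub>G.diffs\<^esub>)"
    using \<gamma>_compl[OF zero_I] compl_unique[OF osum_zero(2)[OF one_closed]] hh_one G_one by simp
  fix x y z assume E: "x \<in> carrier E" "y \<in> carrier E" "z \<in> carrier E"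
  show "Some x \<uplus> Some y = Some z \<longleftrightarrow>
      (hh z, \<gamma> z) = (hh x, \<gamma> x) \<otimes>\<^bsub>H \<times>\<^sub>l\<^sub>e\<^sub>x G.diffs\<^esub> (hh y, \<gamma> y)"
    using hh_sum_iff[OF E] \<rho>_sum[of x y z] \<gamma>_sum[of x y z] sum_if_\<gamma>[OF E] by auto
next
  show "bij_betw (\<lambda>x. (hh x, \<gamma> x)) (carrier E) (carrier (Gamma (H \<times>\<^sub>l\<^sub>e\<^sub>x G.diffs) (u, \<one>\<^bsub>G.diffs\<^esub>)))"
    unfolding bij_betw_def
  proof (intro conjI equalityI subsetI)
    show "inj_on (\<lambda>x. (hh x, \<gamma> x)) (carrier E)"
    proof (rule inj_onI)
      fix x y assume x: "x \<in> carrier E" and y: "y \<in> carrier E" and eq: "(hh x, \<gamma> x) = (hh y, \<gamma> y)"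
      \<comment> \<open>Injectivity follows from the reflection of sums: equal coordinates satisfy
        the coordinate equations for x + 0 = y.\<close>
      have "Some (\<rho> x) \<uplus> Some (\<rho> \<zero>\<^sub>E) = Some (\<rho> y)"
        using eq hh_eq_iff x y \<rho>_zero osum_zero \<rho>_closed by simp
      moreover have "\<gamma> y = \<gamma> x \<otimes>\<^bsub>G.diffs\<^esub> \<gamma> \<zero>\<^sub>E"
        unfolding \<gamma>_I[OF zero_I] G_one[symmetric] G.D.r_one[OF \<gamma>_closed[OF x]]
        using eq by (metis prod.inject)
      ultimately have "Some x \<uplus> Some \<zero>\<^sub>E = Some y" using sum_if_\<gamma> x y zero_closed by blast
      then show "x = y" using osum_zero x by simp
    qed
  next
    fix p assume "p \<in> (\<lambda>x. (hh x, \<gamma> x)) ` carrier E"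
    then obtain x where x: "x \<in> carrier E" "p = (hh x, \<gamma> x)" by blast
    have "\<one>\<^bsub>G.diffs\<^esub> \<preceq>\<^bsub>G.diffs\<^esub> \<gamma> x" if "hh x = \<one>\<^bsub>H\<^esub>" using \<gamma>_pos hh_eq_one x that by simp
    moreover have "\<gamma> x \<preceq>\<^bsub>G.diffs\<^esub> \<one>\<^bsub>G.diffs\<^esub>" if "hh x = u"
      using \<gamma>_neg x that hh_eq_iff[OF x(1) one_closed] hh_one \<rho>_one by simp
    ultimately show "p \<in> carrier (Gamma (H \<times>\<^sub>l\<^sub>e\<^sub>x G.diffs) (u, \<one>\<^bsub>G.diffs\<^esub>))"
      using hh_closed[OF x(1)] \<gamma>_closed[OF x(1)] hh_le[OF x(1)] R.W.D.posD(2)[OF hh_pos[OF x(1)]]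
      unfolding x(2) by auto
  next
    fix p assume "p \<in> carrier (Gamma (H \<times>\<^sub>l\<^sub>e\<^sub>x G.diffs) (u, \<one>\<^bsub>G.diffs\<^esub>))"
    then obtain k s where p: "p = (k, s)" "k \<in> carrier H" "s \<in> carrier G.diffs"
      and pos: "\<one>\<^bsub>H\<^esub> \<preceq>\<^bsub>H\<^esub> k \<and> \<one>\<^bsub>H\<^esub> \<noteq> k \<or> \<one>\<^bsub>H\<^esub> = k \<and> \<one>\<^bsub>G.diffs\<^esub> \<preceq>\<^bsub>G.diffs\<^esub> s"
      and neg: "k \<preceq>\<^bsub>H\<^esub> u \<and> k \<noteq> u \<or> k = u \<and> s \<preceq>\<^bsub>G.diffs\<^esub> \<one>\<^bsub>G.diffs\<^esub>"
      by (cases p) auto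
    have "\<one>\<^bsub>H\<^esub> \<preceq>\<^bsub>H\<^esub> k" "k \<preceq>\<^bsub>H\<^esub> u" using pos neg p(2) R.W.D.le_refl by auto
    then have "k \<in> R.iota ` carrier ret" using R.iota_surj p(2) by simp
    then obtain d where d: "d \<in> \<rho> ` carrier E" "k = R.iota d" by auto
    have "\<one>\<^bsub>G.diffs\<^esub> \<preceq>\<^bsub>G.diffs\<^esub> s" if "d = \<zero>\<^sub>E" using pos d that R.iota_zero by auto
    moreover have "s \<preceq>\<^bsub>G.diffs\<^esub> \<one>\<^bsub>G.diffs\<^esub>" if "d = \<one>\<^sub>E" using neg d that by auto
    ultimately obtain x where "x \<in> carrier E" "\<rho> x = d" "\<gamma> x = s"
      using hh_\<gamma>_surj[OF d(1) p(3)] by blast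
    then show "p \<in> (\<lambda>x. (hh x, \<gamma> x)) ` carrier E" unfolding p(1) d(2) hh_def by force
  qed
qed

text \<open>Primeness passes to the image of \<open>\<rho>\<close>: for every \<open>y\<close> the elements \<open>z\<close> all of whose common
  lower bounds with \<open>y\<close> lie in \<open>I\<close> form an ideal.\<close>

lemma disjoint_ideal:
  assumes "y \<in> carrier E"
  shows "ea_ideal E {z \<in> carrier E. \<forall>w. ea_le E w z \<and> ea_le E w y \<longrightarrow> w \<in> I}" (is "ea_ideal E ?K")
proof (rule idealI)
  have "\<zero>\<^sub>E \<in> ?K" using zero_closed le_zero zero_I by auto
  then show "?K \<noteq> {}" by blast
  fix a b assume "ea_le E a b" "b \<in> ?K"
  then show "a \<in> ?K" using le_trans le_closed by blast
next
  fix a b c assume a: "a \<in> ?K" and b: "b \<in> ?K" and s: "Some a \<uplus> Some b = Some c"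
  have "w \<in> I" if w: "ea_le E w c" "ea_le E w y" for w
  proof -
    obtain v where v: "Some w \<uplus> Some v = Some c" using w(1) by (rule leE)
    \<comment> \<open>RDP splits \<open>w\<close>, which lies below a + b, into a part below
      \<open>a\<close> and a part below \<open>b\<close>.\<close>
    obtain w1 w2 v1 v2 where *: "Some w1 \<uplus> Some w2 = Some w" "Some v1 \<uplus> Some v2 = Some v"
      "Some w1 \<uplus> Some v1 = Some a" "Some w2 \<uplus> Some v2 = Some b"
      by (rule rdp_osum[OF rdp v s])
    have "Some w2 \<uplus> Some w1 = Some w" using *(1) by (simp add: osum_commute)
    then have "ea_le E w1 y" "ea_le E w2 y" using le_trans[OF leI w(2)] *(1) by blast+
    moreover have "ea_le E w1 a" "ea_le E w2 b" using leI *(3,4) by blast+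
    ultimately have "w1 \<in> I" "w2 \<in> I" using a b by blast+
    then show "w \<in> I" using I_sum *(1) by blast
  qed
  then show "c \<in> ?K" using osum_closed(3)[OF s] by blast
qed auto

text \<open>Suppose that \<open>a\<close> and \<open>b\<close> have no nonzero common lower bound in
  the image of \<rho>. Since \<rho> maps common lower bounds in E to common lower bounds in the
  image, all of the former lie in I. This passes to the principal ideals of \<open>a\<close> and
  \<open>b\<close>, so by primeness one of \<open>a\<close>, \<open>b\<close> lies in I and is 0,
  being fixed by \<rho>.\<close>

lemma antilattice_H: "antilattice (pg_order H)"
proof (rule R.antilattice_univ, unfold ret_simps)
  fix a b assume *: "a \<in> \<rho> ` carrier E" "b \<in> \<rho> ` carrier E" "a \<noteq> \<zero>\<^sub>E" "b \<noteq> \<zero>\<^sub>E"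
  then have E: "a \<in> carrier E" "b \<in> carrier E" and \<rho>: "\<rho> a = a" "\<rho> b = b" by (simp_all add: ret_iff)
  show "\<exists>w. w \<noteq> \<zero>\<^sub>E \<and> ea_le ret w a \<and> ea_le ret w b"
  proof (rule ccontr)
    assume no: "\<not> (\<exists>w. w \<noteq> \<zero>\<^sub>E \<and> ea_le ret w a \<and> ea_le ret w b)"
    have low: "v \<in> I" if v: "ea_le E v a" "ea_le E v b" for v
    proof -
      have vE: "v \<in> carrier E" using v le_closed by blast
      have "ea_le E (\<rho> v) c" if "ea_le E v c" "\<rho> c = c" for c
        using \<rho>_sum that leI by (metis leE)
      then have "ea_le ret (\<rho> v) a" "ea_le ret (\<rho> v) b" using R_le_iff * vE v \<rho> by simp_all
      then show ?thesis using no I_iff vE by blast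
    qed
    have "z \<in> I" if za: "z \<in> ea_principal E a" and zb: "z \<in> ea_principal E b" for z
    proof -
      \<comment> \<open>The ideal of elements disjoint from \<open>b\<close> modulo I contains
        \<open>a\<close>, hence the whole principal ideal of \<open>a\<close>.\<close>
      have "a \<in> {z \<in> carrier E. \<forall>w. ea_le E w z \<and> ea_le E w b \<longrightarrow> w \<in> I}" using E low by blast
      then have z: "z \<in> carrier E" "\<And>w. ea_le E w z \<Longrightarrow> ea_le E w b \<Longrightarrow> w \<in> I"
        using za disjoint_ideal[OF E(2)] unfolding ea_principal_def by blast+
      \<comment> \<open>The same argument with \<open>z\<close> in the role of \<open>b\<close>: the
        elements disjoint from \<open>z\<close> modulo I contain the principal ideal of
        \<open>b\<close>, hence \<open>z\<close> itself, and \<open>z\<close> is a lower bound of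
        \<open>z\<close> and \<open>z\<close>.\<close>
      have "b \<in> {v \<in> carrier E. \<forall>w. ea_le E w v \<and> ea_le E w z \<longrightarrow> w \<in> I}" using E z by blast
      then have "z \<in> {v \<in> carrier E. \<forall>w. ea_le E w v \<and> ea_le E w z \<longrightarrow> w \<in> I}"
        using zb disjoint_ideal[OF z(1)] unfolding ea_principal_def by blast
      then show ?thesis using le_refl by blast
    qed
    then have "ea_principal E a \<inter> ea_principal E b \<subseteq> I" by blast
    then have "a \<in> I \<or> b \<in> I"
      using lexicographic_ideal.prime[OF lex] E unfolding ea_prime_def by blast
    then show False using I_iff E \<rho> * by auto
  qed
qed

lemma nontrivial_G: "pg_nontrivial G.diffs"
proof -
  obtain e where e: "e \<in> I" "e \<noteq> \<zero>\<^sub>E"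
    using zero_I lexicographic_ideal.not_zero[OF lex] by blast
  then have "G.emb e \<noteq> G.emb \<zero>\<^sub>E" using G.emb_eq_iff zero_I by simp
  moreover have "G.emb e \<in> carrier G.diffs" using G.emb_closed e by simp
  ultimately show ?thesis using G.emb_one unfolding pg_nontrivial_def by auto
qed

lemma representation:
  "\<exists>(H :: ('a list \<times> 'a list) set pogroup) u (G :: ('a \<times> 'a) set pogroup).
      abelian_po_group H \<and> pg_strong_unit H u \<and> antilattice (pg_order H) \<and> pg_rdp H \<and>
      ea_quot E I \<cong>\<^sub>e Gamma H u \<and>
      abelian_po_group G \<and> pg_nontrivial G \<and> pg_directed G \<and> pg_rdp G \<and>
      ea_generated E I \<cong>\<^sub>e Gamma (int_pogroup \<times>\<^sub>l\<^sub>e\<^sub>x G) (1, \<one>\<^bsub>G\<^esub>) \<and>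
      E \<cong>\<^sub>e Gamma (H \<times>\<^sub>l\<^sub>e\<^sub>x G) (u, \<one>\<^bsub>G\<^esub>)"
proof -
  interpret X: lex_rep H G.diffs E hh \<gamma> u by (rule lex_rep_E)
  \<comment> \<open>The first coordinate vanishes exactly on I, so the results on the elements with
    first component 0 concern the given ideal.\<close>
  have I: "X.inf_ideal = I" using hh_eq_one I_sub unfolding X.inf_ideal_def by blast
  have "E \<cong>\<^sub>e Gamma (H \<times>\<^sub>l\<^sub>e\<^sub>x G.diffs) (u, \<one>\<^bsub>G.diffs\<^esub>)"
  proof (rule X.L.iso_GammaI[OF X.L.posD(1)[OF X.v_pos] X.bij one_closed X.f_one])
    fix x y z assume E: "x \<in> carrier E" "y \<in> carrier E"
    show "z \<in> carrier E" if "x \<boxplus> y = Some z" using plus_closed E that by blast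
    assume "z \<in> carrier E"
    then show "x \<boxplus> y = Some z \<longleftrightarrow> (hh z, \<gamma> z) = (hh x, \<gamma> x) \<otimes>\<^bsub>H \<times>\<^sub>l\<^sub>e\<^sub>x G.diffs\<^esub> (hh y, \<gamma> y)"
      using X.sum E osum_Some by simp
  qed
  moreover have "pg_strong_unit H u" using R.strong_unit_univ by simp
  ultimately show ?thesis
    using X.quot_iso X.generated_iso R.W.abelian_po_group_diffs antilattice_H R.W.rdp_diffs
      G.abelian_po_group_diffs nontrivial_G G.directed_diffs G.rdp_diffs
    unfolding I by (intro exI[of _ H] exI[of _ u] exI[of _ G.diffs] conjI)
qed

end

theorem theorem6p5:
  fixes E :: "'a effalg"
  assumes "effect_algebra E"
  shows "(\<forall>I. ea_rdp E \<and> lexicographic_ideal E I \<longrightarrow>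
      (\<exists>(H :: ('a list \<times> 'a list) set pogroup) u (G :: ('a \<times> 'a) set pogroup).
        abelian_po_group H \<and> pg_strong_unit H u \<and> antilattice (pg_order H) \<and> pg_rdp H \<and>
        ea_quot E I \<cong>\<^sub>e Gamma H u \<and>
        abelian_po_group G \<and> pg_nontrivial G \<and> pg_directed G \<and> pg_rdp G \<and>
        ea_generated E I \<cong>\<^sub>e Gamma (int_pogroup \<times>\<^sub>l\<^sub>e\<^sub>x G) (1, \<one>\<^bsub>G\<^esub>) \<and>
        E \<cong>\<^sub>e Gamma (H \<times>\<^sub>l\<^sub>e\<^sub>x G) (u, \<one>\<^bsub>G\<^esub>)))
    \<and>
    (\<forall>(H :: 'h pogroup) u (G :: 'g pogroup).
        abelian_po_group H \<and> pg_strong_unit H u \<and> pg_nontrivial H \<and>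
        antilattice (pg_order H) \<and> pg_rdp H \<and>
        abelian_po_group G \<and> pg_nontrivial G \<and> pg_directed G \<and> pg_rdp G \<and>
        E \<cong>\<^sub>e Gamma (H \<times>\<^sub>l\<^sub>e\<^sub>x G) (u, \<one>\<^bsub>G\<^esub>) \<longrightarrow>
      (\<exists>I. lexicographic_ideal E I \<and>
        ea_quot E I \<cong>\<^sub>e Gamma H u \<and>
        ea_generated E I \<cong>\<^sub>e Gamma (int_pogroup \<times>\<^sub>l\<^sub>e\<^sub>x G) (1, \<one>\<^bsub>G\<^esub>)))"
proof (intro conjI allI impI, goal_cases)
  case (1 I)
  then have rdp: "ea_rdp E" and lex: "lexicographic_ideal E I" by simp_all
  obtain \<delta> where \<delta>: "\<delta> \<in> ea_hom (ea_quot E I) E"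
    "\<And>X. X \<in> carrier (ea_quot E I) \<Longrightarrow> ea_proj E I (\<delta> X) = X"
    using lexicographic_ideal.retractive[OF lex] unfolding ea_retractive_def by blast
  interpret lex_retract E I \<delta>
    by (intro lex_retract.intro rdp_algebra.intro rdp_algebra_axioms.intro lex_retract_axioms.intro
        assms rdp lex \<delta>)
  show ?case by (rule representation)
next
  case (2 H u G)
  then show ?case by (elim conjE) (rule lexicographic_ideal_of_iso[OF assms])
qed

end
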